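(* Let $k$ be an algebraically closed field and let $A$ be a finite-dimensional basic $k$-algebra with $n$ pairwise non-isomorphic simple modules. Then each $c$-vector $c\in\mathbb{Z}^n$ of $A$ is sign-coherent, i.e. either all entries of $c$ are nonnegative or all entries of $c$ are nonpositive.
   Context: All modules are finitely generated right modules; $\operatorname{mod} A$ is their category and $\tau$ its Auslander–Reiten translation. Let $S_1,\dots,S_n$ be the pairwise non-isomorphic simple $A$-modules with projective covers $P_1,\dots,P_n$. For a module $X$, $|X|$ is the number of non-isomorphic indecomposable direct summands of $X$. An $A$-module $M$ is $\tau$-rigid if $\operatorname{Hom}_A(M,\tau M)=0$. A $\tau$-rigid pair $(M,P)$ consists of a $\tau$-rigid module $M$ and a finitely generated projective module $P$ with $\operatorname{Hom}_A(P,M)=0$; it is a support $\tau$-tilting pair if moreover $|M|+|P|=n$, and it is basic if $M$ and $P$ are basic. $g$-vectors: for a $\tau$-rigid $M$ with minimal projective presentation $P_1^M\to P_0^M\to M\to 0$, $g(M)=(g_1,\dots,g_n)^T\in\mathbb{Z}^n$, where $g_i$ is the multiplicity of $P_i$ in $P_0^M$ minus the multiplicity of $P_i$ in $P_1^M$. $c$-vectors: for a basic support $\tau$-tilting pair $(M,P)$ with decompositions into indecomposables $M=\bigoplus_{i=1}^tM_i$, $P=\bigoplus_{i=t+1}^nP_i^M$, put $G_{(M,P)}=(g(M_1),\dots,g(M_t),-g(P_{t+1}^M),\dots,-g(P_n^M))\in M_n(\mathbb{Z})$ (columns). It is known that $G_{(M,P)}$ is invertible over $\mathbb{Z}$; the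 $C$-matrix is $C_{(M,P)}=(G_{(M,P)}^T)^{-1}$. The columns of the matrices $C_{(M,P)}$, over all basic support $\tau$-tilting pairs $(M,P)$, are the $c$-vectors of $A$. *)

theory Defs
  imports "HOL-Library.Function_Algebras" "HOL-Computational_Algebra.Polynomial" "Jordan_Normal_Form.Matrix"
begin

text \<open>
  A module has as carrier a subspace of an ambient vector space, so that submodules are
  carriers of the same record and Hom-spaces and dual spaces are again records of this kind.
  The same record serves for left and right modules: \<open>act M a x\<close> is \<open>x \<cdot> a\<close> in a right module
  and \<open>a \<cdot> x\<close> in a left module; only the associativity law differs.
\<close>

record ('k, 'a, 'm) amod =
  car :: "'m set"
  smul :: "'k \<Rightarrow> 'm \<Rightarrow> 'm"
  act :: "'a \<Rightarrow> 'm \<Rightarrow> 'm"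

text \<open>
  Every finite-dimensional vector space over \<open>'k\<close> embeds into \<open>nat \<Rightarrow> 'k\<close>. Hence every
  finite-dimensional module is isomorphic to one of the following type, which is the universe
  over which modules are quantified.
\<close>

type_synonym ('k, 'a) umod = "('k, 'a, nat \<Rightarrow> 'k) amod"

definition mhom :: "('k, 'a, 'm::ab_group_add) amod \<Rightarrow> ('k, 'a, 'l::ab_group_add) amod \<Rightarrow> ('m \<Rightarrow> 'l) \<Rightarrow> bool" where
  "mhom M N f \<longleftrightarrow>
     (\<forall>x\<in>car M. f x \<in> car N) \<and>
     (\<forall>x\<in>car M. \<forall>y\<in>car M. f (x + y) = f x + f y) \<and>
     (\<forall>c. \<forall>x\<in>car M. f (smul M c x) = smul N c (f x)) \<and>
     (\<forall>a. \<forall>x\<in>car M. f (act M a x) = act N a (f x))"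

definition hom_zero :: "('k, 'a, 'm::ab_group_add) amod \<Rightarrow> ('k, 'a, 'l::ab_group_add) amod \<Rightarrow> bool" where
  "hom_zero M N \<longleftrightarrow> (\<forall>f. mhom M N f \<longrightarrow> (\<forall>x\<in>car M. f x = 0))"

definition mod_iso :: "('k, 'a, 'm::ab_group_add) amod \<Rightarrow> ('k, 'a, 'l::ab_group_add) amod \<Rightarrow> bool" where
  "mod_iso M N \<longleftrightarrow> (\<exists>f. mhom M N f \<and> bij_betw f (car M) (car N))"

definition mker :: "('k, 'a, 'm::ab_group_add) amod \<Rightarrow> ('m \<Rightarrow> 'l::ab_group_add) \<Rightarrow> 'm set" where
  "mker M f = {x \<in> car M. f x = 0}"

definition submodule :: "'m set \<Rightarrow> ('k::field, 'a, 'm::ab_group_add) amod \<Rightarrow> bool" where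
  "submodule V M \<longleftrightarrow> V \<subseteq> car M \<and> module.subspace (smul M) V \<and> (\<forall>a. \<forall>x\<in>V. act M a x \<in> V)"

definition submod :: "('k, 'a, 'm) amod \<Rightarrow> 'm set \<Rightarrow> ('k, 'a, 'm) amod" where
  "submod M V = M\<lparr>car := V\<rparr>"

definition set_sum :: "'m::ab_group_add set \<Rightarrow> 'm set \<Rightarrow> 'm set" where
  "set_sum V W = {v + w | v w. v \<in> V \<and> w \<in> W}"

definition superfluous :: "'m set \<Rightarrow> ('k::field, 'a, 'm::ab_group_add) amod \<Rightarrow> bool" where
  "superfluous V M \<longleftrightarrow> submodule V M \<and>
     (\<forall>W. submodule W M \<and> set_sum V W = car M \<longrightarrow> W = car M)"

definition complementary :: "('k::field, 'a, 'm::ab_group_add) amod \<Rightarrow> 'm set \<Rightarrow> 'm set \<Rightarrow> bool" where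
  "complementary M V W \<longleftrightarrow> submodule V M \<and> submodule W M \<and> V \<inter> W = {0} \<and> set_sum V W = car M"

definition indecomposable :: "('k::field, 'a, 'm::ab_group_add) amod \<Rightarrow> bool" where
  "indecomposable M \<longleftrightarrow> car M \<noteq> {0} \<and>
     (\<forall>V W. complementary M V W \<longrightarrow> V = {0} \<or> W = {0})"

text \<open>\<open>indec_decomp M t N\<close>: \<open>M\<close> is the internal direct sum of its indecomposable
  submodules \<open>N 0, \<dots>, N (t - 1)\<close>.\<close>

definition indec_decomp :: "('k::field, 'a, 'm::ab_group_add) amod \<Rightarrow> nat \<Rightarrow> (nat \<Rightarrow> 'm set) \<Rightarrow> bool" where
  "indec_decomp M t N \<longleftrightarrow>
     (\<forall>i<t. submodule (N i) M \<and> indecomposable (submod M (N i))) \<and>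
     (\<forall>x\<in>car M. \<exists>!y. y \<in> PiE {..<t} N \<and> x = (\<Sum>i<t. y i))"

definition basic_module :: "('k::field, 'a, 'm::ab_group_add) amod \<Rightarrow> bool" where
  "basic_module M \<longleftrightarrow> (\<exists>t N. indec_decomp M t N \<and>
     (\<forall>i<t. \<forall>j<t. i \<noteq> j \<longrightarrow> \<not> mod_iso (submod M (N i)) (submod M (N j))))"

definition indec_summands :: "('k::field, 'a, 'm::ab_group_add) amod \<Rightarrow> 'm set set" where
  "indec_summands M = {V. (\<exists>W. complementary M V W) \<and> indecomposable (submod M V)}"

definition num_summands :: "('k::field, 'a, 'm::ab_group_add) amod \<Rightarrow> nat" where
  "num_summands M = card (indec_summands M //
     {(V, W) \<in> indec_summands M \<times> indec_summands M. mod_iso (submod M V) (submod M W)})"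

text \<open>The number of summands of a given decomposition that are isomorphic to \<open>Q\<close>; by
  Krull-Schmidt it does not depend on the decomposition.\<close>

definition multiplicity_in ::
    "('k::field, 'a, 'l::ab_group_add) amod \<Rightarrow> ('k, 'a, 'm::ab_group_add) amod \<Rightarrow> nat \<Rightarrow> (nat \<Rightarrow> 'm set) \<Rightarrow> nat" where
  "multiplicity_in Q M t N = card {j. j < t \<and> mod_iso (submod M (N j)) Q}"

text \<open>The dual \<open>D T = Hom\<^sub>k(T, k)\<close>. If \<open>T\<close> is a left module, this is a right module. Linear
  forms are normalised to vanish outside the carrier.\<close>

definition kdual :: "('k::field, 'a, 'm::ab_group_add) amod \<Rightarrow> ('k, 'a, 'm \<Rightarrow> 'k) amod" where
  "kdual T = \<lparr>car = {\<phi>. (\<forall>x\<in>car T. \<forall>y\<in>car T. \<phi> (x + y) = \<phi> x + \<phi> y) \<and>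
                        (\<forall>c. \<forall>x\<in>car T. \<phi> (smul T c x) = c * \<phi> x) \<and>
                        (\<forall>x. x \<notin> car T \<longrightarrow> \<phi> x = 0)},
              smul = (\<lambda>c \<phi> x. c * \<phi> x),
              act = (\<lambda>a \<phi> x. if x \<in> car T then \<phi> (act T a x) else 0)\<rparr>"

text \<open>The sort of \<open>'a\<close> is that of unital rings, without the requirement \<open>0 \<noteq> 1\<close>.\<close>

locale fd_algebra = vector_space scale
  for scale :: "'k::field \<Rightarrow> 'a::{ring,monoid_mult} \<Rightarrow> 'a" +
  assumes scale_mult_left: "scale c a * b = scale c (a * b)"
    and scale_mult_right: "a * scale c b = scale c (a * b)"
    and finite_dim: "\<exists>B. finite B \<and> span B = UNIV"
begin

definition bilinear_action :: "('k, 'a, 'm::ab_group_add) amod \<Rightarrow> bool" where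
  "bilinear_action M \<longleftrightarrow>
     vector_space (smul M) \<and> module.subspace (smul M) (car M) \<and>
     (\<forall>a. \<forall>x\<in>car M. act M a x \<in> car M) \<and>
     (\<forall>a. \<forall>x\<in>car M. \<forall>y\<in>car M. act M a (x + y) = act M a x + act M a y) \<and>
     (\<forall>a b. \<forall>x\<in>car M. act M (a + b) x = act M a x + act M b x) \<and>
     (\<forall>c a. \<forall>x\<in>car M. act M a (smul M c x) = smul M c (act M a x)) \<and>
     (\<forall>c a. \<forall>x\<in>car M. act M (scale c a) x = smul M c (act M a x)) \<and>
     (\<forall>x\<in>car M. act M 1 x = x)"

definition right_module :: "('k, 'a, 'm::ab_group_add) amod \<Rightarrow> bool" where
  "right_module M \<longleftrightarrow> bilinear_action M \<and>
     (\<forall>a b. \<forall>x\<in>car M. act M (a * b) x = act M b (act M a x))"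

definition left_module :: "('k, 'a, 'm::ab_group_add) amod \<Rightarrow> bool" where
  "left_module M \<longleftrightarrow> bilinear_action M \<and>
     (\<forall>a b. \<forall>x\<in>car M. act M (a * b) x = act M a (act M b x))"

definition fg_module :: "('k, 'a, 'm::ab_group_add) amod \<Rightarrow> bool" where
  "fg_module M \<longleftrightarrow> right_module M \<and>
     (\<exists>F. finite F \<and> F \<subseteq> car M \<and> (\<forall>x\<in>car M. \<exists>c. x = (\<Sum>y\<in>F. act M (c y) y)))"

definition regular :: "('k, 'a, 'a) amod" where
  "regular = \<lparr>car = UNIV, smul = scale, act = (\<lambda>a x. x * a)\<rparr>"

definition basic_algebra :: bool where
  "basic_algebra \<longleftrightarrow> basic_module regular"

definition simple_module :: "('k, 'a) umod \<Rightarrow> bool" where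
  "simple_module S \<longleftrightarrow> fg_module S \<and> car S \<noteq> {0} \<and>
     (\<forall>V. submodule V S \<longrightarrow> V = {0} \<or> V = car S)"

definition simple_representatives :: "nat \<Rightarrow> (nat \<Rightarrow> ('k, 'a) umod) \<Rightarrow> bool" where
  "simple_representatives n S \<longleftrightarrow>
     (\<forall>i<n. simple_module (S i)) \<and>
     (\<forall>i<n. \<forall>j<n. i \<noteq> j \<longrightarrow> \<not> mod_iso (S i) (S j)) \<and>
     (\<forall>X. simple_module X \<longrightarrow> (\<exists>i<n. mod_iso X (S i)))"

definition projective :: "('k, 'a) umod \<Rightarrow> bool" where
  "projective P \<longleftrightarrow> fg_module P \<and>
     (\<forall>(X :: ('k, 'a) umod) (Y :: ('k, 'a) umod) g h.
        fg_module X \<and> fg_module Y \<and> mhom X Y g \<and> g ` car X = car Y \<and> mhom P Y h \<longrightarrow>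
        (\<exists>l. mhom P X l \<and> (\<forall>p\<in>car P. g (l p) = h p)))"

definition projective_cover ::
    "('k, 'a) umod \<Rightarrow> ((nat \<Rightarrow> 'k) \<Rightarrow> (nat \<Rightarrow> 'k)) \<Rightarrow> ('k, 'a) umod \<Rightarrow> bool" where
  "projective_cover P e M \<longleftrightarrow> projective P \<and> fg_module M \<and> mhom P M e \<and> e ` car P = car M \<and>
     superfluous (mker P e) P"

definition min_proj_presentation ::
    "('k, 'a) umod \<Rightarrow> ((nat \<Rightarrow> 'k) \<Rightarrow> (nat \<Rightarrow> 'k)) \<Rightarrow> ('k, 'a) umod \<Rightarrow>
     ((nat \<Rightarrow> 'k) \<Rightarrow> (nat \<Rightarrow> 'k)) \<Rightarrow> ('k, 'a) umod \<Rightarrow> bool" where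
  "min_proj_presentation P1 f P0 e M \<longleftrightarrow>
     projective_cover P0 e M \<and> projective_cover P1 f (submod P0 (mker P0 e))"

text \<open>The left module \<open>Hom\<^sub>A(P, A)\<close> with \<open>(a \<cdot> g)(x) = a * g x\<close>, and the map
  \<open>Hom\<^sub>A(f, A)\<close> for \<open>f\<close> with domain \<open>P1\<close>; maps are normalised to vanish outside the carrier.\<close>

definition hom_to_A :: "('k, 'a, 'm::ab_group_add) amod \<Rightarrow> ('k, 'a, 'm \<Rightarrow> 'a) amod" where
  "hom_to_A P = \<lparr>car = {g. mhom P regular g \<and> (\<forall>x. x \<notin> car P \<longrightarrow> g x = 0)},
                 smul = (\<lambda>c g x. scale c (g x)),
                 act = (\<lambda>a g x. a * g x)\<rparr>"

definition pullback_to_A ::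
    "('k, 'a, 'm::ab_group_add) amod \<Rightarrow> ('m \<Rightarrow> 'l) \<Rightarrow> ('l \<Rightarrow> 'a) \<Rightarrow> ('m \<Rightarrow> 'a)" where
  "pullback_to_A P1 f g = (\<lambda>x. if x \<in> car P1 then g (f x) else 0)"

text \<open>\<open>T\<close> is a transpose of \<open>M\<close>: a cokernel of \<open>Hom\<^sub>A(P0, A) \<rightarrow> Hom\<^sub>A(P1, A)\<close> for a minimal
  projective presentation \<open>P1 \<rightarrow> P0 \<rightarrow> M \<rightarrow> 0\<close>. The Auslander-Reiten translate is then
  \<open>\<tau> M = D (Tr M)\<close>, which is unique up to isomorphism.\<close>

definition is_transpose :: "('k, 'a) umod \<Rightarrow> ('k, 'a) umod \<Rightarrow> bool" where
  "is_transpose M T \<longleftrightarrow> left_module T \<and>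
     (\<exists>P1 f P0 e q. min_proj_presentation P1 f P0 e M \<and>
        mhom (hom_to_A P1) T q \<and> q ` car (hom_to_A P1) = car T \<and>
        mker (hom_to_A P1) q = pullback_to_A P1 f ` car (hom_to_A P0))"

definition is_AR_translate :: "('k, 'a) umod \<Rightarrow> ('k, 'a, (nat \<Rightarrow> 'k) \<Rightarrow> 'k) amod \<Rightarrow> bool" where
  "is_AR_translate M N \<longleftrightarrow> (\<exists>T. is_transpose M T \<and> N = kdual T)"

definition tau_rigid :: "('k, 'a) umod \<Rightarrow> bool" where
  "tau_rigid M \<longleftrightarrow> fg_module M \<and> (\<exists>N. is_AR_translate M N \<and> hom_zero M N)"

definition tau_rigid_pair :: "('k, 'a) umod \<Rightarrow> ('k, 'a) umod \<Rightarrow> bool" where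
  "tau_rigid_pair M P \<longleftrightarrow> tau_rigid M \<and> projective P \<and> hom_zero P M"

definition support_tau_tilting_pair :: "nat \<Rightarrow> ('k, 'a) umod \<Rightarrow> ('k, 'a) umod \<Rightarrow> bool" where
  "support_tau_tilting_pair n M P \<longleftrightarrow> tau_rigid_pair M P \<and> num_summands M + num_summands P = n"

definition basic_support_tau_tilting_pair :: "nat \<Rightarrow> ('k, 'a) umod \<Rightarrow> ('k, 'a) umod \<Rightarrow> bool" where
  "basic_support_tau_tilting_pair n M P \<longleftrightarrow>
     support_tau_tilting_pair n M P \<and> basic_module M \<and> basic_module P"

text \<open>Below, \<open>PP 0, \<dots>, PP (n - 1)\<close> are the projective covers of the simple modules.\<close>

definition is_g_vector :: "nat \<Rightarrow> (nat \<Rightarrow> ('k, 'a) umod) \<Rightarrow> ('k, 'a) umod \<Rightarrow> int vec \<Rightarrow> bool" where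
  "is_g_vector n PP M g \<longleftrightarrow>
     (\<exists>P1 f P0 e t0 N0 t1 N1. min_proj_presentation P1 f P0 e M \<and>
        indec_decomp P0 t0 N0 \<and> indec_decomp P1 t1 N1 \<and>
        g = vec n (\<lambda>i. int (multiplicity_in (PP i) P0 t0 N0) - int (multiplicity_in (PP i) P1 t1 N1)))"

definition is_G_matrix ::
    "nat \<Rightarrow> (nat \<Rightarrow> ('k, 'a) umod) \<Rightarrow> ('k, 'a) umod \<Rightarrow> ('k, 'a) umod \<Rightarrow> int mat \<Rightarrow> bool" where
  "is_G_matrix n PP M P G \<longleftrightarrow> G \<in> carrier_mat n n \<and>
     (\<exists>t N Q. t \<le> n \<and> indec_decomp M t N \<and> indec_decomp P (n - t) Q \<and>
        (\<forall>i<t. is_g_vector n PP (submod M (N i)) (col G i)) \<and>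
        (\<forall>i<n - t. is_g_vector n PP (submod P (Q i)) (- col G (t + i))))"

definition is_C_matrix ::
    "nat \<Rightarrow> (nat \<Rightarrow> ('k, 'a) umod) \<Rightarrow> ('k, 'a) umod \<Rightarrow> ('k, 'a) umod \<Rightarrow> int mat \<Rightarrow> bool" where
  "is_C_matrix n PP M P C \<longleftrightarrow> C \<in> carrier_mat n n \<and>
     (\<exists>G. is_G_matrix n PP M P G \<and>
        inverts_mat (transpose_mat G) C \<and> inverts_mat C (transpose_mat G))"

definition c_vector :: "nat \<Rightarrow> (nat \<Rightarrow> ('k, 'a) umod) \<Rightarrow> int vec \<Rightarrow> bool" where
  "c_vector n PP c \<longleftrightarrow>
     (\<exists>M P C j. basic_support_tau_tilting_pair n M P \<and> is_C_matrix n PP M P C \<and> j < n \<and> c = col C j)"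

end

end

theory Submission
  imports Defs
begin

text \<open>
  Let \<open>c\<close> be column \<open>j\<close> of the \<open>C\<close>-matrix of a support tau-tilting pair \<open>(M, P)\<close>. Since \<open>C\<close> is
  inverse to the transpose of \<open>G\<close>, \<open>c\<close> spans the line of vectors orthogonal to all columns of \<open>G\<close>
  except column \<open>j\<close>. Hence it suffices to find a nonzero module \<open>X\<close> whose vector of dimensions
  \<open>hdim (PP i) X = dim Hom(PP i, X)\<close> is orthogonal to these columns: it is a nonzero multiple of \<open>c\<close>
  with nonnegative entries.

  Write \<open>U l\<close> and \<open>Q q\<close> for the indecomposable summands of \<open>M\<close> and \<open>P\<close> other than number \<open>j\<close>.
  A minimal presentation \<open>f : P1 \<rightarrow> P0\<close> of a module \<open>U\<close> gives
  \<open>hdim P0 X - hdim P1 X = hdim U X\<close> as soon as every homomorphism \<open>P1 \<rightarrow> X\<close> extends along \<open>f\<close>,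
  which is the condition \<open>Hom(X, \<tau> U) = 0\<close>, and the left side is the pairing of the g-vector of \<open>U\<close> with
  the dimension vector of \<open>X\<close>. So \<open>X\<close> is as desired if it lies in the torsion class \<open>T\<close> of all \<open>X\<close>
  with \<open>Hom(X, \<tau> U l) = 0\<close> and \<open>Hom(Q q, X) = 0\<close>, and moreover \<open>Hom(U l, X) = 0\<close> for all \<open>l\<close>. That
  the \<open>U l\<close> themselves lie in \<open>T\<close> is tau-rigidity; it is brought into the form used here by
  \<open>tau_rigid_extends_along\<close> and \<open>extends_along_summand\<close>.

  Suppose that there is no such \<open>X\<close>. Then the remaining columns of \<open>G\<close> already span, which contradicts the
  invertibility of \<open>G\<close>. Indeed, every module of \<open>T\<close> is now generated by the \<open>U l\<close>, since its quotient by
  the part generated by them lies in \<open>T\<close> and receives no nonzero map from the \<open>U l\<close>. For a projective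
  module \<open>PP i\<close>, take a map to a sum \<open>W\<close> of modules \<open>U l\<close> through which all maps from \<open>PP i\<close> to modules
  \<open>U l\<close> factor. Its cokernel \<open>C\<close> lies in \<open>T\<close>, and it is a direct summand of a sum of modules \<open>U l\<close>
  because the kernel of an approximation \<open>W2 \<rightarrow> C\<close> lies again in \<open>T\<close>. By Krull-Schmidt
  \<open>hdim (PP i) X = hdim W X - hdim C X\<close> is, for \<open>X\<close> in \<open>T\<close>, a fixed integral combination of the
  \<open>hdim (U l) X\<close> (\<open>hdim_PP_on_torsion\<close>). In other words, the \<open>i\<close>-th basis vector minus a combination of
  g-vectors annihilates the dimension vectors of the modules of \<open>T\<close>. If no \<open>Q q\<close> is isomorphic to \<open>PP k\<close>,
  the universal extension of the simple module \<open>S k\<close> by the \<open>U l\<close> exhibits \<open>S k\<close> as the kernel of a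
  surjection between modules of \<open>T\<close> (\<open>universal_extension\<close>), so that entry \<open>k\<close> of this vector vanishes;
  and if \<open>Q q\<close> is isomorphic to \<open>PP k\<close>, then the \<open>k\<close>-th basis vector is the g-vector of \<open>Q q\<close>. Therefore
  the \<open>i\<close>-th basis vector is a combination of the remaining columns (\<open>orthogonal_to_g_vectors\<close>).
\<close>

section \<open>Linear algebra on finite-dimensional subspaces\<close>

lemma (in vector_space) finite_basis_of_subspace:
  assumes "subspace V" "V \<subseteq> span B" "finite B"
  shows "\<exists>C. finite C \<and> C \<subseteq> V \<and> independent C \<and> span C = V \<and> card C = dim V"
proof -
  obtain C where C: "C \<subseteq> V" "independent C" "V \<subseteq> span C" "card C = dim V"
    using basis_exists by blast
  have "C \<subseteq> span B" using C assms by blast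
  then have "finite C" using independent_span_bound[OF assms(3) C(2)] by blast
  moreover have "span C = V" using span_minimal[OF C(1) assms(1)] C(3) by (rule subset_antisym)
  ultimately show ?thesis using C by blast
qed

lemma (in vector_space) dim_le_of_subset:
  assumes "subspace V" "V \<subseteq> W" "subspace W" "W \<subseteq> span B" "finite B"
  shows "dim V \<le> dim W"
proof -
  obtain C where C: "finite C" "C \<subseteq> W" "span C = W" "card C = dim W"
    using finite_basis_of_subspace[OF assms(3-5)] by blast
  show ?thesis using dim_le_card[of V C] C assms(2) by auto
qed

lemma (in vector_space) eq_of_dim_eq:
  assumes "subspace V" "V \<subseteq> W" "subspace W" "W \<subseteq> span B" "finite B" "dim W \<le> dim V"
  shows "V = W"
proof (rule ccontr)
  assume "V \<noteq> W"
  then obtain w where w: "w \<in> W" "w \<notin> V" using assms(2) by blast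
  obtain C where C: "finite C" "C \<subseteq> W" "span C = W" "card C = dim W"
    using finite_basis_of_subspace[OF assms(3-5)] by blast
  obtain D where D: "finite D" "D \<subseteq> V" "independent D" "span D = V" "card D = dim V"
    using finite_basis_of_subspace[OF assms(1) subset_trans[OF assms(2,4)] assms(5)] by blast
  have ind: "independent (insert w D)" using D(3,4) w(2) independent_insertI[of w D] by simp
  have "insert w D \<subseteq> span C" using D w C assms(2) by auto
  then have "card (insert w D) \<le> card C" using independent_span_bound[OF C(1) ind] by blast
  moreover have "w \<notin> D" using w D by auto
  ultimately show False using D C assms(6) by auto
qed

lemma (in vector_space) dim_pos:
  assumes "subspace V" "V \<subseteq> span B" "finite B" "x \<in> V" "x \<noteq> 0"
  shows "0 < dim V"
proof -
  obtain C where C: "finite C" "C \<subseteq> V" "span C = V" "card C = dim V"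
    using finite_basis_of_subspace[OF assms(1-3)] by blast
  have "C \<noteq> {}" using C assms by auto
  then show ?thesis using C by (metis card_gt_0_iff)
qed

lemma (in vector_space) dim_zero_space: "dim {0} = 0"
  using dim_span[of "{}"] dim_eq_card_independent[OF independent_empty] by simp

lemma (in vector_space) span_Int_span_of_disjoint:
  assumes "independent (A \<union> B)" "A \<inter> B = {}" "x \<in> span A" "x \<in> span B"
  shows "x = 0"
proof -
  have r: "representation (A \<union> B) x = representation A x"
    "representation (A \<union> B) x = representation B x"
    using representation_extend[OF assms(1) assms(3)] representation_extend[OF assms(1) assms(4)] by auto
  have "representation (A \<union> B) x b = 0" for b
    using r representation_ne_zero[of A x b] representation_ne_zero[of B x b] assms(2)
    by (metis disjoint_iff)
  moreover have "x \<in> span (A \<union> B)" using assms(3) span_mono[of A "A \<union> B"] by blast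
  ultimately show ?thesis using sum_nonzero_representation_eq[OF assms(1), of x] by (simp add: fun_eq_iff)
qed

text \<open>Homomorphisms of modules are constrained on carriers only. Extending them to linear maps of the
  ambient spaces makes the results about globally linear maps available.\<close>

lemma linear_on_subspace_extends:
  assumes "vector_space s1" "vector_space s2" and V: "module.subspace s1 V"
    and add: "\<And>x y. x \<in> V \<Longrightarrow> y \<in> V \<Longrightarrow> \<phi> (x + y) = \<phi> x + \<phi> y"
    and sc: "\<And>c x. x \<in> V \<Longrightarrow> \<phi> (s1 c x) = s2 c (\<phi> x)"
  shows "\<exists>\<psi>. Vector_Spaces.linear s1 s2 \<psi> \<and> (\<forall>x\<in>V. \<psi> x = \<phi> x)"
proof -
  interpret vector_space_pair s1 s2 using assms(1,2) by (simp add: vector_space_pair_def)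
  obtain C where C: "C \<subseteq> V" "vs1.independent C" "V \<subseteq> vs1.span C" "card C = vs1.dim V"
    by (rule vs1.basis_exists)
  obtain \<psi> where psi: "Vector_Spaces.linear s1 s2 \<psi>" "\<forall>x\<in>C. \<psi> x = \<phi> x"
    using linear_independent_extend[OF C(2), of \<phi>] by blast
  interpret L: Vector_Spaces.linear s1 s2 \<psi> by (fact psi(1))
  have sub: "vs1.subspace {x \<in> V. \<psi> x = \<phi> x}"
  proof (rule vs1.subspaceI)
    have "\<phi> 0 = \<phi> (0 + 0)" by simp
    also have "\<dots> = \<phi> 0 + \<phi> 0" using add vs1.subspace_0[OF V] by blast
    finally have "\<phi> 0 = 0" by simp
    then show "0 \<in> {x \<in> V. \<psi> x = \<phi> x}" using vs1.subspace_0[OF V] by simp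
  qed (use V in \<open>auto simp: add sc L.add L.scale intro: vs1.subspace_add vs1.subspace_scale\<close>)
  have "vs1.span C \<subseteq> {x \<in> V. \<psi> x = \<phi> x}"
    using vs1.span_minimal[OF _ sub] C(1) psi(2) by auto
  then show ?thesis using psi(1) C(3) by blast
qed

text \<open>A basis of the kernel is extended to a basis of \<open>V\<close>; the added vectors map to a basis of the
  image. The ambient spaces may be infinite-dimensional, as spaces of functions will be.\<close>

theorem rank_nullity_on_subspace:
  assumes "vector_space s1" "vector_space s2" and V: "module.subspace s1 V"
    and fin: "V \<subseteq> module.span s1 B" "finite B"
    and add: "\<And>x y. x \<in> V \<Longrightarrow> y \<in> V \<Longrightarrow> \<phi> (x + y) = \<phi> x + \<phi> y"
    and sc: "\<And>c x. x \<in> V \<Longrightarrow> \<phi> (s1 c x) = s2 c (\<phi> x)"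
  shows "vector_space.dim s1 V = vector_space.dim s2 (\<phi> ` V) + vector_space.dim s1 {x \<in> V. \<phi> x = 0}"
proof -
  interpret vector_space_pair s1 s2 using assms(1,2) by (simp add: vector_space_pair_def)
  have "\<exists>\<psi>. Vector_Spaces.linear s1 s2 \<psi> \<and> (\<forall>x\<in>V. \<psi> x = \<phi> x)"
    by (rule linear_on_subspace_extends[where \<phi>=\<phi>, OF assms(1,2) V add sc])
  then obtain \<psi> where psi: "Vector_Spaces.linear s1 s2 \<psi>" "\<forall>x\<in>V. \<psi> x = \<phi> x"
    by blast
  interpret L: Vector_Spaces.linear s1 s2 \<psi> by (fact psi(1))
  let ?K = "{x \<in> V. \<phi> x = 0}"
  have K_eq: "?K = {x \<in> V. \<psi> x = 0}" using psi(2) by auto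
  have Ksub: "vs1.subspace ?K" unfolding K_eq using V
    by (auto simp: vs1.subspace_def L.add L.scale)
  obtain C0 where C0: "finite C0" "C0 \<subseteq> ?K" "vs1.independent C0" "vs1.span C0 = ?K" "card C0 = vs1.dim ?K"
    using vs1.finite_basis_of_subspace[OF Ksub subset_trans[OF _ fin(1)] fin(2)] by blast
  obtain C where C: "C0 \<subseteq> C" "C \<subseteq> V" "vs1.independent C" "V \<subseteq> vs1.span C"
    using vs1.maximal_independent_subset_extend[of C0 V] C0 by blast
  have Cfin: "finite C" using vs1.independent_span_bound[OF fin(2) C(3)] C(2) fin(1) by blast
  have spC: "vs1.span C = V" using C V vs1.span_minimal by blast
  have cC: "card C = vs1.dim V" using vs1.basis_card_eq_dim C by blast
  let ?D = "C - C0"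
  have indD: "vs1.independent ?D" using C(3) vs1.independent_mono by blast
  have inj: "inj_on \<psi> (vs1.span ?D)"
    unfolding L.inj_on_iff_eq_0[OF vs1.subspace_span]
  proof safe
    fix x assume x: "x \<in> vs1.span ?D" "\<psi> x = 0"
    have "x \<in> V" using x(1) spC vs1.span_mono[of ?D C] by blast
    then have "x \<in> vs1.span C0" using x(2) C0(4) K_eq by blast
    moreover have "?D \<union> C0 = C" using C(1) by blast
    ultimately show "x = 0" using vs1.span_Int_span_of_disjoint[of ?D C0 x] x(1) C(3) by auto
  qed
  have ind: "vs2.independent (\<psi> ` ?D)" by (rule L.independent_injective_image[OF indD inj])
  have card: "card (\<psi> ` ?D) = card ?D"
    by (rule card_image, rule inj_on_subset[OF inj vs1.span_superset])
  have "vs2.span (\<psi> ` ?D) = vs2.span (\<psi> ` C)"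
  proof -
    have "\<psi> ` C0 \<subseteq> {0}" using C0(2) K_eq by auto
    then have "\<psi> ` C \<subseteq> insert 0 (\<psi> ` ?D)" by auto
    then have "vs2.span (\<psi> ` C) \<subseteq> vs2.span (\<psi> ` ?D)" using vs2.span_mono[of _ "insert 0 (\<psi> ` ?D)"] by simp
    then show ?thesis using vs2.span_mono[of "\<psi> ` ?D" "\<psi> ` C"] by auto
  qed
  also have "\<dots> = \<psi> ` V" using L.span_image spC by simp
  also have "\<dots> = \<phi> ` V" using psi(2) by (intro image_cong) auto
  finally have "vs2.dim (\<phi> ` V) = card ?D"
    using vs2.dim_span_eq_card_independent[OF ind] card by simp
  moreover have "card C = card ?D + card C0"
    using C(1) Cfin by (metis card_Diff_subset card_mono finite_subset le_add_diff_inverse2)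
  ultimately show ?thesis using cC C0(5) by simp
qed

section \<open>Modules, homomorphisms and submodules\<close>

context fd_algebra
begin

lemma right_moduleD:
  assumes "right_module M"
  shows rm_vs: "vector_space (smul M)"
    and rm_subspace: "module.subspace (smul M) (car M)"
    and rm_act: "x \<in> car M \<Longrightarrow> act M a x \<in> car M"
    and rm_act_add: "x \<in> car M \<Longrightarrow> y \<in> car M \<Longrightarrow> act M a (x + y) = act M a x + act M a y"
    and rm_act_plus: "x \<in> car M \<Longrightarrow> act M (a + b) x = act M a x + act M b x"
    and rm_act_smul: "x \<in> car M \<Longrightarrow> act M a (smul M c x) = smul M c (act M a x)"
    and rm_act_scale: "x \<in> car M \<Longrightarrow> act M (scale c a) x = smul M c (act M a x)"
    and rm_act_one: "x \<in> car M \<Longrightarrow> act M 1 x = x"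
    and rm_act_mult: "x \<in> car M \<Longrightarrow> act M (a * b) x = act M b (act M a x)"
  using assms unfolding right_module_def bilinear_action_def by blast+

lemma rm_module: "right_module M \<Longrightarrow> Modules.module (smul M)"
  using rm_vs module_iff_vector_space by blast

lemma right_module_closed:
  assumes "right_module M"
  shows rm_zero: "0 \<in> car M"
    and rm_add: "x \<in> car M \<Longrightarrow> y \<in> car M \<Longrightarrow> x + y \<in> car M"
    and rm_smul: "x \<in> car M \<Longrightarrow> smul M c x \<in> car M"
    and rm_diff: "x \<in> car M \<Longrightarrow> y \<in> car M \<Longrightarrow> x - y \<in> car M"
    and rm_sum: "(\<And>i. i \<in> I \<Longrightarrow> g i \<in> car M) \<Longrightarrow> sum g I \<in> car M"
proof -
  interpret V: vector_space "smul M" using rm_vs[OF assms] .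
  note S = rm_subspace[OF assms]
  show "0 \<in> car M" by (rule V.subspace_0[OF S])
  show "x \<in> car M \<Longrightarrow> y \<in> car M \<Longrightarrow> x + y \<in> car M" by (rule V.subspace_add[OF S])
  show "x \<in> car M \<Longrightarrow> smul M c x \<in> car M" by (rule V.subspace_scale[OF S])
  show "x \<in> car M \<Longrightarrow> y \<in> car M \<Longrightarrow> x - y \<in> car M" by (rule V.subspace_diff[OF S])
  show "(\<And>i. i \<in> I \<Longrightarrow> g i \<in> car M) \<Longrightarrow> sum g I \<in> car M" by (rule V.subspace_sum[OF S])
qed

lemma rm_act_0:
  assumes "right_module M" shows "act M a 0 = 0"
  using rm_act_add[OF assms rm_zero[OF assms] rm_zero[OF assms], of a] by simp

lemma rm_act_0_left:
  assumes "right_module M" "x \<in> car M" shows "act M 0 x = 0"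
  using rm_act_plus[OF assms, of 0 0] by simp

lemma rm_act_sum:
  assumes "right_module M" "\<And>i. i \<in> I \<Longrightarrow> g i \<in> car M"
  shows "act M a (sum g I) = (\<Sum>i\<in>I. act M a (g i))"
  using assms(2)
proof (induction I rule: infinite_finite_induct)
  case (insert i I)
  then show ?case by (simp add: rm_act_add[OF assms(1)] rm_sum[OF assms(1)])
qed (simp_all add: rm_act_0[OF assms(1)])

lemma rm_act_diff:
  assumes "right_module M" "x \<in> car M" "y \<in> car M"
  shows "act M a (x - y) = act M a x - act M a y"
  using rm_act_add[OF assms(1) rm_diff[OF assms] assms(3), of a] by (simp add: algebra_simps)

subsection \<open>Homomorphisms\<close>

lemma mhomD:
  assumes "mhom M N f"
  shows mhom_in: "x \<in> car M \<Longrightarrow> f x \<in> car N"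
    and mhom_add: "x \<in> car M \<Longrightarrow> y \<in> car M \<Longrightarrow> f (x + y) = f x + f y"
    and mhom_smul: "x \<in> car M \<Longrightarrow> f (smul M c x) = smul N c (f x)"
    and mhom_act: "x \<in> car M \<Longrightarrow> f (act M a x) = act N a (f x)"
  using assms unfolding mhom_def by blast+

lemma mhomI:
  assumes "\<And>x. x \<in> car M \<Longrightarrow> f x \<in> car N"
    and "\<And>x y. x \<in> car M \<Longrightarrow> y \<in> car M \<Longrightarrow> f (x + y) = f x + f y"
    and "\<And>c x. x \<in> car M \<Longrightarrow> f (smul M c x) = smul N c (f x)"
    and "\<And>a x. x \<in> car M \<Longrightarrow> f (act M a x) = act N a (f x)"
  shows "mhom M N f"
  using assms unfolding mhom_def by blast

lemma mhom_0:
  assumes "right_module M" "mhom M N f" shows "f 0 = 0"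
  using mhom_add[OF assms(2) rm_zero[OF assms(1)] rm_zero[OF assms(1)]] by simp

lemma mhom_diff:
  assumes "right_module M" "mhom M N f" "x \<in> car M" "y \<in> car M" shows "f (x - y) = f x - f y"
  using mhom_add[OF assms(2) rm_diff[OF assms(1,3,4)] assms(4)] by (simp add: algebra_simps)

lemma mhom_sum:
  assumes "right_module M" "mhom M N f" "\<And>i. i \<in> I \<Longrightarrow> g i \<in> car M"
  shows "f (sum g I) = (\<Sum>i\<in>I. f (g i))"
  using assms(3)
proof (induction I rule: infinite_finite_induct)
  case (insert i I)
  then show ?case by (simp add: mhom_add[OF assms(2)] rm_sum[OF assms(1)])
qed (simp_all add: mhom_0[OF assms(1,2)])

lemma mhom_comp: "mhom M N f \<Longrightarrow> mhom N K g \<Longrightarrow> mhom M K (\<lambda>x. g (f x))"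
  unfolding mhom_def by simp

lemma mhom_ident: "mhom M M (\<lambda>x. x)"
  unfolding mhom_def by simp

lemma mhom_zero: "right_module N \<Longrightarrow> mhom M N (\<lambda>x. 0)"
  by (rule mhomI) (auto simp: rm_zero rm_act_0 module.scale_zero_right[OF rm_module])

lemma mhom_fun_add: "right_module N \<Longrightarrow> mhom M N f \<Longrightarrow> mhom M N g \<Longrightarrow> mhom M N (\<lambda>x. f x + g x)"
  by (rule mhomI)
    (auto simp: mhomD rm_add rm_act_add algebra_simps module.scale_right_distrib[OF rm_module])

lemma mhom_fun_smul: "right_module N \<Longrightarrow> mhom M N f \<Longrightarrow> mhom M N (\<lambda>x. smul N c (f x))"
  by (rule mhomI)
    (auto simp: mhomD rm_smul rm_act_smul module.scale_right_distrib[OF rm_module]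
      module.scale_left_commute[OF rm_module])

lemma mhom_fun_diff:
  assumes "right_module N" "mhom M N f" "mhom M N g" shows "mhom M N (\<lambda>x. f x - g x)"
proof (rule mhomI)
  interpret V: vector_space "smul N" using rm_vs[OF assms(1)] .
  show "f (smul M c x) - g (smul M c x) = smul N c (f x - g x)" if "x \<in> car M" for c x
    using that assms by (simp add: mhomD V.scale_right_diff_distrib)
qed (auto simp: mhomD[OF assms(2)] mhomD[OF assms(3)] rm_diff[OF assms(1)] rm_act_diff[OF assms(1)])

lemma mhom_fun_neg:
  assumes "right_module N" "mhom M N f" shows "mhom M N (\<lambda>x. - f x)"
  using mhom_fun_diff[OF assms(1) mhom_zero[OF assms(1)] assms(2)] by simp

lemma mhom_fun_sum:
  assumes "right_module N" "\<And>i. i \<in> I \<Longrightarrow> mhom M N (f i)"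
  shows "mhom M N (\<lambda>x. \<Sum>i\<in>I. f i x)"
  using assms(2)
proof (induction I rule: infinite_finite_induct)
  case (insert i I)
  then show ?case using mhom_fun_add[OF assms(1), of M "f i" "\<lambda>x. \<Sum>i\<in>I. f i x"] by simp
qed (simp_all add: mhom_zero[OF assms(1)])

lemma mhom_cong:
  assumes "right_module M" "mhom M N f" "\<And>x. x \<in> car M \<Longrightarrow> g x = f x"
  shows "mhom M N g"
  by (rule mhomI) (auto simp: assms(3) mhomD[OF assms(2)] rm_add rm_smul rm_act assms(1))

lemma mhom_inj_on:
  assumes "right_module M" "mhom M N f" "\<And>x. x \<in> car M \<Longrightarrow> f x = 0 \<Longrightarrow> x = 0"
  shows "inj_on f (car M)"
proof (rule inj_onI)
  fix x y assume "x \<in> car M" "y \<in> car M" "f x = f y"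
  then show "x = y"
    using assms(3)[OF rm_diff[OF assms(1), of x y]] mhom_diff[OF assms(1,2), of x y] by simp
qed

text \<open>The universal property of a cokernel, by which maps descend along the surjection \<open>g\<close>: the value
  of \<open>h\<close> does not depend on the chosen preimage.\<close>

lemma mhom_factor_surj:
  assumes M: "right_module M" and g: "mhom M N g" and s: "g ` car M = car N"
    and h: "mhom M Z h" and ker: "\<And>x. x \<in> car M \<Longrightarrow> g x = 0 \<Longrightarrow> h x = 0"
  shows "\<exists>k. mhom N Z k \<and> (\<forall>x\<in>car M. k (g x) = h x)"
proof -
  let ?k = "\<lambda>y. h (inv_into (car M) g y)"
  have k: "?k (g x) = h x" if x: "x \<in> car M" for x
  proof -
    let ?x = "inv_into (car M) g (g x)"
    have x': "?x \<in> car M" "g ?x = g x" using x by (simp_all add: inv_into_into f_inv_into_f)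
    have "g (?x - x) = 0" using mhom_diff[OF M g x'(1) x] x'(2) by simp
    then have "h (?x - x) = 0" using ker rm_diff[OF M x'(1) x] by blast
    then show ?thesis using mhom_diff[OF M h x'(1) x] by simp
  qed
  have "mhom N Z ?k"
  proof (rule mhomI)
    fix y assume "y \<in> car N"
    then obtain x where x: "x \<in> car M" "y = g x" using s by blast
    show "?k y \<in> car Z" using x k mhom_in[OF h] by simp
    show "?k (smul N c y) = smul Z c (?k y)" for c
      using x k[of x] k[of "smul M c x"] mhom_smul[OF g x(1)] mhom_smul[OF h x(1)] rm_smul[OF M x(1)] by simp
    show "?k (act N c y) = act Z c (?k y)" for c
      using x k[of x] k[of "act M c x"] mhom_act[OF g x(1)] mhom_act[OF h x(1)] rm_act[OF M x(1)] by simp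
    fix z assume "z \<in> car N"
    then obtain w where w: "w \<in> car M" "z = g w" using s by blast
    show "?k (y + z) = ?k y + ?k z"
      using x w k[of x] k[of w] k[of "x + w"] mhom_add[OF g x(1) w(1)] mhom_add[OF h x(1) w(1)] rm_add[OF M x(1) w(1)] by simp
  qed
  then show ?thesis using k by blast
qed

lemma mhom_inverse:
  assumes M: "right_module M" and f: "mhom M N f" "bij_betw f (car M) (car N)"
  shows "\<exists>g. mhom N M g \<and> (\<forall>x\<in>car M. g (f x) = x) \<and> (\<forall>y\<in>car N. f (g y) = y) \<and> bij_betw g (car N) (car M)"
proof -
  have im: "f ` car M = car N" using bij_betw_imp_surj_on[OF f(2)] .
  have "\<exists>g. mhom N M g \<and> (\<forall>x\<in>car M. g (f x) = x)"
  proof (rule mhom_factor_surj[OF M f(1) im mhom_ident])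
    fix x assume x: "x \<in> car M" "f x = 0"
    have "f x = f 0" using x(2) mhom_0[OF M f(1)] by simp
    then show "x = 0" using f(2) x(1) rm_zero[OF M] unfolding bij_betw_def inj_on_def by blast
  qed
  then obtain g where g: "mhom N M g" "\<forall>x\<in>car M. g (f x) = x" by blast
  moreover have g': "\<forall>y\<in>car N. f (g y) = y"
  proof
    fix y assume "y \<in> car N"
    then obtain x where "x \<in> car M" "y = f x" using im by blast
    then show "f (g y) = y" using g(2) by simp
  qed
  moreover have "bij_betw g (car N) (car M)"
    by (rule bij_betwI[of _ _ _ f]) (use g g' mhom_in[OF g(1)] mhom_in[OF f(1)] in auto)
  ultimately show ?thesis by blast
qed

lemma mod_iso_sym: "right_module M \<Longrightarrow> mod_iso M N \<Longrightarrow> mod_iso N M"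
  using mhom_inverse[of M N] unfolding mod_iso_def by blast

lemma mod_iso_trans: "mod_iso M N \<Longrightarrow> mod_iso N K \<Longrightarrow> mod_iso M K"
  unfolding mod_iso_def using mhom_comp bij_betw_trans[unfolded comp_def] by blast

subsection \<open>Submodules\<close>

lemma submod_simps [simp]:
  "car (submod M V) = V" "smul (submod M V) = smul M" "act (submod M V) = act M"
  unfolding submod_def by simp_all

lemma submodule_subset: "submodule V M \<Longrightarrow> V \<subseteq> car M"
  unfolding submodule_def by blast

lemma right_module_submod:
  assumes "right_module M" "submodule V M" shows "right_module (submod M V)"
proof -
  have sub: "x \<in> car M" if "x \<in> V" for x using assms(2) that unfolding submodule_def by blast
  show ?thesis
    unfolding right_module_def bilinear_action_def submod_simps
    using rm_vs[OF assms(1)] assms(2)[unfolded submodule_def] right_moduleD(4-)[OF assms(1) sub]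
      rm_act_add[OF assms(1) sub sub]
    by blast
qed

lemma submoduleI:
  assumes "right_module M" "V \<subseteq> car M" "0 \<in> V" "\<And>x y. x \<in> V \<Longrightarrow> y \<in> V \<Longrightarrow> x + y \<in> V"
    "\<And>c x. x \<in> V \<Longrightarrow> smul M c x \<in> V" "\<And>a x. x \<in> V \<Longrightarrow> act M a x \<in> V"
  shows "submodule V M"
  unfolding submodule_def module.subspace_def[OF rm_module[OF assms(1)]] using assms by blast

lemma submodule_closed:
  assumes "right_module M" "submodule V M"
  shows sm_zero: "0 \<in> V"
    and sm_add: "x \<in> V \<Longrightarrow> y \<in> V \<Longrightarrow> x + y \<in> V"
    and sm_diff: "x \<in> V \<Longrightarrow> y \<in> V \<Longrightarrow> x - y \<in> V"
    and sm_smul: "x \<in> V \<Longrightarrow> smul M c x \<in> V"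
    and sm_act: "x \<in> V \<Longrightarrow> act M a x \<in> V"
    and sm_sum: "(\<And>i. i \<in> I \<Longrightarrow> g i \<in> V) \<Longrightarrow> sum g I \<in> V"
proof -
  note R = right_module_submod[OF assms]
  show "0 \<in> V" using rm_zero[OF R] by simp
  show "x \<in> V \<Longrightarrow> y \<in> V \<Longrightarrow> x + y \<in> V" using rm_add[OF R] by simp
  show "x \<in> V \<Longrightarrow> y \<in> V \<Longrightarrow> x - y \<in> V" using rm_diff[OF R] by simp
  show "x \<in> V \<Longrightarrow> smul M c x \<in> V" using rm_smul[OF R] by simp
  show "x \<in> V \<Longrightarrow> act M a x \<in> V" using rm_act[OF R] by simp
  show "(\<And>i. i \<in> I \<Longrightarrow> g i \<in> V) \<Longrightarrow> sum g I \<in> V" using rm_sum[OF R, of I g] by simp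
qed

lemma submodule_subspace: "submodule V M \<Longrightarrow> module.subspace (smul M) V"
  unfolding submodule_def by blast

lemma submodule_car: "right_module M \<Longrightarrow> submodule (car M) M"
  by (rule submoduleI) (auto simp: right_module_closed rm_act)

lemma submodule_0: "right_module M \<Longrightarrow> submodule {0} M"
  by (rule submoduleI) (auto simp: right_module_closed rm_act_0 module.scale_zero_right[OF rm_module])

lemma submodule_submod_iff:
  "submodule V M \<Longrightarrow> submodule W (submod M V) \<longleftrightarrow> W \<subseteq> V \<and> submodule W M"
  unfolding submodule_def by auto

lemma submodule_image:
  assumes M: "right_module M" and N: "right_module N" and f: "mhom M N f" and V: "submodule V M"
  shows "submodule (f ` V) N"
proof (rule submoduleI[OF N])
  have sub: "x \<in> V \<Longrightarrow> x \<in> car M" for x using V submodule_subset by blast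
  show "f ` V \<subseteq> car N" using sub mhom_in[OF f] by blast
  show "0 \<in> f ` V" using mhom_0[OF M f] sm_zero[OF M V] by (metis image_eqI)
  show "x + y \<in> f ` V" if "x \<in> f ` V" "y \<in> f ` V" for x y
    using that mhom_add[OF f] sub sm_add[OF M V] by (smt (verit) image_iff)
  show "smul N c x \<in> f ` V" if "x \<in> f ` V" for c x
    using that mhom_smul[OF f] sub sm_smul[OF M V] by (smt (verit) image_iff)
  show "act N c x \<in> f ` V" if "x \<in> f ` V" for c x
    using that mhom_act[OF f] sub sm_act[OF M V] by (smt (verit) image_iff)
qed

lemma submodule_range:
  "right_module M \<Longrightarrow> right_module N \<Longrightarrow> mhom M N f \<Longrightarrow> submodule (f ` car M) N"
  using submodule_image submodule_car by blast

lemma submodule_preimage: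
  assumes M: "right_module M" and N: "right_module N" and f: "mhom M N f" and V: "submodule V N"
  shows "submodule {x \<in> car M. f x \<in> V} M"
  by (rule submoduleI[OF M])
    (auto simp: right_module_closed[OF M] rm_act[OF M] mhom_0[OF M f] mhomD[OF f]
      submodule_closed[OF N V])

lemma mker_eq: "mker M f = {x \<in> car M. f x \<in> {0}}"
  unfolding mker_def by auto

lemma submodule_mker:
  "right_module M \<Longrightarrow> right_module N \<Longrightarrow> mhom M N f \<Longrightarrow> submodule (mker M f) M"
  unfolding mker_eq using submodule_preimage submodule_0 by blast

lemma submodule_set_sum:
  assumes M: "right_module M" and V: "submodule V M" and W: "submodule W M"
  shows "submodule (set_sum V W) M"
proof (rule submoduleI[OF M])
  have sub: "x \<in> V \<Longrightarrow> x \<in> car M" "x \<in> W \<Longrightarrow> x \<in> car M" for x using V W submodule_subset by blast+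
  interpret S: vector_space "smul M" using rm_vs[OF M] .
  show "set_sum V W \<subseteq> car M" unfolding set_sum_def using sub rm_add[OF M] by blast
  show "0 \<in> set_sum V W" unfolding set_sum_def using sm_zero[OF M V] sm_zero[OF M W] by force
  fix x assume "x \<in> set_sum V W"
  then obtain v w where x: "x = v + w" "v \<in> V" "w \<in> W" unfolding set_sum_def by blast
  show "smul M c x \<in> set_sum V W" for c
    unfolding set_sum_def using x sm_smul[OF M V x(2)] sm_smul[OF M W x(3)] S.scale_right_distrib by blast
  show "act M c x \<in> set_sum V W" for c
    unfolding set_sum_def using x sm_act[OF M V x(2)] sm_act[OF M W x(3)] rm_act_add[OF M] sub by blast
  fix y assume "y \<in> set_sum V W"
  then obtain v' w' where y: "y = v' + w'" "v' \<in> V" "w' \<in> W" unfolding set_sum_def by blast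
  have "x + y = (v + v') + (w + w')" using x y by simp
  then show "x + y \<in> set_sum V W"
    unfolding set_sum_def using sm_add[OF M V x(2) y(2)] sm_add[OF M W x(3) y(3)] by blast
qed

lemma mhom_to_submod: "mhom M N f \<Longrightarrow> (\<And>x. x \<in> car M \<Longrightarrow> f x \<in> V) \<Longrightarrow> mhom M (submod N V) f"
  unfolding mhom_def by simp

lemma mhom_from_submod: "mhom M N f \<Longrightarrow> V \<subseteq> car M \<Longrightarrow> mhom (submod M V) N f"
  unfolding mhom_def submod_simps by blast

lemma mhom_incl: "V \<subseteq> car M \<Longrightarrow> mhom (submod M V) M (\<lambda>x. x)"
  unfolding mhom_def by auto

subsection \<open>Finite dimension\<close>

text \<open>As the algebra is finite-dimensional, the finitely generated modules are the ones that are
  finite-dimensional as vector spaces. Both forms are needed: projectivity refers to the former,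
  dimension counts to the latter.\<close>

lemma fg_right_module: "fg_module M \<Longrightarrow> right_module M"
  unfolding fg_module_def by blast

lemma fg_module_finite_span:
  assumes "fg_module M"
  shows "\<exists>B. finite B \<and> B \<subseteq> car M \<and> module.span (smul M) B = car M"
proof -
  have M: "right_module M" using assms fg_right_module by blast
  interpret V: vector_space "smul M" using rm_vs[OF M] .
  obtain F where F: "finite F" "F \<subseteq> car M" "\<forall>x\<in>car M. \<exists>c. x = (\<Sum>y\<in>F. act M (c y) y)"
    using assms unfolding fg_module_def by blast
  obtain A where A: "finite A" "span A = UNIV" using finite_dim by blast
  let ?B = "(\<lambda>(a, y). act M a y) ` (A \<times> F)"
  have Bsub: "?B \<subseteq> car M" using F(2) rm_act[OF M] by auto
  have act: "act M a y \<in> V.span ?B" if y: "y \<in> F" for a y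
  proof -
    have y': "y \<in> car M" using F(2) y by blast
    have "a \<in> span A" using A by simp
    then show ?thesis
    proof (induction rule: span_induct_alt)
      case base then show ?case using rm_act_0_left[OF M y'] V.span_zero by simp
    next
      case (step c x z)
      have "act M x y \<in> ?B" using step(1) y by force
      then show ?case using step(2) rm_act_plus[OF M y'] rm_act_scale[OF M y'] V.span_add V.span_scale V.span_base by simp
    qed
  qed
  have "car M \<subseteq> V.span ?B"
  proof
    fix x assume "x \<in> car M"
    then obtain c where "x = (\<Sum>y\<in>F. act M (c y) y)" using F(3) by blast
    moreover have "(\<Sum>y\<in>F. act M (c y) y) \<in> V.span ?B" by (rule V.span_sum) (rule act)
    ultimately show "x \<in> V.span ?B" by simp
  qed
  moreover have "V.span ?B \<subseteq> car M" using V.span_minimal[OF Bsub rm_subspace[OF M]] .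
  moreover have "finite ?B" using A(1) F(1) by simp
  ultimately show ?thesis using Bsub by (intro exI[of _ ?B]) simp
qed

lemma fg_moduleI:
  assumes M: "right_module M" and B: "finite B" "car M \<subseteq> module.span (smul M) B"
  shows "fg_module M"
proof -
  interpret V: vector_space "smul M" using rm_vs[OF M] .
  obtain C where C: "finite C" "C \<subseteq> car M" "V.span C = car M"
    using V.finite_basis_of_subspace[OF rm_subspace[OF M] B(2,1)] by blast
  have "\<exists>c. x = (\<Sum>y\<in>C. act M (c y) y)" if "x \<in> car M" for x
  proof -
    have "x \<in> range (\<lambda>u. \<Sum>y\<in>C. smul M (u y) y)" using that C(3) V.span_finite[OF C(1)] by simp
    then obtain u where u: "x = (\<Sum>y\<in>C. smul M (u y) y)" by blast
    also have "\<dots> = (\<Sum>y\<in>C. act M (scale (u y) 1) y)"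
      using C(2) rm_act_scale[OF M] rm_act_one[OF M] by (intro sum.cong) auto
    finally show ?thesis by (intro exI[of _ "\<lambda>y. scale (u y) 1"])
  qed
  then show ?thesis unfolding fg_module_def using M C by blast
qed

lemma fg_submod:
  assumes "fg_module M" "submodule V M" shows "fg_module (submod M V)"
proof -
  obtain B where B: "finite B" "B \<subseteq> car M" "module.span (smul M) B = car M"
    using fg_module_finite_span[OF assms(1)] by blast
  show ?thesis
    by (rule fg_moduleI[OF right_module_submod[OF fg_right_module[OF assms(1)] assms(2)] B(1)])
      (use B(3) submodule_subset[OF assms(2)] in simp)
qed

lemma fg_image:
  assumes M: "fg_module M" and N: "right_module N" and f: "mhom M N f" "f ` car M = car N"
  shows "fg_module N"
proof -
  have M': "right_module M" using M fg_right_module by blast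
  obtain B where B: "finite B" "B \<subseteq> car M" "module.span (smul M) B = car M"
    using fg_module_finite_span[OF M] by blast
  have "\<exists>\<psi>. Vector_Spaces.linear (smul M) (smul N) \<psi> \<and> (\<forall>x\<in>car M. \<psi> x = f x)"
    by (rule linear_on_subspace_extends[where \<phi>=f, OF rm_vs[OF M'] rm_vs[OF N] rm_subspace[OF M']])
      (use mhomD[OF f(1)] in blast)+
  then obtain \<psi> where psi: "Vector_Spaces.linear (smul M) (smul N) \<psi>" "\<forall>x\<in>car M. \<psi> x = f x" by blast
  interpret L: Vector_Spaces.linear "smul M" "smul N" \<psi> by (fact psi(1))
  have "\<psi> ` car M = car N" using psi(2) f(2) by (metis image_cong)
  then have "car N \<subseteq> module.span (smul N) (\<psi> ` B)" using L.span_image[of B] B(3) by simp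
  then show ?thesis using fg_moduleI[OF N, of "\<psi> ` B"] B(1) by blast
qed

abbreviation mdim :: "('k, 'a, 'm::ab_group_add) amod \<Rightarrow> nat" where
  "mdim M \<equiv> vector_space.dim (smul M) (car M)"

lemma mhom_rank_nullity:
  assumes M: "fg_module M" and N: "right_module N" and f: "mhom M N f"
  shows "mdim M = vector_space.dim (smul N) (f ` car M) + vector_space.dim (smul M) (mker M f)"
proof -
  have M': "right_module M" using M fg_right_module by blast
  obtain B where B: "finite B" "B \<subseteq> car M" "module.span (smul M) B = car M"
    using fg_module_finite_span[OF M] by blast
  show ?thesis unfolding mker_def
    by (rule rank_nullity_on_subspace[where \<phi>=f, OF rm_vs[OF M'] rm_vs[OF N] rm_subspace[OF M'] _ B(1)])
      (use B(3) mhomD[OF f] in auto)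
qed

lemma submodule_dim:
  assumes M: "fg_module M" and V: "submodule V M" and W: "submodule W M" and sub: "V \<subseteq> W"
  shows submodule_dim_mono: "vector_space.dim (smul M) V \<le> vector_space.dim (smul M) W"
    and submodule_dim_eq: "vector_space.dim (smul M) W \<le> vector_space.dim (smul M) V \<Longrightarrow> V = W"
proof -
  have M': "right_module M" using M fg_right_module by blast
  interpret S: vector_space "smul M" using rm_vs[OF M'] .
  obtain B where B: "finite B" "B \<subseteq> car M" "module.span (smul M) B = car M"
    using fg_module_finite_span[OF M] by blast
  have W': "W \<subseteq> S.span B" using B(3) submodule_subset[OF W] by simp
  show "S.dim V \<le> S.dim W"
    by (rule S.dim_le_of_subset[OF submodule_subspace[OF V] sub submodule_subspace[OF W] W' B(1)])
  show "S.dim W \<le> S.dim V \<Longrightarrow> V = W"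
    by (rule S.eq_of_dim_eq[OF submodule_subspace[OF V] sub submodule_subspace[OF W] W' B(1)])
qed

text \<open>By rank-nullity, both sides say that the kernel has dimension zero.\<close>

lemma endo_inj_iff_surj:
  assumes M: "fg_module M" and f: "mhom M M f"
  shows "(\<forall>x\<in>car M. f x = 0 \<longrightarrow> x = 0) \<longleftrightarrow> f ` car M = car M"
proof -
  have M': "right_module M" using M fg_right_module by blast
  interpret S: vector_space "smul M" using rm_vs[OF M'] .
  note rn = mhom_rank_nullity[OF M M' f]
  have K: "submodule (mker M f) M" "{0} \<subseteq> mker M f"
    using submodule_mker[OF M' M' f] sm_zero[OF M'] by blast+
  have R: "submodule (f ` car M) M" using submodule_range[OF M' M' f] .
  have "(\<forall>x\<in>car M. f x = 0 \<longrightarrow> x = 0) \<longleftrightarrow> mker M f = {0}"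
    using K(2) unfolding mker_def by auto
  also have "\<dots> \<longleftrightarrow> S.dim (mker M f) = 0"
    using submodule_dim_eq[OF M submodule_0[OF M'] K] S.dim_zero_space by auto
  also have "\<dots> \<longleftrightarrow> f ` car M = car M"
    using rn submodule_dim_eq[OF M R submodule_car[OF M'] submodule_subset[OF R]] by auto
  finally show ?thesis .
qed

lemma endo_bij:
  assumes M: "fg_module M" and f: "mhom M M f"
  shows endo_bij_if_inj: "(\<And>x. x \<in> car M \<Longrightarrow> f x = 0 \<Longrightarrow> x = 0) \<Longrightarrow> bij_betw f (car M) (car M)"
    and endo_bij_if_surj: "f ` car M = car M \<Longrightarrow> bij_betw f (car M) (car M)"
  using endo_inj_iff_surj[OF assms] mhom_inj_on[OF fg_right_module[OF M] f]
  unfolding bij_betw_def by blast+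

end

section \<open>Quotients and direct sums\<close>

lemma sum_fun_apply: "(\<Sum>i\<in>I. f i) x = (\<Sum>i\<in>I. f i x)"
  by (induction I rule: infinite_finite_induct) simp_all

lemma vector_space_pointwise: "vector_space (\<lambda>c (y::nat \<Rightarrow> 'k::field) i. c * y i)"
  by unfold_locales (auto simp: fun_eq_iff algebra_simps)

context fd_algebra
begin

text \<open>The quotient is realised on sequences of scalars rather than on cosets. A basis of
  \<open>V\<close> is extended to a basis of \<open>M\<close>; the coordinates with respect to the added vectors identify the
  quotient with a coordinate space, to which the action is transported. For \<open>V = {0}\<close> this yields an
  isomorphic copy of \<open>M\<close> in the universe of modules over which projectivity and simple modules are
  quantified.\<close>

theorem exists_quotient:
  fixes M :: "('k, 'a, 'm::ab_group_add) amod"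
  assumes M: "fg_module M" and V: "submodule V M"
  shows "\<exists>(X :: ('k, 'a) umod) q. fg_module X \<and> mhom M X q \<and> q ` car M = car X \<and>
    (\<forall>x\<in>car M. q x = 0 \<longleftrightarrow> x \<in> V)"
proof -
  have M': "right_module M" using M fg_right_module by blast
  interpret S: vector_space "smul M" using rm_vs[OF M'] .
  obtain B where B: "finite B" "B \<subseteq> car M" "S.span B = car M"
    using fg_module_finite_span[OF M] by blast
  have VB: "V \<subseteq> S.span B" using B submodule_subset[OF V] by simp
  obtain C0 where C0: "finite C0" "C0 \<subseteq> V" "S.independent C0" "S.span C0 = V"
    using S.finite_basis_of_subspace[OF submodule_subspace[OF V] VB B(1)] by blast
  have "C0 \<subseteq> car M" using C0(2) submodule_subset[OF V] by blast
  then obtain C where C: "C0 \<subseteq> C" "C \<subseteq> car M" "S.independent C" "car M \<subseteq> S.span C"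
    using S.maximal_independent_subset_extend[OF _ C0(3), of "car M"] by metis
  have spC: "S.span C = car M" using C(4) S.span_minimal[OF C(2) rm_subspace[OF M']] by blast
  have "C \<subseteq> S.span B" using C(2) B(3) by simp
  then have Cfin: "finite C" using S.independent_span_bound[OF B(1) C(3)] by blast
  define d where "d = card (C - C0)"
  obtain h where h: "bij_betw h {0..<d} (C - C0)"
    using ex_bij_betw_nat_finite[of "C - C0"] Cfin unfolding d_def by blast
  have hC: "h i \<in> C" "h i \<notin> C0" if "i < d" for i using h that unfolding bij_betw_def by auto
  have hinj: "h i = h j \<longleftrightarrow> i = j" if "i < d" "j < d" for i j
    using h that unfolding bij_betw_def inj_on_def by auto
  define q where "q x = (\<lambda>i. if i < d then S.representation C x (h i) else 0)" for x
  define s where "s y = (\<Sum>i<d. smul M (y i) (h i))" for y :: "nat \<Rightarrow> 'k"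
  define Y where "Y = {y :: nat \<Rightarrow> 'k. \<forall>i\<ge>d. y i = 0}"
  have q_add: "q (x + y) = q x + q y" if "x \<in> car M" "y \<in> car M" for x y
    using S.representation_add[OF C(3)] that spC by (auto simp: q_def fun_eq_iff)
  have q_diff: "q (x - y) = q x - q y" if "x \<in> car M" "y \<in> car M" for x y
    using S.representation_diff[OF C(3)] that spC by (auto simp: q_def fun_eq_iff)
  have q_smul: "q (smul M c x) = (\<lambda>i. c * q x i)" if "x \<in> car M" for c x
    using S.representation_scale[OF C(3)] that spC by (auto simp: q_def fun_eq_iff)
  have q_ker: "q x = 0 \<longleftrightarrow> x \<in> V" if x: "x \<in> car M" for x
  proof
    assume q0: "q x = 0"
    have "S.representation C x b = 0" if "b \<in> C - C0" for b
    proof -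
      have "b \<in> h ` {0..<d}" using bij_betw_imp_surj_on[OF h] that by simp
      then obtain i where "i < d" "b = h i" by auto
      then show ?thesis using fun_cong[OF q0, of i] by (simp add: q_def)
    qed
    moreover have "x = (\<Sum>b\<in>C. smul M (S.representation C x b) b)"
      using S.sum_representation_eq[OF C(3) _ Cfin] x spC by simp
    moreover have "\<dots> = (\<Sum>b\<in>C0. smul M (S.representation C x b) b)"
      using calculation(1) Cfin C(1) by (intro sum.mono_neutral_right) auto
    moreover have "\<dots> \<in> V" by (rule sm_sum[OF M' V]) (use C0(2) sm_smul[OF M' V] in blast)
    ultimately show "x \<in> V" by simp
  next
    assume "x \<in> V"
    then have x0: "x \<in> S.span C0" using C0(4) by simp
    have "S.representation C x = S.representation C0 x" by (rule S.representation_extend[OF C(3) x0 C(1)])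
    moreover have "S.representation C0 x (h i) = 0" if "i < d" for i
      using hC(2)[OF that] S.representation_ne_zero[of C0 x "h i"] by metis
    ultimately show "q x = 0" by (auto simp: q_def fun_eq_iff)
  qed
  have s_in: "s y \<in> car M" for y unfolding s_def
    by (rule rm_sum[OF M'], rule rm_smul[OF M'], rule subsetD[OF C(2)], rule hC(1)) simp
  have q_h: "q (h i) = (\<lambda>j. if j = i then 1 else 0)" if "i < d" for i
    using S.representation_basis[OF C(3) hC(1)[OF that]] hinj[OF _ that] that by (auto simp: q_def fun_eq_iff)
  have qs: "q (s y) = y" if "y \<in> Y" for y
  proof -
    have q0: "q 0 = 0" using q_ker[OF rm_zero[OF M']] sm_zero[OF M' V] by simp
    have fin: "q (\<Sum>i\<in>I. smul M (y i) (h i)) = (\<Sum>i\<in>I. (\<lambda>j. y i * q (h i) j))" if "finite I" "I \<subseteq> {..<d}" for I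
      using that
    proof (induction I)
      case (insert i I)
      have i: "h i \<in> car M" using insert hC(1)[of i] C(2) by auto
      have I: "(\<Sum>i\<in>I. smul M (y i) (h i)) \<in> car M"
        by (rule rm_sum[OF M']) (use insert hC C(2) rm_smul[OF M'] in blast)
      show ?case using insert q_add[OF rm_smul[OF M' i, of "y i"] I] q_smul[OF i, of "y i"]
        by simp
    qed (simp add: q0)
    have "q (s y) = (\<Sum>i<d. (\<lambda>j. y i * q (h i) j))" unfolding s_def by (rule fin) auto
    also have "\<dots> = (\<Sum>i<d. (\<lambda>j. y i * (if j = i then 1 else 0)))"
      by (intro sum.cong) (auto simp: q_h)
    also have "\<dots> = y"
    proof
      fix j
      have "(\<Sum>i<d. (\<lambda>j. y i * (if j = i then 1 else 0))) j = (\<Sum>i<d. if j = i then y i else 0)"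
        unfolding sum_fun_apply by (intro sum.cong) auto
      also have "\<dots> = (if j < d then y j else 0)" by simp
      also have "\<dots> = y j" using \<open>y \<in> Y\<close> unfolding Y_def by simp
      finally show "(\<Sum>i<d. (\<lambda>j. y i * (if j = i then 1 else 0))) j = y j" .
    qed
    finally show ?thesis .
  qed
  have qY: "q x \<in> Y" for x unfolding Y_def q_def by simp
  define X where "X = \<lparr>car = Y, smul = (\<lambda>c (y :: nat \<Rightarrow> 'k) i. c * y i), act = (\<lambda>a y. q (act M a (s y)))\<rparr>"
  have X [simp]: "car X = Y" "smul X = (\<lambda>c (y :: nat \<Rightarrow> 'k) i. c * y i)" "act X a y = q (act M a (s y))" for a y
    unfolding X_def by simp_all
  have act_q: "act X a (q x) = q (act M a x)" if x: "x \<in> car M" for a x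
  proof -
    have "q (s (q x) - x) = 0" using q_diff[OF s_in x] qs[OF qY] by simp
    then have "s (q x) - x \<in> V" using q_ker[OF rm_diff[OF M' s_in x]] by blast
    then have "act M a (s (q x) - x) \<in> V" by (rule sm_act[OF M' V])
    then have "q (act M a (s (q x) - x)) = 0" using q_ker submodule_subset[OF V] by blast
    then show ?thesis
      using rm_act_diff[OF M' s_in x] q_diff[OF rm_act[OF M' s_in] rm_act[OF M' x]] by simp
  qed
  have surj: "\<exists>x\<in>car M. y = q x" if "y \<in> Y" for y using qs[OF that] s_in by metis
  have rm: "right_module X"
    unfolding right_module_def bilinear_action_def
  proof (intro conjI allI ballI)
    show "vector_space (smul X)" using vector_space_pointwise by simp
    then interpret T: vector_space "smul X" .
    show "T.subspace (car X)" by (rule T.subspaceI) (auto simp: Y_def)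
    fix x assume "x \<in> car X"
    then obtain u where u: "u \<in> car M" "x = q u" using surj by auto
    show "act X a x \<in> car X" for a using qY by simp
    show "act X 1 x = x" using u act_q[OF u(1), of 1] rm_act_one[OF M' u(1)] by simp
    show "act X (a + b) x = act X a x + act X b x" for a b
      using act_q[OF u(1)] u(2) rm_act_plus[OF M' u(1)] q_add[OF rm_act[OF M' u(1)] rm_act[OF M' u(1)]] by metis
    show "act X a (smul X c x) = smul X c (act X a x)" for a c
      using act_q[OF u(1)] act_q[OF rm_smul[OF M' u(1)]] u(2) rm_act_smul[OF M' u(1)]
        q_smul[OF u(1)] q_smul[OF rm_act[OF M' u(1)]] X(2) by metis
    show "act X (scale c a) x = smul X c (act X a x)" for a c
      using act_q[OF u(1)] u(2) rm_act_scale[OF M' u(1)] q_smul[OF rm_act[OF M' u(1)]] X(2) by metis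
    show "act X (a * b) x = act X b (act X a x)" for a b
      using act_q[OF u(1)] act_q[OF rm_act[OF M' u(1)]] u(2) rm_act_mult[OF M' u(1)] by metis
    fix y assume "y \<in> car X"
    then obtain v where v: "v \<in> car M" "y = q v" using surj by auto
    show "act X a (x + y) = act X a x + act X a y" for a
      using act_q[OF u(1)] act_q[OF v(1)] act_q[OF rm_add[OF M' u(1) v(1)]] u(2) v(2)
        rm_act_add[OF M' u(1) v(1)] q_add[OF u(1) v(1)]
        q_add[OF rm_act[OF M' u(1)] rm_act[OF M' v(1)]] by metis
  qed
  have hom: "mhom M X q"
    by (rule mhomI) (use qY q_add q_smul act_q in auto)
  have im: "q ` car M = car X" using qY surj by auto
  have "fg_module X" by (rule fg_image[OF M rm hom im])
  then show ?thesis using hom im q_ker by blast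
qed

text \<open>\<open>W\<close> is the direct sum of \<open>X 0, \<dots>, X (m - 1)\<close>. Recording the injections \<open>\<iota>\<close> and the
  projections \<open>\<pi>\<close> covers external sums as well as decompositions into submodules, where \<open>\<iota>\<close> consists of
  inclusions.\<close>

definition biproduct ::
    "('k, 'a, 'm::ab_group_add) amod \<Rightarrow> nat \<Rightarrow> (nat \<Rightarrow> ('k, 'a, 'l::ab_group_add) amod) \<Rightarrow>
     (nat \<Rightarrow> 'l \<Rightarrow> 'm) \<Rightarrow> (nat \<Rightarrow> 'm \<Rightarrow> 'l) \<Rightarrow> bool" where
  "biproduct W m X \<iota> \<pi> \<longleftrightarrow>
     (\<forall>a<m. right_module (X a) \<and> mhom (X a) W (\<iota> a) \<and> mhom W (X a) (\<pi> a)) \<and>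
     (\<forall>a<m. \<forall>b<m. \<forall>x\<in>car (X a). \<pi> b (\<iota> a x) = (if a = b then x else 0)) \<and>
     (\<forall>w\<in>car W. w = (\<Sum>a<m. \<iota> a (\<pi> a w)))"

lemma biproductD:
  assumes "biproduct W m X \<iota> \<pi>"
  shows bp_right_module: "a < m \<Longrightarrow> right_module (X a)"
    and bp_inj: "a < m \<Longrightarrow> mhom (X a) W (\<iota> a)"
    and bp_proj: "a < m \<Longrightarrow> mhom W (X a) (\<pi> a)"
    and bp_proj_inj: "a < m \<Longrightarrow> b < m \<Longrightarrow> x \<in> car (X a) \<Longrightarrow> \<pi> b (\<iota> a x) = (if a = b then x else 0)"
    and bp_sum: "w \<in> car W \<Longrightarrow> (\<Sum>a<m. \<iota> a (\<pi> a w)) = w"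
  using assms unfolding biproduct_def by (blast, blast, blast, blast, metis)

lemma bp_eq_zero:
  assumes W: "biproduct W m X \<iota> \<pi>" "right_module W" "w \<in> car W" "\<And>a. a < m \<Longrightarrow> \<pi> a w = 0"
  shows "w = 0"
proof -
  have "w = (\<Sum>a<m. \<iota> a (\<pi> a w))" using bp_sum[OF W(1,3)] by simp
  also have "\<dots> = (\<Sum>a<m. 0)"
    using W(4) mhom_0[OF bp_right_module[OF W(1)] bp_inj[OF W(1)]] by (intro sum.cong) auto
  finally show ?thesis by simp
qed

lemma bp_mhom_from:
  assumes W: "biproduct W m X \<iota> \<pi>" and Z: "right_module Z"
    and \<phi>: "\<And>a. a < m \<Longrightarrow> mhom (X a) Z (\<phi> a)"
  shows "mhom W Z (\<lambda>w. \<Sum>a<m. \<phi> a (\<pi> a w))"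
  by (rule mhom_fun_sum[OF Z]) (use mhom_comp[OF bp_proj[OF W] \<phi>] in auto)

lemma bp_mhom_from_inj:
  assumes W: "biproduct W m X \<iota> \<pi>"
    and \<phi>: "\<And>a. a < m \<Longrightarrow> mhom (X a) Z (\<phi> a)" and b: "b < m" "x \<in> car (X b)"
  shows "(\<Sum>a<m. \<phi> a (\<pi> a (\<iota> b x))) = \<phi> b x"
proof -
  have "(\<Sum>a<m. \<phi> a (\<pi> a (\<iota> b x))) = (\<Sum>a<m. if a = b then \<phi> b x else 0)"
    using bp_proj_inj[OF W b(1) _ b(2)] mhom_0[OF bp_right_module[OF W] \<phi>]
    by (intro sum.cong) auto
  then show ?thesis using b by simp
qed

lemma bp_mhom_to:
  assumes W: "biproduct W m X \<iota> \<pi>" "right_module W"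
    and \<psi>: "\<And>a. a < m \<Longrightarrow> mhom Y (X a) (\<psi> a)"
  shows "mhom Y W (\<lambda>y. \<Sum>a<m. \<iota> a (\<psi> a y))"
  by (rule mhom_fun_sum[OF W(2)]) (use mhom_comp[OF \<psi> bp_inj[OF W(1)]] in auto)

lemma bp_proj_sum:
  assumes W: "biproduct W m X \<iota> \<pi>" "right_module W" and z: "\<And>a. a < m \<Longrightarrow> z a \<in> car (X a)" and b: "b < m"
  shows "\<pi> b (\<Sum>a<m. \<iota> a (z a)) = z b"
proof -
  have "\<pi> b (\<Sum>a<m. \<iota> a (z a)) = (\<Sum>a<m. \<pi> b (\<iota> a (z a)))"
    by (rule mhom_sum[OF W(2) bp_proj[OF W(1) b]]) (use z mhom_in[OF bp_inj[OF W(1)]] in auto)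
  also have "\<dots> = (\<Sum>a<m. if a = b then z b else 0)"
    using bp_proj_inj[OF W(1) _ b z] by (intro sum.cong) auto
  finally show ?thesis using b by simp
qed

theorem exists_biproduct:
  fixes X :: "nat \<Rightarrow> ('k, 'a) umod"
  assumes X: "\<And>a. a < m \<Longrightarrow> fg_module (X a)"
  shows "\<exists>(W :: ('k, 'a) umod) \<iota> \<pi>. fg_module W \<and> biproduct W m X \<iota> \<pi>"
proof -
  have X': "right_module (X a)" if "a < m" for a using X[OF that] fg_right_module by blast
  \<comment> \<open>Tuples of elements, indexed by all natural numbers; the default scalar multiplication at the
    indices from \<open>m\<close> on makes the whole ambient type a vector space.\<close>
  define R :: "('k, 'a, nat \<Rightarrow> nat \<Rightarrow> 'k) amod" where
    "R = \<lparr>car = {w. (\<forall>a<m. w a \<in> car (X a)) \<and> (\<forall>a\<ge>m. w a = 0)},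
          smul = (\<lambda>c w a. if a < m then smul (X a) c (w a) else (\<lambda>i. c * w a i)),
          act = (\<lambda>b w a. if a < m then act (X a) b (w a) else 0)\<rparr>"
  have R [simp]: "car R = {w. (\<forall>a<m. w a \<in> car (X a)) \<and> (\<forall>a\<ge>m. w a = 0)}"
    "smul R c w = (\<lambda>a. if a < m then smul (X a) c (w a) else (\<lambda>i. c * w a i))"
    "act R b w = (\<lambda>a. if a < m then act (X a) b (w a) else 0)" for c w b
    unfolding R_def by simp_all
  have vs: "vector_space (smul R)"
  proof (unfold_locales)
    fix c d :: 'k and x y :: "nat \<Rightarrow> nat \<Rightarrow> 'k"
    note V = module.scale_right_distrib[OF rm_module[OF X']] module.scale_left_distrib[OF rm_module[OF X']]
      module.scale_scale[OF rm_module[OF X']] module.scale_one[OF rm_module[OF X']]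
    show "smul R c (x + y) = smul R c x + smul R c y" by (auto simp: fun_eq_iff V algebra_simps)
    show "smul R (c + d) x = smul R c x + smul R d x" by (auto simp: fun_eq_iff V algebra_simps)
    show "smul R c (smul R d x) = smul R (c * d) x" by (auto simp: fun_eq_iff V)
    show "smul R 1 x = x" by (auto simp: fun_eq_iff V)
  qed
  interpret S: vector_space "smul R" by (fact vs)
  have rm: "right_module R"
    unfolding right_module_def bilinear_action_def
  proof (intro conjI allI ballI)
    show "S.subspace (car R)" by (rule S.subspaceI) (auto simp: rm_zero rm_add rm_smul X' fun_eq_iff)
  qed (auto simp: vs fun_eq_iff rm_act rm_act_add rm_act_plus rm_act_smul rm_act_scale rm_act_one rm_act_mult X')
  define \<iota> where "\<iota> a x = (\<lambda>b. if b = a then x else 0)" for a :: nat and x :: "nat \<Rightarrow> 'k"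
  have hi: "mhom (X a) R (\<iota> a)" if "a < m" for a
    by (rule mhomI) (use that in \<open>auto simp: \<iota>_def fun_eq_iff rm_zero X' rm_act_0
      module.scale_zero_right[OF rm_module[OF X']]\<close>)
  have hp: "mhom R (X a) (\<lambda>w. w a)" if "a < m" for a
    by (rule mhomI) (use that in auto)
  have wsum: "w = (\<Sum>a<m. \<iota> a (w a))" if "w \<in> car R" for w
    using that by (auto simp: fun_eq_iff sum_fun_apply \<iota>_def sum.delta' if_distrib if_distribR cong: if_cong)
  have bp: "biproduct R m X \<iota> (\<lambda>a w. w a)"
    unfolding biproduct_def using X' hi hp wsum by (auto simp: \<iota>_def)
  have fg: "fg_module R"
  proof -
    have "\<forall>a<m. \<exists>B. finite B \<and> B \<subseteq> car (X a) \<and> module.span (smul (X a)) B = car (X a)"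
      using fg_module_finite_span[OF X] by blast
    then obtain B where B: "\<And>a. a < m \<Longrightarrow> finite (B a) \<and> B a \<subseteq> car (X a) \<and> module.span (smul (X a)) (B a) = car (X a)"
      by metis
    let ?B = "\<Union>a<m. \<iota> a ` B a"
    have sp: "\<iota> a x \<in> S.span ?B" if a: "a < m" and x: "x \<in> car (X a)" for a x
    proof -
      interpret T: vector_space "smul (X a)" using rm_vs[OF X'[OF a]] .
      have "x \<in> T.span (B a)" using B[OF a] x by simp
      then have "x \<in> car (X a) \<and> \<iota> a x \<in> S.span ?B"
      proof (induction rule: T.span_induct_alt)
        case base then show ?case using S.span_zero mhom_0[OF X'[OF a] hi[OF a]] rm_zero[OF X'[OF a]] by metis
      next
        case (step c x y)
        have x: "x \<in> car (X a)" using B[OF a] step(1) by blast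
        have "\<iota> a x \<in> ?B" using step(1) a by blast
        then have "smul R c (\<iota> a x) + \<iota> a y \<in> S.span ?B"
          using step(2) by (blast intro: S.span_add S.span_scale S.span_base)
        moreover have cx: "smul (X a) c x \<in> car (X a)" and y: "y \<in> car (X a)"
          using step(2) rm_smul[OF X'[OF a] x] by blast+
        moreover have "\<iota> a (smul (X a) c x + y) = smul R c (\<iota> a x) + \<iota> a y"
          using mhom_add[OF hi[OF a] cx y] mhom_smul[OF hi[OF a] x] by (simp only:)
        ultimately show ?case using rm_add[OF X'[OF a] cx y] by (simp only: simp_thms)
      qed
      then show ?thesis ..
    qed
    have "car R \<subseteq> S.span ?B"
    proof
      fix w assume w: "w \<in> car R"
      have "(\<Sum>a<m. \<iota> a (w a)) \<in> S.span ?B" by (rule S.span_sum) (use w sp in auto)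
      then show "w \<in> S.span ?B" using wsum[OF w] by simp
    qed
    moreover have "finite ?B" using B by auto
    ultimately show ?thesis using fg_moduleI[OF rm] by blast
  qed
  obtain W :: "('k, 'a) umod" and q where q: "fg_module W" "mhom R W q" "q ` car R = car W"
    "\<forall>x\<in>car R. q x = 0 \<longleftrightarrow> x \<in> {0}"
    using exists_quotient[OF fg submodule_0[OF rm]] by blast
  have "bij_betw q (car R) (car W)"
    unfolding bij_betw_def using q mhom_inj_on[OF rm q(2)] by blast
  then obtain p where p: "mhom W R p" "\<forall>x\<in>car R. p (q x) = x" "\<forall>y\<in>car W. q (p y) = y"
    using mhom_inverse[OF rm q(2)] by blast
  have "biproduct W m X (\<lambda>a x. q (\<iota> a x)) (\<lambda>a w. p w a)"
    unfolding biproduct_def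
  proof (intro conjI allI impI ballI)
    fix a assume a: "a < m"
    show "right_module (X a)" using X'[OF a] .
    show "mhom (X a) W (\<lambda>x. q (\<iota> a x))" using mhom_comp[OF hi[OF a] q(2)] .
    show "mhom W (X a) (\<lambda>w. p w a)" using mhom_comp[OF p(1) hp[OF a]] .
    show "p (q (\<iota> a x)) b = (if a = b then x else 0)" if "x \<in> car (X a)" for b x
      using p(2) mhom_in[OF hi[OF a] that] by (simp add: \<iota>_def)
  next
    fix w assume w: "w \<in> car W"
    have "w = q (\<Sum>a<m. \<iota> a (p w a))" using wsum[OF mhom_in[OF p(1) w]] p(3) w by metis
    also have "\<dots> = (\<Sum>a<m. q (\<iota> a (p w a)))"
      by (rule mhom_sum[OF rm q(2)]) (use mhom_in[OF hi] mhom_in[OF hp mhom_in[OF p(1) w]] in blast)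
    finally show "w = (\<Sum>a<m. q (\<iota> a (p w a)))" .
  qed
  then show ?thesis using q(1) by blast
qed

text \<open>Since components exist and are unique, they depend linearly and equivariantly on the element, and
  so provide the projections.\<close>

lemma biproduct_of_submodules:
  fixes M :: "('k, 'a, 'm::ab_group_add) amod"
  assumes M: "right_module M" and N: "\<And>i. i < t \<Longrightarrow> submodule (N i) M"
    and ex: "\<And>x. x \<in> car M \<Longrightarrow> \<exists>z. (\<forall>i<t. z i \<in> N i) \<and> x = (\<Sum>i<t. z i)"
    and uniq: "\<And>z i. (\<And>i. i < t \<Longrightarrow> z i \<in> N i) \<Longrightarrow> (\<Sum>i<t. z i) = 0 \<Longrightarrow> i < t \<Longrightarrow> z i = 0"
  shows "\<exists>\<pi>. biproduct M t (\<lambda>i. submod M (N i)) (\<lambda>i x. x) \<pi>"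
proof -
  define z where "z x = (SOME z. (\<forall>i<t. z i \<in> N i) \<and> x = (\<Sum>i<t. z i))" for x
  have z: "(\<forall>i<t. z x i \<in> N i) \<and> x = (\<Sum>i<t. z x i)" if "x \<in> car M" for x
    using someI_ex[OF ex[OF that]] unfolding z_def .
  have zN: "z x i \<in> N i" if "x \<in> car M" "i < t" for x i using z[OF that(1)] that(2) by blast
  have zsum: "x = (\<Sum>i<t. z x i)" if "x \<in> car M" for x using z[OF that] by blast
  have zI: "z x i = y i" if y: "\<And>i. i < t \<Longrightarrow> y i \<in> N i" "x = (\<Sum>i<t. y i)" and i: "i < t" and x: "x \<in> car M" for x y i
  proof -
    have "z x i - y i = 0"
      by (rule uniq[of "\<lambda>i. z x i - y i" i])
        (use zN[OF x] y(1) sm_diff[OF M N] i zsum[OF x] y(2) in \<open>auto simp: sum_subtractf\<close>)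
    then show ?thesis by simp
  qed
  have Nsub: "x \<in> car M" if "i < t" "x \<in> N i" for x i using submodule_subset[OF N] that by blast
  have hom: "mhom M (submod M (N i)) (\<lambda>x. z x i)" if i: "i < t" for i
  proof (rule mhomI)
    fix x assume x: "x \<in> car M"
    show "z x i \<in> car (submod M (N i))" using zN[OF x i] by simp
    show "z (smul M c x) i = smul (submod M (N i)) c (z x i)" for c
    proof -
      have "smul M c x = (\<Sum>i<t. smul M c (z x i))"
        using zsum[OF x] module.scale_sum_right[OF rm_module[OF M]] by metis
      then show ?thesis using zI[of "\<lambda>i. smul M c (z x i)" "smul M c x" i] i rm_smul[OF M x, of c] sm_smul[OF M N] zN[OF x] by simp
    qed
    show "z (act M c x) i = act (submod M (N i)) c (z x i)" for c
    proof -
      have "act M c x = (\<Sum>i<t. act M c (z x i))"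
        using zsum[OF x] rm_act_sum[OF M, of "{..<t}" "z x" c] Nsub zN[OF x] by auto
      then show ?thesis using zI[of "\<lambda>i. act M c (z x i)" "act M c x" i] i rm_act[OF M x, of c] sm_act[OF M N] zN[OF x] by simp
    qed
    fix y assume y: "y \<in> car M"
    have "x + y = (\<Sum>i<t. z x i + z y i)" using zsum[OF x] zsum[OF y] by (simp add: sum.distrib)
    then show "z (x + y) i = z x i + z y i"
      using zI[of "\<lambda>i. z x i + z y i" "x + y" i] i rm_add[OF M x y] sm_add[OF M N] zN[OF x] zN[OF y] by simp
  qed
  have "biproduct M t (\<lambda>i. submod M (N i)) (\<lambda>i x. x) (\<lambda>i x. z x i)"
    unfolding biproduct_def
  proof (intro conjI allI impI ballI)
    fix i assume i: "i < t"
    show "right_module (submod M (N i))" by (rule right_module_submod[OF M N[OF i]])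
    show "mhom (submod M (N i)) M (\<lambda>x. x)" by (rule mhom_incl[OF submodule_subset[OF N[OF i]]])
    show "mhom M (submod M (N i)) (\<lambda>x. z x i)" by (rule hom[OF i])
    fix j x assume j: "j < t" and "x \<in> car (submod M (N i))"
    then have x: "x \<in> N i" by simp
    show "z x j = (if i = j then x else 0)"
      by (rule zI[of "\<lambda>j. if i = j then x else 0"])
        (use x i j Nsub[OF i x] sm_zero[OF M N] in \<open>auto simp: sum.delta\<close>)
  next
    fix w assume "w \<in> car M"
    then show "w = (\<Sum>a<t. z w a)" by (rule zsum)
  qed
  then show ?thesis by blast
qed

lemma indec_decomp_biproduct:
  fixes M :: "('k, 'a, 'm::ab_group_add) amod"
  assumes M: "right_module M" and N: "indec_decomp M t N"
  shows "\<exists>\<pi>. biproduct M t (\<lambda>i. submod M (N i)) (\<lambda>i x. x) \<pi>"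
proof (rule biproduct_of_submodules[OF M])
  have sub: "submodule (N i) M" if "i < t" for i using N that unfolding indec_decomp_def by blast
  show "i < t \<Longrightarrow> submodule (N i) M" for i by (rule sub)
  have ex1: "\<exists>!y. y \<in> PiE {..<t} N \<and> x = (\<Sum>i<t. y i)" if "x \<in> car M" for x
    using N that unfolding indec_decomp_def by blast
  show "\<exists>z. (\<forall>i<t. z i \<in> N i) \<and> x = (\<Sum>i<t. z i)" if "x \<in> car M" for x
    using ex1[OF that] by (metis PiE_mem lessThan_iff)
  fix z i assume z: "\<And>i. i < t \<Longrightarrow> z i \<in> N i" "(\<Sum>i<t. z i) = 0" and i: "i < t"
  let ?z = "restrict z {..<t}" and ?o = "restrict (\<lambda>i. 0) {..<t}"
  have "?z \<in> PiE {..<t} N \<and> 0 = (\<Sum>i<t. ?z i)" using z by auto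
  moreover have "?o \<in> PiE {..<t} N \<and> 0 = (\<Sum>i<t. ?o i)" using sm_zero[OF M sub] by auto
  ultimately have "?z = ?o" using ex1[OF rm_zero[OF M]] by blast
  then have "?z i = ?o i" by simp
  then show "z i = 0" using i by simp
qed

lemma complementary_biproduct:
  fixes M :: "('k, 'a, 'm::ab_group_add) amod"
  assumes M: "right_module M" and c: "complementary M V W"
  shows "\<exists>\<pi>. biproduct M 2 (\<lambda>i. submod M (if i = 0 then V else W)) (\<lambda>i x. x) \<pi>"
proof (rule biproduct_of_submodules[OF M])
  have V: "submodule V M" and W: "submodule W M" and VW: "V \<inter> W = {0}" "set_sum V W = car M"
    using c unfolding complementary_def by blast+
  have two: "(\<Sum>i<2. z i) = z 0 + z 1" for z :: "nat \<Rightarrow> 'm" by (simp add: numeral_2_eq_2)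
  show "i < 2 \<Longrightarrow> submodule (if i = 0 then V else W) M" for i :: nat using V W by simp
  show "\<exists>z. (\<forall>i<2. z i \<in> (if i = (0::nat) then V else W)) \<and> x = (\<Sum>i<2. z i)" if x: "x \<in> car M" for x
  proof -
    obtain v w where "x = v + w" "v \<in> V" "w \<in> W" using x VW(2) unfolding set_sum_def by blast
    then show ?thesis by (intro exI[of _ "\<lambda>i. if i = 0 then v else w"]) (simp add: two)
  qed
  fix z :: "nat \<Rightarrow> 'm" and i :: nat
  assume z: "\<And>i. i < 2 \<Longrightarrow> z i \<in> (if i = 0 then V else W)" "(\<Sum>i<2. z i) = 0" and i: "i < 2"
  have e: "z 0 = 0 - z 1" using z(2) two[of z] by (simp add: eq_neg_iff_add_eq_0)
  have z01: "z 0 \<in> V" "z 1 \<in> W" using z(1)[of 0] z(1)[of 1] by auto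
  then have "z 0 \<in> W" using e sm_diff[OF M W sm_zero[OF M W]] by metis
  then have "z 0 = 0" using VW z01 by blast
  moreover have "z 1 = 0" using e calculation by simp
  ultimately show "z i = 0" using i by (cases i) auto
qed

end

section \<open>Dimensions of spaces of homomorphisms\<close>

context fd_algebra
begin

text \<open>Homomorphisms are normalised to vanish outside the carrier. Thus they form a subspace of a function
  space, and maps that agree on the carrier are not counted twice in \<open>hdim\<close>.\<close>

definition homs :: "('k, 'a, 'm::ab_group_add) amod \<Rightarrow> ('k, 'a, 'l::ab_group_add) amod \<Rightarrow> ('m \<Rightarrow> 'l) set" where
  "homs M X = {f. mhom M X f \<and> (\<forall>x. x \<notin> car M \<longrightarrow> f x = 0)}"

definition homscale :: "('k, 'a, 'l) amod \<Rightarrow> 'k \<Rightarrow> ('m \<Rightarrow> 'l) \<Rightarrow> 'm \<Rightarrow> 'l" where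
  "homscale X c f = (\<lambda>x. smul X c (f x))"

definition hdim :: "('k, 'a, 'm::ab_group_add) amod \<Rightarrow> ('k, 'a, 'l::ab_group_add) amod \<Rightarrow> nat" where
  "hdim M X = vector_space.dim (homscale X) (homs M X)"

definition extend0 :: "('k, 'a, 'm) amod \<Rightarrow> ('m \<Rightarrow> 'l::zero) \<Rightarrow> 'm \<Rightarrow> 'l" where
  "extend0 M f = (\<lambda>x. if x \<in> car M then f x else 0)"

lemma extend0_in [simp]: "x \<in> car M \<Longrightarrow> extend0 M f x = f x"
  and extend0_out [simp]: "x \<notin> car M \<Longrightarrow> extend0 M f x = 0"
  unfolding extend0_def by simp_all

lemma extend0_homs: "right_module M \<Longrightarrow> mhom M X f \<Longrightarrow> extend0 M f \<in> homs M X"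
  unfolding homs_def using mhom_cong[of M X f "extend0 M f"] by simp

lemma homs_mhom: "f \<in> homs M X \<Longrightarrow> mhom M X f"
  unfolding homs_def by blast

lemma homs_out: "f \<in> homs M X \<Longrightarrow> x \<notin> car M \<Longrightarrow> f x = 0"
  unfolding homs_def by blast

lemma homs_eq_extend0: "f \<in> homs M X \<Longrightarrow> (\<And>x. x \<in> car M \<Longrightarrow> f x = g x) \<Longrightarrow> f = extend0 M g"
  unfolding extend0_def using homs_out by fastforce

lemma vector_space_homscale:
  assumes "right_module X"
  shows "vector_space (homscale X :: 'k \<Rightarrow> ('m \<Rightarrow> 'l::ab_group_add) \<Rightarrow> 'm \<Rightarrow> 'l)"
proof -
  interpret V: vector_space "smul X" using rm_vs[OF assms] .
  show ?thesis
    by unfold_locales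
      (auto simp: homscale_def fun_eq_iff V.scale_right_distrib V.scale_left_distrib)
qed

lemma homs_subspace:
  assumes X: "right_module X" shows "module.subspace (homscale X) (homs M X)"
proof -
  interpret H: vector_space "homscale X" using vector_space_homscale[OF X] .
  interpret V: vector_space "smul X" using rm_vs[OF X] .
  show ?thesis
  proof (rule H.subspaceI)
    show "0 \<in> homs M X" unfolding homs_def using mhom_zero[OF X] by (simp add: zero_fun_def)
    show "f + g \<in> homs M X" if "f \<in> homs M X" "g \<in> homs M X" for f g
      using that mhom_fun_add[OF X, of M f g] unfolding homs_def by (simp add: plus_fun_def)
    show "homscale X c f \<in> homs M X" if "f \<in> homs M X" for c f
      using that mhom_fun_smul[OF X, of M f c] unfolding homs_def homscale_def by simp
  qed
qed

text \<open>Matrix units with respect to bases of \<open>M\<close> and \<open>X\<close> span all linear maps.\<close>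

lemma homs_finite_span:
  fixes M :: "('k, 'a, 'm::ab_group_add) amod" and X :: "('k, 'a, 'l::ab_group_add) amod"
  assumes M: "fg_module M" and X: "fg_module X"
  shows "\<exists>E. finite E \<and> homs M X \<subseteq> module.span (homscale X) E"
proof -
  note M' = fg_right_module[OF M] and X' = fg_right_module[OF X]
  interpret H: vector_space "homscale X :: 'k \<Rightarrow> ('m \<Rightarrow> 'l) \<Rightarrow> 'm \<Rightarrow> 'l" using vector_space_homscale[OF X'] .
  interpret S: vector_space "smul M" using rm_vs[OF M'] .
  interpret V: vector_space "smul X" using rm_vs[OF X'] .
  obtain B0 where B0: "finite B0" "S.span B0 = car M" using fg_module_finite_span[OF M] by blast
  obtain C0 where C0: "finite C0" "V.span C0 = car X" using fg_module_finite_span[OF X] by blast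
  obtain B where B: "finite B" "B \<subseteq> car M" "S.independent B" "S.span B = car M"
    using S.finite_basis_of_subspace[OF rm_subspace[OF M'] _ B0(1)] B0(2) by auto
  obtain C where C: "finite C" "C \<subseteq> car X" "V.independent C" "V.span C = car X"
    using V.finite_basis_of_subspace[OF rm_subspace[OF X'] _ C0(1)] C0(2) by auto
  define e where "e b c = extend0 M (\<lambda>x. smul X (S.representation B x b) c)" for b c
  define E where "E = (\<lambda>(b, c). e b c) ` (B \<times> C)"
  have "f \<in> H.span E" if f: "f \<in> homs M X" for f
  proof -
    have fM: "mhom M X f" using homs_mhom[OF f] .
    have "f = (\<Sum>b\<in>B. \<Sum>c\<in>C. homscale X (V.representation C (f b) c) (e b c))"
    proof
      fix x
      show "f x = (\<Sum>b\<in>B. \<Sum>c\<in>C. homscale X (V.representation C (f b) c) (e b c)) x"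
      proof (cases "x \<in> car M")
        case False
        then show ?thesis using homs_out[OF f] by (simp add: sum_fun_apply homscale_def e_def)
      next
        case True
        have "f x = f (\<Sum>b\<in>B. smul M (S.representation B x b) b)"
          using S.sum_representation_eq[OF B(3) _ B(1)] True B(4) by simp
        also have "\<dots> = (\<Sum>b\<in>B. f (smul M (S.representation B x b) b))"
          by (rule mhom_sum[OF M' fM]) (use B(2) rm_smul[OF M'] in blast)
        also have "\<dots> = (\<Sum>b\<in>B. smul X (S.representation B x b) (f b))"
          by (intro sum.cong refl mhom_smul[OF fM]) (use B(2) in blast)
        also have "\<dots> = (\<Sum>b\<in>B. \<Sum>c\<in>C. smul X (V.representation C (f b) c) (smul X (S.representation B x b) c))"
        proof (intro sum.cong refl)
          fix b assume "b \<in> B"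
          then have "f b \<in> V.span C" using B(2) mhom_in[OF fM] C(4) by blast
          then have "f b = (\<Sum>c\<in>C. smul X (V.representation C (f b) c) c)"
            using V.sum_representation_eq[OF C(3) _ C(1)] by simp
          then have "smul X (S.representation B x b) (f b) =
              (\<Sum>c\<in>C. smul X (S.representation B x b) (smul X (V.representation C (f b) c) c))"
            using V.scale_sum_right by metis
          then show "smul X (S.representation B x b) (f b) =
              (\<Sum>c\<in>C. smul X (V.representation C (f b) c) (smul X (S.representation B x b) c))"
            by (simp add: mult.commute)
        qed
        finally show ?thesis using True by (simp add: sum_fun_apply homscale_def e_def)
      qed
    qed
    moreover have "(\<Sum>b\<in>B. \<Sum>c\<in>C. homscale X (V.representation C (f b) c) (e b c)) \<in> H.span E"
      by (intro H.span_sum H.span_scale H.span_base) (auto simp: E_def)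
    ultimately show ?thesis by simp
  qed
  moreover have "finite E" unfolding E_def using B(1) C(1) by simp
  ultimately show ?thesis by blast
qed

lemma finite_spanning_homs:
  fixes M :: "('k, 'a, 'm::ab_group_add) amod" and X :: "('k, 'a, 'l::ab_group_add) amod"
  assumes M: "fg_module M" and X: "fg_module X"
  shows "\<exists>F. finite F \<and> F \<subseteq> homs M X \<and>
    (\<forall>\<phi>. mhom M X \<phi> \<longrightarrow> (\<exists>c. \<forall>x\<in>car M. \<phi> x = (\<Sum>f\<in>F. smul X (c f) (f x))))"
proof -
  note M' = fg_right_module[OF M] and X' = fg_right_module[OF X]
  interpret H: vector_space "homscale X :: 'k \<Rightarrow> ('m \<Rightarrow> 'l) \<Rightarrow> 'm \<Rightarrow> 'l" using vector_space_homscale[OF X'] .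
  obtain E where E: "finite E" "homs M X \<subseteq> H.span E" using homs_finite_span[OF M X] by blast
  obtain F where F: "finite F" "F \<subseteq> homs M X" "H.span F = homs M X"
    using H.finite_basis_of_subspace[OF homs_subspace[OF X'] E(2,1)] by blast
  have "\<exists>c. \<forall>x\<in>car M. \<phi> x = (\<Sum>f\<in>F. smul X (c f) (f x))" if "mhom M X \<phi>" for \<phi>
  proof -
    have "extend0 M \<phi> \<in> range (\<lambda>u. \<Sum>f\<in>F. homscale X (u f) f)"
      using extend0_homs[OF M' that] F(3) H.span_finite[OF F(1)] by simp
    then obtain c where c: "extend0 M \<phi> = (\<Sum>f\<in>F. homscale X (c f) f)" by blast
    have "\<phi> x = (\<Sum>f\<in>F. smul X (c f) (f x))" if "x \<in> car M" for x
      using fun_cong[OF c, of x] that by (simp add: sum_fun_apply homscale_def)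
    then show ?thesis by blast
  qed
  then show ?thesis using F by blast
qed

text \<open>A finite list of homomorphisms that spans all spaces \<open>Hom(M l, X l)\<close> at once. The direct sums over
  such a list carry the approximations and the universal extensions below.\<close>

lemma finite_spanning_homs_family:
  fixes M :: "'i \<Rightarrow> ('k, 'a, 'm::ab_group_add) amod" and X :: "'i \<Rightarrow> ('k, 'a, 'l::ab_group_add) amod"
  assumes L: "finite L" and M: "\<And>l. l \<in> L \<Longrightarrow> fg_module (M l)" and X: "\<And>l. l \<in> L \<Longrightarrow> fg_module (X l)"
  shows "\<exists>s ix b. (\<forall>a<s. ix a \<in> L \<and> mhom (M (ix a)) (X (ix a)) (b a)) \<and>
    (\<forall>l\<in>L. \<forall>\<phi>. mhom (M l) (X l) \<phi> \<longrightarrow>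
      (\<exists>c. \<forall>x\<in>car (M l). \<phi> x = (\<Sum>a\<in>{a. a < (s::nat) \<and> ix a = l}. smul (X l) (c a) (b a x))))"
proof -
  have "\<forall>l\<in>L. \<exists>F. finite F \<and> F \<subseteq> homs (M l) (X l) \<and>
    (\<forall>\<phi>. mhom (M l) (X l) \<phi> \<longrightarrow> (\<exists>c. \<forall>x\<in>car (M l). \<phi> x = (\<Sum>f\<in>F. smul (X l) (c f) (f x))))"
    using finite_spanning_homs[OF M X] by blast
  from bchoice[OF this] obtain F where F: "\<forall>l\<in>L. finite (F l) \<and> F l \<subseteq> homs (M l) (X l) \<and>
    (\<forall>\<phi>. mhom (M l) (X l) \<phi> \<longrightarrow> (\<exists>c. \<forall>x\<in>car (M l). \<phi> x = (\<Sum>f\<in>F l. smul (X l) (c f) (f x))))"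
    by blast
  obtain h where h: "bij_betw h {0..<card (Sigma L F)} (Sigma L F)"
    using ex_bij_betw_nat_finite[of "Sigma L F"] L F by (meson finite_SigmaI)
  let ?s = "card (Sigma L F)" and ?ix = "\<lambda>a. fst (h a)" and ?b = "\<lambda>a. snd (h a)"
  have hS: "h a \<in> Sigma L F" if "a < ?s" for a
    using that by (intro bij_betw_apply[OF h]) simp
  show ?thesis
  proof (intro exI[of _ ?s] exI[of _ ?ix] exI[of _ ?b] conjI allI impI ballI)
    fix a assume a: "a < ?s"
    show "?ix a \<in> L" using hS[OF a] by (metis SigmaD1 prod.collapse)
    have "?b a \<in> F (?ix a)" using hS[OF a] by (metis SigmaD2 prod.collapse)
    then show "mhom (M (?ix a)) (X (?ix a)) (?b a)" using F \<open>?ix a \<in> L\<close> homs_mhom by blast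
  next
    fix l \<phi> assume l: "l \<in> L" and "mhom (M l) (X l) \<phi>"
    then obtain c where c: "\<forall>x\<in>car (M l). \<phi> x = (\<Sum>f\<in>F l. smul (X l) (c f) (f x))" using F by blast
    have bij: "bij_betw ?b {a. a < ?s \<and> ?ix a = l} (F l)"
    proof (rule bij_betwI')
      fix a a' assume a: "a \<in> {a. a < ?s \<and> ?ix a = l}" "a' \<in> {a. a < ?s \<and> ?ix a = l}"
      then have "?b a = ?b a' \<longleftrightarrow> h a = h a'" by (auto simp: prod_eq_iff)
      also have "\<dots> \<longleftrightarrow> a = a'" using a inj_on_eq_iff[OF bij_betw_imp_inj_on[OF h], of a a'] by simp
      finally show "?b a = ?b a' \<longleftrightarrow> a = a'" .
    next
      fix a assume a: "a \<in> {a. a < ?s \<and> ?ix a = l}"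
      then have "h a \<in> Sigma L F" using hS by blast
      then have "?b a \<in> F (?ix a)" by (metis SigmaD2 prod.collapse)
      then show "?b a \<in> F l" using a by simp
    next
      fix f assume "f \<in> F l"
      then have "(l, f) \<in> h ` {0..<?s}" using bij_betw_imp_surj_on[OF h] l by blast
      then obtain a where "a < ?s" "h a = (l, f)" by auto
      then show "\<exists>a\<in>{a. a < ?s \<and> ?ix a = l}. f = ?b a" by (intro bexI[of _ a]) auto
    qed
    have "\<phi> x = (\<Sum>a\<in>{a. a < ?s \<and> ?ix a = l}. smul (X l) (c (?b a)) (?b a x))" if "x \<in> car (M l)" for x
      using c that sum.reindex_bij_betw[OF bij, of "\<lambda>f. smul (X l) (c f) (f x)"] by simp
    then show "\<exists>c. \<forall>x\<in>car (M l). \<phi> x = (\<Sum>a\<in>{a. a < ?s \<and> ?ix a = l}. smul (X l) (c a) (?b a x))"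
      by (intro exI[of _ "\<lambda>a. c (?b a)"]) blast
  qed
qed

lemma homs_rank_nullity:
  fixes M :: "('k, 'a, 'm::ab_group_add) amod" and X :: "('k, 'a, 'l::ab_group_add) amod"
    and Y :: "('k, 'a, 'j::ab_group_add) amod"
  assumes M: "fg_module M" and X: "fg_module X" and Y: "right_module Y"
    and V: "module.subspace (homscale X) V" "V \<subseteq> homs M X"
    and add: "\<And>f g. f \<in> V \<Longrightarrow> g \<in> V \<Longrightarrow> \<Phi> (f + g) = \<Phi> f + \<Phi> g"
    and sc: "\<And>c f. f \<in> V \<Longrightarrow> \<Phi> (homscale X c f) = homscale Y c (\<Phi> f)"
  shows "vector_space.dim (homscale X) V =
    vector_space.dim (homscale Y :: 'k \<Rightarrow> ('i \<Rightarrow> 'j) \<Rightarrow> 'i \<Rightarrow> 'j) (\<Phi> ` V) +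
    vector_space.dim (homscale X) {f \<in> V. \<Phi> f = 0}"
proof -
  obtain E where E: "finite E" "homs M X \<subseteq> module.span (homscale X) E" using homs_finite_span[OF M X] by blast
  show ?thesis
    by (rule rank_nullity_on_subspace[where \<phi>=\<Phi>, OF vector_space_homscale[OF fg_right_module[OF X]]
      vector_space_homscale[OF Y] V(1) subset_trans[OF V(2) E(2)] E(1) add sc])
qed

lemma homs_dim_image_inj:
  fixes M :: "('k, 'a, 'm::ab_group_add) amod" and X :: "('k, 'a, 'l::ab_group_add) amod"
    and Y :: "('k, 'a, 'j::ab_group_add) amod"
  assumes M: "fg_module M" and X: "fg_module X" and Y: "right_module Y"
    and add: "\<And>f g. f \<in> homs M X \<Longrightarrow> g \<in> homs M X \<Longrightarrow> \<Phi> (f + g) = \<Phi> f + \<Phi> g"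
    and sc: "\<And>c f. f \<in> homs M X \<Longrightarrow> \<Phi> (homscale X c f) = homscale Y c (\<Phi> f)"
    and inj: "\<And>f. f \<in> homs M X \<Longrightarrow> \<Phi> f = 0 \<Longrightarrow> f = 0"
  shows "vector_space.dim (homscale Y :: 'k \<Rightarrow> ('i \<Rightarrow> 'j) \<Rightarrow> 'i \<Rightarrow> 'j) (\<Phi> ` homs M X) = hdim M X"
proof -
  note X' = fg_right_module[OF X]
  interpret H: vector_space "homscale X :: 'k \<Rightarrow> ('m \<Rightarrow> 'l) \<Rightarrow> 'm \<Rightarrow> 'l" using vector_space_homscale[OF X'] .
  interpret K: vector_space "homscale Y :: 'k \<Rightarrow> ('i \<Rightarrow> 'j) \<Rightarrow> 'i \<Rightarrow> 'j" using vector_space_homscale[OF Y] .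
  have z: "0 \<in> homs M X" using H.subspace_0[OF homs_subspace[OF X']] .
  have "\<Phi> 0 = 0" using add[OF z z] by simp
  then have "{f \<in> homs M X. \<Phi> f = 0} = {0}" using inj z by blast
  then show ?thesis
    using homs_rank_nullity[where \<Phi>=\<Phi>, OF M X Y homs_subspace[OF X'] subset_refl add sc] H.dim_zero_space
    unfolding hdim_def by simp
qed

lemma hdim_pos:
  fixes M :: "('k, 'a, 'm::ab_group_add) amod" and X :: "('k, 'a, 'l::ab_group_add) amod"
  assumes M: "fg_module M" and X: "fg_module X" and f: "mhom M X f" "x \<in> car M" "f x \<noteq> 0"
  shows "0 < hdim M X"
proof -
  note M' = fg_right_module[OF M] and X' = fg_right_module[OF X]
  interpret H: vector_space "homscale X :: 'k \<Rightarrow> ('m \<Rightarrow> 'l) \<Rightarrow> 'm \<Rightarrow> 'l" using vector_space_homscale[OF X'] .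
  obtain E where E: "finite E" "homs M X \<subseteq> H.span E" using homs_finite_span[OF M X] by blast
  have "extend0 M f \<noteq> 0"
  proof
    assume "extend0 M f = 0"
    from fun_cong[OF this, of x] show False using f(2,3) by simp
  qed
  then show ?thesis unfolding hdim_def
    using H.dim_pos[OF homs_subspace[OF X'] E(2,1) extend0_homs[OF M' f(1)]] by blast
qed

lemma hdim_eq_0:
  fixes M :: "('k, 'a, 'm::ab_group_add) amod" and X :: "('k, 'a, 'l::ab_group_add) amod"
  assumes X: "right_module X" and z: "hom_zero M X"
  shows "hdim M X = 0"
proof -
  interpret H: vector_space "homscale X :: 'k \<Rightarrow> ('m \<Rightarrow> 'l) \<Rightarrow> 'm \<Rightarrow> 'l" using vector_space_homscale[OF X] .
  have "f = 0" if "f \<in> homs M X" for f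
  proof
    fix x show "f x = 0 x" using z that homs_mhom[OF that] homs_out[OF that, of x] unfolding hom_zero_def
      by (cases "x \<in> car M") simp_all
  qed
  then have "homs M X = {0}" using H.subspace_0[OF homs_subspace[OF X]] by blast
  then show ?thesis unfolding hdim_def using H.dim_zero_space by simp
qed

lemma extend0_comp_add: "extend0 M (\<lambda>x. (f + g) (a x)) = extend0 M (\<lambda>x. f (a x)) + (extend0 M (\<lambda>x. g (a x)) :: 'm \<Rightarrow> 'l::ab_group_add)"
  unfolding extend0_def by (auto simp: fun_eq_iff)

lemma extend0_comp_scale:
  assumes X: "right_module X"
  shows "extend0 M (\<lambda>x. homscale X c f (a x)) = homscale X c (extend0 M (\<lambda>x. f (a x)))"
  unfolding extend0_def homscale_def using module.scale_zero_right[OF rm_module[OF X]]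
  by (auto simp: fun_eq_iff)

text \<open>Restriction along \<open>a\<close> maps \<open>Hom(N, X)\<close> onto \<open>Hom(M, X)\<close> by assumption, and its kernel consists of
  the maps that factor through the cokernel \<open>b\<close>. The assumption stands in for the injectivity of \<open>a\<close> and
  the vanishing of an extension group.\<close>

theorem hdim_exact_contravariant:
  fixes M :: "('k, 'a, 'm::ab_group_add) amod" and N :: "('k, 'a, 'n::ab_group_add) amod"
    and C :: "('k, 'a, 'c::ab_group_add) amod" and X :: "('k, 'a, 'l::ab_group_add) amod"
  assumes M: "fg_module M" and N: "fg_module N" and C: "fg_module C" and X: "fg_module X"
    and a: "mhom M N a" and b: "mhom N C b" "b ` car N = car C"
    and ex: "\<And>y. y \<in> car N \<Longrightarrow> b y = 0 \<longleftrightarrow> y \<in> a ` car M"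
    and ext: "\<And>\<phi>. mhom M X \<phi> \<Longrightarrow> \<exists>\<psi>. mhom N X \<psi> \<and> (\<forall>x\<in>car M. \<psi> (a x) = \<phi> x)"
  shows "hdim N X = hdim M X + hdim C X"
proof -
  note M' = fg_right_module[OF M] and X' = fg_right_module[OF X] and N' = fg_right_module[OF N]
    and C' = fg_right_module[OF C]
  let ?\<Phi> = "\<lambda>f. extend0 M (\<lambda>x. f (a x))" and ?\<Psi> = "\<lambda>f. extend0 N (\<lambda>x. f (b x))"
  have im: "?\<Phi> ` homs N X = homs M X"
  proof
    show "?\<Phi> ` homs N X \<subseteq> homs M X"
      using extend0_homs[OF M' mhom_comp[OF a homs_mhom]] by blast
    show "homs M X \<subseteq> ?\<Phi> ` homs N X"
    proof
      fix \<phi> assume f: "\<phi> \<in> homs M X"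
      then obtain \<psi> where p: "mhom N X \<psi>" "\<forall>x\<in>car M. \<psi> (a x) = \<phi> x" using ext homs_mhom by blast
      have "\<phi> = ?\<Phi> (extend0 N \<psi>)"
        by (rule homs_eq_extend0[OF f]) (use p(2) mhom_in[OF a] in simp)
      then show "\<phi> \<in> ?\<Phi> ` homs N X" using extend0_homs[OF N' p(1)] by blast
    qed
  qed
  have ker: "{f \<in> homs N X. ?\<Phi> f = 0} = ?\<Psi> ` homs C X"
  proof
    show "?\<Psi> ` homs C X \<subseteq> {f \<in> homs N X. ?\<Phi> f = 0}"
    proof safe
      fix g assume g: "g \<in> homs C X"
      show "?\<Psi> g \<in> homs N X" using extend0_homs[OF N' mhom_comp[OF b(1) homs_mhom[OF g]]] .
      have "g (b (a x)) = 0" if "x \<in> car M" for x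
        using ex[OF mhom_in[OF a that]] that mhom_0[OF C' homs_mhom[OF g]] by simp
      then show "?\<Phi> (?\<Psi> g) = 0" using mhom_in[OF a] by (auto simp: extend0_def fun_eq_iff)
    qed
    show "{f \<in> homs N X. ?\<Phi> f = 0} \<subseteq> ?\<Psi> ` homs C X"
    proof safe
      fix f assume f: "f \<in> homs N X" "?\<Phi> f = 0"
      have fa: "f (a x) = 0" if "x \<in> car M" for x using fun_cong[OF f(2), of x] that by simp
      have "\<exists>k. mhom C X k \<and> (\<forall>x\<in>car N. k (b x) = f x)"
        by (rule mhom_factor_surj[OF N' b homs_mhom[OF f(1)]]) (use ex fa in blast)
      then obtain k where k: "mhom C X k" "\<forall>x\<in>car N. k (b x) = f x" by blast
      have "f = ?\<Psi> (extend0 C k)"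
        by (rule homs_eq_extend0[OF f(1)]) (use k(2) mhom_in[OF b(1)] in simp)
      then show "f \<in> ?\<Psi> ` homs C X" using extend0_homs[OF C' k(1)] by blast
    qed
  qed
  have "vector_space.dim (homscale X) (?\<Psi> ` homs C X) = hdim C X"
  proof (rule homs_dim_image_inj[OF C X X'])
    fix f assume f: "f \<in> homs C X" "?\<Psi> f = 0"
    have "f y = 0" for y
    proof (cases "y \<in> car C")
      case True
      then obtain x where "x \<in> car N" "y = b x" using b(2) by blast
      then show ?thesis using fun_cong[OF f(2), of x] by simp
    qed (use homs_out[OF f(1)] in blast)
    then show "f = 0" by (simp add: fun_eq_iff)
  qed (use extend0_comp_add extend0_comp_scale[OF X'] in blast)+
  then show ?thesis
    using homs_rank_nullity[where \<Phi>="?\<Phi>", OF N X X' homs_subspace[OF X'] subset_refl extend0_comp_add extend0_comp_scale[OF X']]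
    unfolding im ker hdim_def by simp
qed

text \<open>Composition with \<open>r\<close> maps \<open>Hom(P, X)\<close> onto \<open>Hom(P, Z)\<close> by assumption, and its kernel consists of
  the maps with values in the image of \<open>j\<close>.\<close>

theorem hdim_exact_covariant:
  fixes P :: "('k, 'a, 'm::ab_group_add) amod" and Y :: "('k, 'a, 'n::ab_group_add) amod"
    and Z :: "('k, 'a, 'c::ab_group_add) amod" and X :: "('k, 'a, 'l::ab_group_add) amod"
  assumes P: "fg_module P" and Y: "fg_module Y" and X: "fg_module X" and Z: "fg_module Z"
    and j: "mhom Y X j" "inj_on j (car Y)" and r: "mhom X Z r"
    and ex: "\<And>x. x \<in> car X \<Longrightarrow> r x = 0 \<longleftrightarrow> x \<in> j ` car Y"
    and lift: "\<And>\<phi>. mhom P Z \<phi> \<Longrightarrow> \<exists>\<psi>. mhom P X \<psi> \<and> (\<forall>x\<in>car P. r (\<psi> x) = \<phi> x)"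
  shows "hdim P X = hdim P Y + hdim P Z"
proof -
  note P' = fg_right_module[OF P] and X' = fg_right_module[OF X] and Y' = fg_right_module[OF Y]
    and Z' = fg_right_module[OF Z]
  let ?\<Phi> = "\<lambda>f. extend0 P (\<lambda>x. r (f x))" and ?\<Psi> = "\<lambda>f. extend0 P (\<lambda>x. j (f x))"
  have add: "extend0 P (\<lambda>x. h ((f + g) x)) = extend0 P (\<lambda>x. h (f x)) + extend0 P (\<lambda>x. h (g x))"
    if "mhom A B h" "f \<in> homs P A" "g \<in> homs P A" for f g h
      and A :: "('k, 'a, 'v::ab_group_add) amod" and B :: "('k, 'a, 'w::ab_group_add) amod"
    using mhom_add[OF that(1)] mhom_in[OF homs_mhom[OF that(2)]] mhom_in[OF homs_mhom[OF that(3)]]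
    by (auto simp: extend0_def fun_eq_iff)
  have sc: "extend0 P (\<lambda>x. h (homscale A c f x)) = homscale B c (extend0 P (\<lambda>x. h (f x)))"
    if "mhom A B h" "f \<in> homs P A" "right_module B" for f h c
      and A :: "('k, 'a, 'v::ab_group_add) amod" and B :: "('k, 'a, 'w::ab_group_add) amod"
    using mhom_smul[OF that(1)] mhom_in[OF homs_mhom[OF that(2)]] module.scale_zero_right[OF rm_module[OF that(3)]]
    by (auto simp: extend0_def homscale_def fun_eq_iff)
  have im: "?\<Phi> ` homs P X = homs P Z"
  proof
    show "?\<Phi> ` homs P X \<subseteq> homs P Z"
      using extend0_homs[OF P' mhom_comp[OF homs_mhom r]] by blast
    show "homs P Z \<subseteq> ?\<Phi> ` homs P X"
    proof
      fix \<phi> assume f: "\<phi> \<in> homs P Z"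
      then obtain \<psi> where p: "mhom P X \<psi>" "\<forall>x\<in>car P. r (\<psi> x) = \<phi> x" using lift homs_mhom by blast
      have "\<phi> = ?\<Phi> (extend0 P \<psi>)"
        by (rule homs_eq_extend0[OF f]) (use p(2) in simp)
      then show "\<phi> \<in> ?\<Phi> ` homs P X" using extend0_homs[OF P' p(1)] by blast
    qed
  qed
  have ker: "{f \<in> homs P X. ?\<Phi> f = 0} = ?\<Psi> ` homs P Y"
  proof
    show "?\<Psi> ` homs P Y \<subseteq> {f \<in> homs P X. ?\<Phi> f = 0}"
    proof safe
      fix g assume g: "g \<in> homs P Y"
      show "?\<Psi> g \<in> homs P X" using extend0_homs[OF P' mhom_comp[OF homs_mhom[OF g] j(1)]] .
      have "r (j (g x)) = 0" if "x \<in> car P" for x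
        using ex[OF mhom_in[OF j(1) mhom_in[OF homs_mhom[OF g] that]]] mhom_in[OF homs_mhom[OF g] that] by blast
      then show "?\<Phi> (?\<Psi> g) = 0" by (auto simp: extend0_def fun_eq_iff)
    qed
    show "{f \<in> homs P X. ?\<Phi> f = 0} \<subseteq> ?\<Psi> ` homs P Y"
    proof safe
      fix f assume f: "f \<in> homs P X" "?\<Phi> f = 0"
      note fm = homs_mhom[OF f(1)]
      have fr: "r (f x) = 0" if "x \<in> car P" for x using fun_cong[OF f(2), of x] that by simp
      then have fj: "f x \<in> j ` car Y" if "x \<in> car P" for x using ex mhom_in[OF fm that] that by blast
      have sub: "submodule (j ` car Y) X" by (rule submodule_range[OF Y' X' j(1)])
      have "bij_betw j (car Y) (car (submod X (j ` car Y)))" using j(2) by (simp add: bij_betw_def)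
      moreover have "mhom Y (submod X (j ` car Y)) j" by (rule mhom_to_submod[OF j(1)]) blast
      ultimately obtain k where k: "mhom (submod X (j ` car Y)) Y k" "\<forall>y\<in>j ` car Y. j (k y) = y"
        using mhom_inverse[OF Y', of "submod X (j ` car Y)" j] by auto
      have "mhom P (submod X (j ` car Y)) f" by (rule mhom_to_submod[OF fm fj])
      then have kf: "mhom P Y (\<lambda>x. k (f x))" using mhom_comp[OF _ k(1)] by blast
      have "f = ?\<Psi> (extend0 P (\<lambda>x. k (f x)))"
        by (rule homs_eq_extend0[OF f(1)]) (simp add: bspec[OF k(2) fj])
      then show "f \<in> ?\<Psi> ` homs P Y" using extend0_homs[OF P' kf] by blast
    qed
  qed
  have "vector_space.dim (homscale X) (?\<Psi> ` homs P Y) = hdim P Y"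
  proof (rule homs_dim_image_inj[OF P Y X' add[OF j(1)] sc[OF j(1) _ X']])
    fix f assume f: "f \<in> homs P Y" "?\<Psi> f = 0"
    have "f x = 0" for x
    proof (cases "x \<in> car P")
      case True
      have "j (f x) = j 0" using fun_cong[OF f(2), of x] True mhom_0[OF Y' j(1)] by simp
      then show ?thesis
        using inj_onD[OF j(2)] mhom_in[OF homs_mhom[OF f(1)] True] rm_zero[OF Y'] by blast
    qed (use homs_out[OF f(1)] in blast)
    then show "f = 0" by (simp add: fun_eq_iff)
  qed
  then show ?thesis
    using homs_rank_nullity[where \<Phi>="?\<Phi>", OF P X Z' homs_subspace[OF X'] subset_refl add[OF r] sc[OF r _ Z']]
    unfolding im ker hdim_def by simp
qed

lemma hdim_iso:
  fixes M :: "('k, 'a, 'm::ab_group_add) amod" and N :: "('k, 'a, 'n::ab_group_add) amod"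
    and X :: "('k, 'a, 'l::ab_group_add) amod"
  assumes M: "fg_module M" and N: "fg_module N" and X: "fg_module X" and i: "mod_iso M N"
  shows "hdim M X = hdim N X"
proof -
  note M' = fg_right_module[OF M] and X' = fg_right_module[OF X] and N' = fg_right_module[OF N]
  obtain f where f: "mhom M N f" "bij_betw f (car M) (car N)" using i unfolding mod_iso_def by blast
  obtain g where g: "mhom N M g" "\<forall>x\<in>car M. g (f x) = x" "\<forall>y\<in>car N. f (g y) = y"
    using mhom_inverse[OF M' f] by blast
  let ?\<Phi> = "\<lambda>h. extend0 N (\<lambda>x. h (g x))"
  have im: "?\<Phi> ` homs M X = homs N X"
  proof
    show "?\<Phi> ` homs M X \<subseteq> homs N X"
      using extend0_homs[OF N' mhom_comp[OF g(1) homs_mhom]] by blast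
    show "homs N X \<subseteq> ?\<Phi> ` homs M X"
    proof
      fix h assume h: "h \<in> homs N X"
      have "h = ?\<Phi> (extend0 M (\<lambda>x. h (f x)))"
        by (rule homs_eq_extend0[OF h]) (use g mhom_in[OF g(1)] in simp)
      then show "h \<in> ?\<Phi> ` homs M X" using extend0_homs[OF M' mhom_comp[OF f(1) homs_mhom[OF h]]] by blast
    qed
  qed
  have "vector_space.dim (homscale X) (?\<Phi> ` homs M X) = hdim M X"
  proof (rule homs_dim_image_inj[OF M X X'])
    fix h assume h: "h \<in> homs M X" "?\<Phi> h = 0"
    have "h x = 0" for x
    proof (cases "x \<in> car M")
      case True
      then show ?thesis using fun_cong[OF h(2), of "f x"] mhom_in[OF f(1) True] g(2) by simp
    qed (use homs_out[OF h(1)] in blast)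
    then show "h = 0" by (simp add: fun_eq_iff)
  qed (use extend0_comp_add extend0_comp_scale[OF X'] in blast)+
  then show ?thesis unfolding im hdim_def by simp
qed

lemma bp_fg:
  assumes "biproduct W m X \<iota> \<pi>" "fg_module W" "a < m" shows "fg_module (X a)"
proof (rule fg_image[OF assms(2) bp_right_module[OF assms(1,3)] bp_proj[OF assms(1,3)]])
  have "x \<in> \<pi> a ` car W" if "x \<in> car (X a)" for x
    using bp_proj_inj[OF assms(1,3,3) that] mhom_in[OF bp_inj[OF assms(1,3)] that] by (metis image_eqI)
  then show "\<pi> a ` car W = car (X a)" using mhom_in[OF bp_proj[OF assms(1,3)]] by blast
qed

text \<open>Rank-nullity is applied to the restriction to one summand after the other.\<close>

theorem hdim_biproduct:
  fixes W :: "('k, 'a, 'm::ab_group_add) amod" and X :: "nat \<Rightarrow> ('k, 'a, 'n::ab_group_add) amod"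
    and Z :: "('k, 'a, 'l::ab_group_add) amod"
  assumes bp: "biproduct W m X \<iota> \<pi>" and W: "fg_module W" and Z: "fg_module Z"
  shows "hdim W Z = (\<Sum>a<m. hdim (X a) Z)"
proof -
  note W' = fg_right_module[OF W] and Z' = fg_right_module[OF Z]
  interpret H: vector_space "homscale Z :: 'k \<Rightarrow> ('m \<Rightarrow> 'l) \<Rightarrow> 'm \<Rightarrow> 'l" using vector_space_homscale[OF Z'] .
  \<comment> \<open>The homomorphisms that live on the first \<open>k\<close> summands.\<close>
  define V where "V k = {f \<in> homs W Z. \<forall>a<m. k \<le> a \<longrightarrow> (\<forall>x\<in>car (X a). f (\<iota> a x) = 0)}" for k
  have subV: "V k \<subseteq> homs W Z" for k unfolding V_def by blast
  note SH = homs_subspace[OF Z', of W]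
  have sV: "H.subspace (V k)" for k
  proof (rule H.subspaceI)
    show "0 \<in> V k" unfolding V_def using H.subspace_0[OF SH] by simp
    show "f + g \<in> V k" if "f \<in> V k" "g \<in> V k" for f g
      using that H.subspace_add[OF SH] unfolding V_def by simp
    show "homscale Z c f \<in> V k" if "f \<in> V k" for c f
      using that H.subspace_scale[OF SH] module.scale_zero_right[OF rm_module[OF Z']]
      unfolding V_def by (simp add: homscale_def)
  qed
  have "k \<le> m \<Longrightarrow> H.dim (V k) = (\<Sum>a<k. hdim (X a) Z)" for k
  proof (induction k)
    case 0
    have "f = 0" if f: "f \<in> V 0" for f
    proof
      fix w
      note fm = homs_mhom[OF subsetD[OF subV f]]
      show "f w = 0 w"
      proof (cases "w \<in> car W")
        case True
        have "f w = f (\<Sum>a<m. \<iota> a (\<pi> a w))" using bp_sum[OF bp True] by simp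
        also have "\<dots> = (\<Sum>a<m. f (\<iota> a (\<pi> a w)))"
          by (rule mhom_sum[OF W' fm]) (use mhom_in[OF bp_inj[OF bp]] mhom_in[OF bp_proj[OF bp] True] in auto)
        also have "\<dots> = (\<Sum>a<m. 0)"
          using f mhom_in[OF bp_proj[OF bp] True] unfolding V_def by (intro sum.cong) auto
        finally show ?thesis by simp
      qed (use homs_out[OF subsetD[OF subV f]] in simp)
    qed
    then have "V 0 = {0}" using H.subspace_0[OF sV] by blast
    then show ?case using H.dim_zero_space by simp
  next
    case (Suc k)
    then have k: "k < m" by simp
    let ?\<Phi> = "\<lambda>f. extend0 (X k) (\<lambda>x. f (\<iota> k x))"
    note Xk = bp_right_module[OF bp k]
    have im: "?\<Phi> ` V (Suc k) = homs (X k) Z"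
    proof
      show "?\<Phi> ` V (Suc k) \<subseteq> homs (X k) Z"
        using extend0_homs[OF Xk mhom_comp[OF bp_inj[OF bp k] homs_mhom]] subV by blast
      show "homs (X k) Z \<subseteq> ?\<Phi> ` V (Suc k)"
      proof
        fix g assume g: "g \<in> homs (X k) Z"
        let ?f = "extend0 W (\<lambda>w. g (\<pi> k w))"
        have f: "?f \<in> homs W Z" using extend0_homs[OF W' mhom_comp[OF bp_proj[OF bp k] homs_mhom[OF g]]] .
        have e: "?f (\<iota> a x) = (if a = k then g x else 0)" if "a < m" "x \<in> car (X a)" for a x
          using bp_proj_inj[OF bp that(1) k that(2)] mhom_in[OF bp_inj[OF bp that(1)] that(2)]
            mhom_0[OF Xk homs_mhom[OF g]] by simp
        have "?f \<in> V (Suc k)" unfolding V_def using f e by simp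
        moreover have "g = ?\<Phi> ?f" by (rule homs_eq_extend0[OF g]) (use e[OF k] in simp)
        ultimately show "g \<in> ?\<Phi> ` V (Suc k)" by blast
      qed
    qed
    have ker: "{f \<in> V (Suc k). ?\<Phi> f = 0} = V k"
    proof -
      have "?\<Phi> f = 0 \<longleftrightarrow> (\<forall>x\<in>car (X k). f (\<iota> k x) = 0)" for f :: "'m \<Rightarrow> 'l"
        by (auto simp: extend0_def fun_eq_iff)
      then show ?thesis unfolding V_def using k by (auto simp: Suc_le_eq le_less)
    qed
    show ?case
      using homs_rank_nullity[where \<Phi>="?\<Phi>", OF W Z Z' sV[of "Suc k"] subV extend0_comp_add extend0_comp_scale[OF Z']] Suc
      unfolding im ker hdim_def by simp
  qed
  moreover have "V m = homs W Z" unfolding V_def by auto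
  ultimately show ?thesis unfolding hdim_def by (metis order_refl)
qed

end

section \<open>Projective modules and projective covers\<close>

context fd_algebra
begin

lemma projective_fg: "projective P \<Longrightarrow> fg_module P"
  unfolding projective_def by blast

text \<open>Only the values of \<open>h\<close> need to be hit by \<open>g\<close>: projectivity is applied to the corestriction of \<open>g\<close>
  to its image.\<close>

lemma projective_lift:
  fixes P X Y :: "('k, 'a) umod"
  assumes P: "projective P" and X: "fg_module X" and Y: "right_module Y"
    and g: "mhom X Y g" and h: "mhom P Y h" and im: "\<And>p. p \<in> car P \<Longrightarrow> h p \<in> g ` car X"
  shows "\<exists>l. mhom P X l \<and> (\<forall>p\<in>car P. g (l p) = h p)"
proof -
  note X' = fg_right_module[OF X]
  let ?Z = "submod Y (g ` car X)"
  have sub: "submodule (g ` car X) Y" by (rule submodule_range[OF X' Y g])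
  have gZ: "mhom X ?Z g" by (rule mhom_to_submod[OF g]) blast
  have hZ: "mhom P ?Z h" by (rule mhom_to_submod[OF h im])
  have surj: "g ` car X = car ?Z" by simp
  have "fg_module ?Z" by (rule fg_image[OF X right_module_submod[OF Y sub] gZ surj])
  then show ?thesis using P X gZ hZ surj unfolding projective_def by blast
qed

lemma projective_retract:
  fixes P Q :: "('k, 'a) umod"
  assumes P: "projective P" and Q: "fg_module Q" and i: "mhom Q P i" and p: "mhom P Q p"
    and pi: "\<And>x. x \<in> car Q \<Longrightarrow> p (i x) = x"
  shows "projective Q"
  unfolding projective_def
proof (intro conjI allI impI)
  fix X Y :: "('k, 'a) umod" and g h
  assume a: "fg_module X \<and> fg_module Y \<and> mhom X Y g \<and> g ` car X = car Y \<and> mhom Q Y h"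
  have hp: "mhom P Y (\<lambda>x. h (p x))" using mhom_comp[OF p] a by blast
  have "\<exists>l. mhom P X l \<and> (\<forall>x\<in>car P. g (l x) = h (p x))"
    by (rule projective_lift[OF P _ _ _ hp]) (use a fg_right_module mhom_in[OF hp] in auto)
  then obtain l where l: "mhom P X l" "\<forall>x\<in>car P. g (l x) = h (p x)" by blast
  show "\<exists>l. mhom Q X l \<and> (\<forall>x\<in>car Q. g (l x) = h x)"
    using mhom_comp[OF i l(1)] l(2) mhom_in[OF i] pi by (intro exI[of _ "\<lambda>x. l (i x)"]) simp
qed (fact Q)

lemma projective_summand:
  fixes P :: "('k, 'a) umod"
  assumes P: "projective P" and bp: "biproduct P m X \<iota> \<pi>" and a: "a < m"
  shows "projective (X a)"
  by (rule projective_retract[OF P bp_fg[OF bp projective_fg[OF P] a] bp_inj[OF bp a] bp_proj[OF bp a]])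
    (use bp_proj_inj[OF bp a a] in simp)

lemma projective_coverD:
  assumes "projective_cover P e M"
  shows pc_projective: "projective P" and pc_fg: "fg_module P" and pc_fg_target: "fg_module M"
    and pc_mhom: "mhom P M e" and pc_surj: "e ` car P = car M" and pc_superfluous: "superfluous (mker P e) P"
  using assms projective_fg unfolding projective_cover_def by blast+

lemma superfluousD:
  "superfluous V M \<Longrightarrow> submodule W M \<Longrightarrow> set_sum V W = car M \<Longrightarrow> W = car M"
  unfolding superfluous_def by blast

text \<open>The image of \<open>l\<close> and the superfluous kernel of \<open>e\<close> together fill \<open>P\<close>.\<close>

lemma projective_cover_surj:
  assumes c: "projective_cover P e M" and R: "right_module R" and l: "mhom R P l"
    and s: "\<And>y. y \<in> car M \<Longrightarrow> \<exists>x\<in>car R. e (l x) = y"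
  shows "l ` car R = car P"
proof (rule superfluousD[OF pc_superfluous[OF c]])
  note P = fg_right_module[OF pc_fg[OF c]]
  show "submodule (l ` car R) P" by (rule submodule_range[OF R P l])
  show "set_sum (mker P e) (l ` car R) = car P"
  proof
    show "set_sum (mker P e) (l ` car R) \<subseteq> car P"
      unfolding set_sum_def mker_def using rm_add[OF P] mhom_in[OF l] by auto
    show "car P \<subseteq> set_sum (mker P e) (l ` car R)"
    proof
      fix p assume p: "p \<in> car P"
      obtain x where x: "x \<in> car R" "e (l x) = e p" using s[OF mhom_in[OF pc_mhom[OF c] p]] by blast
      have lx: "l x \<in> car P" using mhom_in[OF l x(1)] .
      have "p - l x \<in> mker P e"
        unfolding mker_def using rm_diff[OF P p lx] mhom_diff[OF P pc_mhom[OF c] p lx] x(2) by simp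
      moreover have "p = (p - l x) + l x" by simp
      ultimately show "p \<in> set_sum (mker P e) (l ` car R)" unfolding set_sum_def using x(1) by blast
    qed
  qed
qed

lemma projective_cover_endo_bij:
  assumes c: "projective_cover P e M" and h: "mhom P P h" and eh: "\<And>x. x \<in> car P \<Longrightarrow> e (h x) = e x"
  shows "bij_betw h (car P) (car P)"
proof (rule endo_bij_if_surj[OF pc_fg[OF c] h])
  show "h ` car P = car P"
  proof (rule projective_cover_surj[OF c fg_right_module[OF pc_fg[OF c]] h])
    fix y assume "y \<in> car M"
    then obtain x where "x \<in> car P" "y = e x" using pc_surj[OF c] by blast
    then show "\<exists>x\<in>car P. e (h x) = y" using eh by blast
  qed
qed

section \<open>Indecomposable modules\<close>

text \<open>The image of \<open>i\<close> and the kernel of \<open>p\<close> are complementary, and the former is nonzero.\<close>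

lemma retract_of_indecomposable:
  assumes U: "right_module U" and C: "right_module C" and ind: "indecomposable U"
    and i: "mhom C U i" and p: "mhom U C p" and pi: "\<And>x. x \<in> car C \<Longrightarrow> p (i x) = x" and nz: "car C \<noteq> {0}"
  shows "bij_betw p (car U) (car C)"
proof -
  have "complementary U (i ` car C) (mker U p)"
    unfolding complementary_def
  proof (intro conjI)
    show sI: "submodule (i ` car C) U" by (rule submodule_range[OF C U i])
    show sK: "submodule (mker U p) U" by (rule submodule_mker[OF U C p])
    show "i ` car C \<inter> mker U p = {0}"
    proof
      show "i ` car C \<inter> mker U p \<subseteq> {0}"
        unfolding mker_def using pi mhom_0[OF C i] by auto
      show "{0} \<subseteq> i ` car C \<inter> mker U p" using sm_zero[OF U sI] sm_zero[OF U sK] by blast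
    qed
    show "set_sum (i ` car C) (mker U p) = car U"
    proof
      show "set_sum (i ` car C) (mker U p) \<subseteq> car U"
        unfolding set_sum_def mker_def using rm_add[OF U] mhom_in[OF i] by auto
      show "car U \<subseteq> set_sum (i ` car C) (mker U p)"
      proof
        fix x assume x: "x \<in> car U"
        have px: "p x \<in> car C" "i (p x) \<in> car U" using mhom_in[OF p x] mhom_in[OF i] by blast+
        have "x - i (p x) \<in> mker U p"
          unfolding mker_def using rm_diff[OF U x px(2)] mhom_diff[OF U p x px(2)] pi[OF px(1)] by simp
        moreover have "x = i (p x) + (x - i (p x))" by simp
        ultimately show "x \<in> set_sum (i ` car C) (mker U p)" unfolding set_sum_def using px(1) by blast
      qed
    qed
  qed
  then have "i ` car C = {0} \<or> mker U p = {0}" using ind unfolding indecomposable_def by blast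
  moreover have "i ` car C \<noteq> {0}"
  proof
    assume a: "i ` car C = {0}"
    have "x = 0" if "x \<in> car C" for x
    proof -
      have "i x = 0" using a that by blast
      then show ?thesis using pi[OF that] mhom_0[OF U p] by simp
    qed
    then show False using nz rm_zero[OF C] by blast
  qed
  ultimately have "mker U p = {0}" by blast
  then have "inj_on p (car U)" by (intro mhom_inj_on[OF U p]) (auto simp: mker_def)
  moreover have "p ` car U = car C"
    using mhom_in[OF p] pi mhom_in[OF i] by (metis image_subsetI image_eqI subsetI subset_antisym)
  ultimately show ?thesis unfolding bij_betw_def by blast
qed

lemma mhom_funpow: "mhom M M h \<Longrightarrow> mhom M M (h ^^ i)"
proof (induction i)
  case 0 then show ?case using mhom_ident by (simp add: id_def)
next
  case (Suc i) then show ?case using mhom_comp[of M M "h ^^ i" M h] by (simp add: comp_def)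
qed

text \<open>Fitting's lemma. If the image of \<open>h ^^ i\<close> has the least possible dimension, then \<open>h ^^ i\<close> is
  bijective on its image; hence its image and its kernel are complementary, and one of them is zero.\<close>

lemma indecomposable_endo:
  assumes M: "fg_module M" and ind: "indecomposable M" and h: "mhom M M h"
  shows "bij_betw h (car M) (car M) \<or> (\<exists>N. \<forall>x\<in>car M. (h ^^ N) x = 0)"
proof -
  note M' = fg_right_module[OF M]
  let ?d = "\<lambda>i. vector_space.dim (smul M) ((h ^^ i) ` car M)"
  note hi = mhom_funpow[OF h]
  obtain i where i: "\<And>j. ?d i \<le> ?d j" using ex_has_least_nat[of "\<lambda>_. True" 0 ?d] by blast
  define g where "g = h ^^ i"
  define V where "V = g ` car M"
  have g: "mhom M M g" unfolding g_def by (rule hi)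
  have V: "submodule V M" unfolding V_def by (rule submodule_range[OF M' M' g])
  have gV: "g ` V = V"
  proof (rule submodule_dim_eq[OF M])
    show "submodule (g ` V) M" by (rule submodule_image[OF M' M' g V])
    show "g ` V \<subseteq> V" unfolding V_def using mhom_in[OF g] by blast
    have "g ` V = (h ^^ (i + i)) ` car M" unfolding V_def g_def by (simp add: funpow_add image_comp)
    then show "vector_space.dim (smul M) V \<le> vector_space.dim (smul M) (g ` V)" using i unfolding V_def g_def by simp
  qed (fact V)
  have injV: "x = 0" if "x \<in> V" "g x = 0" for x
  proof -
    have gm: "mhom (submod M V) (submod M V) g"
      by (rule mhom_to_submod[OF mhom_from_submod[OF g submodule_subset[OF V]]]) (use gV in auto)
    have "\<forall>x\<in>car (submod M V). g x = 0 \<longrightarrow> x = 0"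
      unfolding endo_inj_iff_surj[OF fg_submod[OF M V] gm] using gV by simp
    then show ?thesis using that by simp
  qed
  have K: "submodule (mker M g) M" by (rule submodule_mker[OF M' M' g])
  have "complementary M V (mker M g)"
    unfolding complementary_def
  proof (intro conjI)
    show "V \<inter> mker M g = {0}"
      using injV sm_zero[OF M' V] sm_zero[OF M' K] unfolding mker_def by blast
    show "set_sum V (mker M g) = car M"
    proof
      show "set_sum V (mker M g) \<subseteq> car M" by (rule submodule_subset[OF submodule_set_sum[OF M' V K]])
      show "car M \<subseteq> set_sum V (mker M g)"
      proof
        fix x assume x: "x \<in> car M"
        then have "g x \<in> g ` V" unfolding gV by (simp add: V_def)
        then obtain v where v: "v \<in> V" "g x = g v" by blast
        have vM: "v \<in> car M" using v(1) submodule_subset[OF V] by blast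
        have "x - v \<in> mker M g"
          unfolding mker_def using rm_diff[OF M' x vM] mhom_diff[OF M' g x vM] v(2) by simp
        moreover have "x = v + (x - v)" by simp
        ultimately show "x \<in> set_sum V (mker M g)" unfolding set_sum_def using v(1) by blast
      qed
    qed
  qed (fact V, fact K)
  then consider "V = {0}" | "mker M g = {0}" using ind unfolding indecomposable_def by blast
  then show ?thesis
  proof cases
    case 1
    then have "\<forall>x\<in>car M. (h ^^ i) x = 0" unfolding V_def g_def by blast
    then show ?thesis by blast
  next
    case 2
    then have "\<forall>x\<in>car M. g x = 0 \<longrightarrow> x = 0" unfolding mker_def by blast
    then have "V = car M" unfolding V_def using endo_inj_iff_surj[OF M g] by blast
    then have "vector_space.dim (smul M) (car M) \<le> vector_space.dim (smul M) (h ` car M)"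
      using i[of 1] unfolding V_def g_def by simp
    then have "h ` car M = car M"
      using submodule_dim_eq[OF M submodule_range[OF M' M' h] submodule_car[OF M']] mhom_in[OF h] by blast
    then show ?thesis using endo_bij_if_surj[OF M h] by blast
  qed
qed

text \<open>The endomorphism ring is local. If the summand \<open>h a\<close> is not bijective, then \<open>k = u\<^sup>-\<^sup>1 \<circ> h a\<close> is
  nilpotent by Fitting's lemma, so \<open>1 - k\<close> is bijective, and it is the sum of the remaining
  \<open>u\<^sup>-\<^sup>1 \<circ> h b\<close>.\<close>

lemma indecomposable_sum_bij:
  assumes M: "fg_module M" and ind: "indecomposable M" and A: "finite A"
    and h: "\<And>a. a \<in> A \<Longrightarrow> mhom M M (h a)" and u: "mhom M M u" "bij_betw u (car M) (car M)"
    and sum: "\<And>x. x \<in> car M \<Longrightarrow> u x = (\<Sum>a\<in>A. h a x)"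
  shows "\<exists>a\<in>A. bij_betw (h a) (car M) (car M)"
  using A h u sum
proof (induction A arbitrary: h u rule: finite_induct)
  case empty
  note M' = fg_right_module[OF M]
  have "car M = u ` car M" using empty(3) unfolding bij_betw_def by blast
  then have "car M = {0}" using empty(4) rm_zero[OF M'] by auto
  then show ?case using ind unfolding indecomposable_def by blast
next
  case (insert a A)
  note M' = fg_right_module[OF M]
  note u = insert.prems(2,3)
  have h: "mhom M M (h b)" if "b \<in> insert a A" for b using insert.prems(1) that by blast
  obtain v where v: "mhom M M v" "\<forall>x\<in>car M. v (u x) = x" "\<forall>x\<in>car M. u (v x) = x"
    using mhom_inverse[OF M' u] by blast
  have bij_h: "bij_betw (h b) (car M) (car M)"
    if b: "b \<in> insert a A" and bij: "bij_betw (\<lambda>x. v (h b x)) (car M) (car M)" for b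
  proof -
    have "bij_betw (u \<circ> (\<lambda>x. v (h b x))) (car M) (car M)" by (rule bij_betw_trans[OF bij u(2)])
    moreover have "(u \<circ> (\<lambda>x. v (h b x))) x = h b x" if "x \<in> car M" for x
      using v(3) mhom_in[OF h[OF b] that] by simp
    ultimately show ?thesis using bij_betw_cong[of "car M" "u \<circ> (\<lambda>x. v (h b x))" "h b"] by blast
  qed
  let ?k = "\<lambda>x. v (h a x)"
  have k: "mhom M M ?k" using mhom_comp[OF h v(1)] by blast
  show ?case
  proof (cases "bij_betw ?k (car M) (car M)")
    case True
    then show ?thesis using bij_h by blast
  next
    case False
    then obtain N where N: "\<forall>x\<in>car M. (?k ^^ N) x = 0" using indecomposable_endo[OF M ind k] by blast
    let ?w = "\<lambda>x. x - ?k x"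
    have w: "mhom M M ?w" by (rule mhom_fun_diff[OF M' mhom_ident k])
    have wbij: "bij_betw ?w (car M) (car M)"
    proof (rule endo_bij_if_inj[OF M w])
      fix x assume x: "x \<in> car M" "x - ?k x = 0"
      have "(?k ^^ i) x = x" for i
      proof (induction i)
        case (Suc i) then show ?case using x(2) by simp
      qed simp
      then show "x = 0" using N x(1) by metis
    qed
    have ws: "?w x = (\<Sum>b\<in>A. v (h b x))" if x: "x \<in> car M" for x
    proof -
      have "x = v (u x)" using v(2) x by simp
      also have "\<dots> = v (\<Sum>b\<in>insert a A. h b x)" using insert.prems(4)[OF x] by simp
      also have "\<dots> = (\<Sum>b\<in>insert a A. v (h b x))"
        by (rule mhom_sum[OF M' v(1)]) (use mhom_in[OF h x] in blast)
      also have "\<dots> = ?k x + (\<Sum>b\<in>A. v (h b x))" using insert.hyps by simp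
      finally have "x = ?k x + (\<Sum>b\<in>A. v (h b x))" .
      then show ?thesis by (metis add_diff_cancel_left')
    qed
    have vh: "mhom M M (\<lambda>x. v (h b x))" if "b \<in> A" for b
      using mhom_comp[OF h v(1)] that by blast
    have "\<exists>b\<in>A. bij_betw (\<lambda>x. v (h b x)) (car M) (car M)"
      by (rule insert.IH[OF vh w wbij ws])
    then show ?thesis using bij_h by blast
  qed
qed

text \<open>The part of the Krull-Schmidt theorem needed below: a direct summand \<open>C\<close> of a sum of modules \<open>U l\<close>
  is isomorphic to a sum of modules \<open>U l\<close>. Being a summand is expressed by the maps \<open>i a\<close> and \<open>p a\<close>, a
  form which passes to direct summands of \<open>C\<close> and permits an induction on the dimension. If \<open>C\<close> is
  indecomposable, one of the maps \<open>p a \<circ> i a\<close> is bijective, and \<open>C\<close> is isomorphic to \<open>U (ix a)\<close>.\<close>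

theorem hdim_of_summand:
  fixes C :: "('k, 'a) umod" and U :: "'i \<Rightarrow> ('k, 'a) umod" and m :: nat
  assumes L: "finite L" and U: "\<And>l. l \<in> L \<Longrightarrow> fg_module (U l) \<and> indecomposable (U l)"
    and C: "fg_module C"
    and ix: "\<And>a. a < m \<Longrightarrow> ix a \<in> L \<and> mhom C (U (ix a)) (i a) \<and> mhom (U (ix a)) C (p a)"
    and sum: "\<And>x. x \<in> car C \<Longrightarrow> x = (\<Sum>a<m. p a (i a x))"
  shows "\<exists>\<mu> :: 'i \<Rightarrow> nat. \<forall>X :: ('k, 'a) umod. fg_module X \<longrightarrow> hdim C X = (\<Sum>l\<in>L. \<mu> l * hdim (U l) X)"
  using C ix sum
proof (induction "mdim C" arbitrary: C i p rule: less_induct)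
  case less
  note C = less.prems(1) and ix = less.prems(2) and sum = less.prems(3)
  note C' = fg_right_module[OF C]
  show ?case
  proof (cases "car C = {0}")
    case True
    have "hdim C X = 0" if "fg_module X" for X :: "('k, 'a) umod"
      by (rule hdim_eq_0[OF fg_right_module[OF that]]) (use True mhom_0[OF C'] in \<open>auto simp: hom_zero_def\<close>)
    then show ?thesis by (intro exI[of _ "\<lambda>_. 0"]) simp
  next
    case nz: False
    show ?thesis
    proof (cases "indecomposable C")
      case True
      have hm: "mhom C C (\<lambda>x. p a (i a x))" if "a \<in> {..<m}" for a
        using mhom_comp ix that by blast
      have "\<exists>a\<in>{..<m}. bij_betw (\<lambda>x. p a (i a x)) (car C) (car C)"
      proof (rule indecomposable_sum_bij[OF C True, where u = "\<lambda>x. x"])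
        show "mhom C C (\<lambda>x. x)" by (rule mhom_ident)
        show "x = (\<Sum>a<m. p a (i a x))" if "x \<in> car C" for x by (rule sum[OF that])
      qed (auto simp: bij_betw_def intro!: hm)
      then obtain a where a: "a < m" "bij_betw (\<lambda>x. p a (i a x)) (car C) (car C)" by blast
      have am: "a \<in> {..<m}" using a(1) by simp
      let ?l = "ix a"
      have l: "?l \<in> L" "mhom C (U ?l) (i a)" "mhom (U ?l) C (p a)" using ix[OF a(1)] by blast+
      obtain g where g: "mhom C C g" "\<forall>x\<in>car C. g (p a (i a x)) = x"
        using mhom_inverse[OF C' hm[OF am] a(2)] by blast
      have "bij_betw (\<lambda>x. g (p a x)) (car (U ?l)) (car C)"
        by (rule retract_of_indecomposable[OF _ C' _ l(2) mhom_comp[OF l(3) g(1)] _ nz])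
          (use g(2) U[OF l(1)] fg_right_module in auto)
      then have "mod_iso (U ?l) C" unfolding mod_iso_def using mhom_comp[OF l(3) g(1)] by blast
      then have e: "hdim C X = hdim (U ?l) X" if "fg_module X" for X :: "('k, 'a) umod"
        using hdim_iso[OF conjunct1[OF U[OF l(1)]] C that] by simp
      have "(\<Sum>l\<in>L. (if l = ?l then 1 else 0) * hdim (U l) X) = hdim (U ?l) X" for X :: "('k, 'a) umod"
      proof -
        have "(\<Sum>l\<in>L. (if l = ?l then 1 else 0) * hdim (U l) X) = (\<Sum>l\<in>L. if l = ?l then hdim (U l) X else 0)"
          by (intro sum.cong) auto
        then show ?thesis using L l(1) by simp
      qed
      then show ?thesis using e by (intro exI[of _ "\<lambda>l. if l = ?l then 1 else 0"]) simp
    next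
      case False
      then obtain V W where VW: "complementary C V W" "V \<noteq> {0}" "W \<noteq> {0}"
        using nz unfolding indecomposable_def by blast
      let ?N = "\<lambda>i::nat. if i = 0 then V else W"
      obtain \<pi> where bp: "biproduct C 2 (\<lambda>i. submod C (?N i)) (\<lambda>i x. x) \<pi>"
        using complementary_biproduct[OF C' VW(1)] by blast
      have sub: "submodule (?N k) C" for k using VW(1) unfolding complementary_def by simp
      have int: "V \<inter> W = {0}" using VW(1) unfolding complementary_def by blast
      have proper: "?N k \<noteq> car C" for k
        using int VW(2,3) submodule_subset[OF sub[of 0]] submodule_subset[OF sub[of 1]] by auto
      have ex: "\<exists>\<mu> :: 'i \<Rightarrow> nat. \<forall>X :: ('k, 'a) umod. fg_module X \<longrightarrow>
        hdim (submod C (?N k)) X = (\<Sum>l\<in>L. \<mu> l * hdim (U l) X)" if k: "k < 2" for k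
      proof -
        let ?V = "submod C (?N k)"
        note VC = submodule_subset[OF sub[of k]]
        have lt: "mdim ?V < mdim C"
          using submodule_dim_eq[OF C sub[of k] submodule_car[OF C'] VC] proper[of k]
          by (metis not_le submod_simps(1) submod_simps(2))
        have fg: "fg_module ?V" by (rule fg_submod[OF C sub])
        have hom: "ix a \<in> L \<and> mhom ?V (U (ix a)) (i a) \<and> mhom (U (ix a)) ?V (\<lambda>x. \<pi> k (p a x))"
          if a: "a < m" for a
        proof (intro conjI)
          show "ix a \<in> L" using ix[OF a] by blast
          have "mhom C (U (ix a)) (i a)" using ix[OF a] by blast
          then show "mhom ?V (U (ix a)) (i a)" by (rule mhom_from_submod[OF _ VC])
          have "mhom (U (ix a)) C (p a)" using ix[OF a] by blast
          then show "mhom (U (ix a)) ?V (\<lambda>x. \<pi> k (p a x))" by (rule mhom_comp[OF _ bp_proj[OF bp k]])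
        qed
        have id: "x = (\<Sum>a<m. \<pi> k (p a (i a x)))" if x: "x \<in> car ?V" for x
        proof -
          have xC: "x \<in> car C" using x VC by auto
          have pi: "p a (i a x) \<in> car C" if a: "a \<in> {..<m}" for a
          proof -
            have "mhom C (U (ix a)) (i a)" "mhom (U (ix a)) C (p a)" using ix a by blast+
            then show ?thesis using mhom_in xC by blast
          qed
          have "x = \<pi> k x" using bp_proj_inj[OF bp k k x] by simp
          also have "\<dots> = \<pi> k (\<Sum>a<m. p a (i a x))" using sum[OF xC] by simp
          also have "\<dots> = (\<Sum>a<m. \<pi> k (p a (i a x)))" by (rule mhom_sum[OF C' bp_proj[OF bp k] pi])
          finally show ?thesis .
        qed
        show ?thesis by (rule less.hyps[of ?V i "\<lambda>a x. \<pi> k (p a x)", OF lt fg hom id])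
      qed
      obtain \<mu>0 \<mu>1 :: "'i \<Rightarrow> nat" where mu:
        "\<forall>X :: ('k, 'a) umod. fg_module X \<longrightarrow> hdim (submod C (?N 0)) X = (\<Sum>l\<in>L. \<mu>0 l * hdim (U l) X)"
        "\<forall>X :: ('k, 'a) umod. fg_module X \<longrightarrow> hdim (submod C (?N 1)) X = (\<Sum>l\<in>L. \<mu>1 l * hdim (U l) X)"
        using ex[of 0] ex[of 1] by force
      have "hdim C X = (\<Sum>l\<in>L. (\<mu>0 l + \<mu>1 l) * hdim (U l) X)" if X: "fg_module X" for X :: "('k, 'a) umod"
      proof -
        have "hdim C X = (\<Sum>k<2. hdim (submod C (?N k)) X)" by (rule hdim_biproduct[OF bp C X])
        also have "\<dots> = hdim (submod C (?N 0)) X + hdim (submod C (?N 1)) X" by (simp add: numeral_2_eq_2)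
        also have "\<dots> = (\<Sum>l\<in>L. (\<mu>0 l + \<mu>1 l) * hdim (U l) X)"
          using mu X by (simp only: sum.distrib[symmetric] distrib_right)
        finally show ?thesis .
      qed
      then show ?thesis by (intro exI[of _ "\<lambda>l. \<mu>0 l + \<mu>1 l"]) blast
    qed
  qed
qed

section \<open>Simple modules\<close>

lemma simple_moduleD:
  assumes "simple_module S"
  shows simple_fg: "fg_module S" and simple_nonzero: "car S \<noteq> {0}"
    and simple_submodule: "submodule V S \<Longrightarrow> V = {0} \<or> V = car S"
  using assms unfolding simple_module_def by blast+

lemma hom_to_simple_surj:
  assumes S: "simple_module S" and M: "right_module M" and h: "mhom M S h" and x: "x \<in> car M" "h x \<noteq> 0"
  shows "h ` car M = car S"
  using simple_submodule[OF S submodule_range[OF M fg_right_module[OF simple_fg[OF S]] h]] x by blast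

lemma hom_from_simple_inj:
  assumes S: "simple_module S" and N: "right_module N" and h: "mhom S N h" and x: "x \<in> car S" "h x \<noteq> 0"
  shows "inj_on h (car S)"
proof -
  note S' = fg_right_module[OF simple_fg[OF S]]
  have "mker S h = {0}"
    using simple_submodule[OF S submodule_mker[OF S' N h]] x unfolding mker_def by blast
  then show ?thesis by (intro mhom_inj_on[OF S' h]) (auto simp: mker_def)
qed

text \<open>A nonzero submodule of least dimension is simple.\<close>

lemma exists_simple_submodule:
  fixes X :: "('k, 'a) umod"
  assumes X: "fg_module X" and nz: "car X \<noteq> {0}"
  shows "\<exists>V. submodule V X \<and> simple_module (submod X V)"
proof -
  note X' = fg_right_module[OF X]
  obtain V where V: "submodule V X \<and> V \<noteq> {0}"
    "\<forall>W. submodule W X \<and> W \<noteq> {0} \<longrightarrow> vector_space.dim (smul X) V \<le> vector_space.dim (smul X) W"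
    using ex_has_least_nat[of "\<lambda>V. submodule V X \<and> V \<noteq> {0}" "car X" "vector_space.dim (smul X)"]
      submodule_car[OF X'] nz by blast
  have VX: "submodule V X" using V by blast
  have "simple_module (submod X V)"
    unfolding simple_module_def
  proof (intro conjI allI impI)
    show "fg_module (submod X V)" by (rule fg_submod[OF X VX])
    show "car (submod X V) \<noteq> {0}" using V by simp
    fix W assume "submodule W (submod X V)"
    then have W: "W \<subseteq> V" "submodule W X" using submodule_submod_iff[OF VX] by blast+
    show "W = {0} \<or> W = car (submod X V)"
      using submodule_dim_eq[OF X W(2) VX W(1)] V(2) W(2) by auto
  qed
  then show ?thesis using VX by blast
qed

text \<open>The quotient by a proper submodule of largest dimension is simple.\<close>

lemma exists_simple_quotient:
  fixes X :: "('k, 'a) umod"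
  assumes X: "fg_module X" and nz: "car X \<noteq> {0}"
  shows "\<exists>S q. simple_module (S :: ('k, 'a) umod) \<and> mhom X S q \<and> q ` car X = car S"
proof -
  note X' = fg_right_module[OF X]
  let ?P = "\<lambda>V. submodule V X \<and> V \<noteq> car X"
  obtain V where V: "?P V" "\<forall>W. ?P W \<longrightarrow> vector_space.dim (smul X) W \<le> vector_space.dim (smul X) V"
  proof -
    have b: "vector_space.dim (smul X) W \<le> mdim X" if "?P W" for W
      using submodule_dim_mono[OF X _ submodule_car[OF X'], of W] submodule_subset[of W X] that by blast
    have "?P {0}" using submodule_0[OF X'] nz by blast
    then obtain V where V: "?P V"
      "\<forall>W. ?P W \<longrightarrow> mdim X - vector_space.dim (smul X) V \<le> mdim X - vector_space.dim (smul X) W"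
      using ex_has_least_nat[of ?P "{0}" "\<lambda>V. mdim X - vector_space.dim (smul X) V"] by blast
    have le: "vector_space.dim (smul X) W \<le> vector_space.dim (smul X) V" if "?P W" for W
      using V(2)[rule_format, OF that] b[OF that] b[OF V(1)] by linarith
    show ?thesis using that[OF V(1)] le by blast
  qed
  have VX: "submodule V X" using V by blast
  obtain S :: "('k, 'a) umod" and q where S: "fg_module S" "mhom X S q" "q ` car X = car S"
    "\<forall>x\<in>car X. q x = 0 \<longleftrightarrow> x \<in> V"
    using exists_quotient[OF X VX] by blast
  note S' = fg_right_module[OF S(1)]
  have "simple_module S"
    unfolding simple_module_def
  proof (intro conjI allI impI)
    show "fg_module S" by (fact S(1))
    show "car S \<noteq> {0}"
    proof
      assume "car S = {0}"
      then have "car X \<subseteq> V" using S(3,4) by blast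
      then show False using V(1) submodule_subset[OF VX] by blast
    qed
    fix W assume W: "submodule W S"
    let ?W = "{x \<in> car X. q x \<in> W}"
    have sW: "submodule ?W X" by (rule submodule_preimage[OF X' S' S(2) W])
    have VW: "V \<subseteq> ?W"
    proof
      fix x assume "x \<in> V"
      then have "x \<in> car X" "q x = 0" using S(4) submodule_subset[OF VX] by blast+
      then show "x \<in> ?W" using sm_zero[OF S' W] by simp
    qed
    show "W = {0} \<or> W = car S"
    proof (cases "?W = car X")
      case True
      then have "q ` car X \<subseteq> W" by blast
      then have "car S \<subseteq> W" using S(3) by simp
      then show ?thesis using submodule_subset[OF W] by blast
    next
      case False
      then have "V = ?W" using submodule_dim_eq[OF X VX sW VW] V(2) sW by blast
      have "w = 0" if w: "w \<in> W" for w
      proof -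
        have "w \<in> q ` car X" using w submodule_subset[OF W] S(3) by auto
        then obtain x where x: "x \<in> car X" "w = q x" by blast
        then have "x \<in> V" using w \<open>V = ?W\<close> by blast
        then show ?thesis using x S(4) by blast
      qed
      then show ?thesis using sm_zero[OF S' W] by blast
    qed
  qed
  then show ?thesis using S by blast
qed

end

section \<open>Simple modules and their projective covers\<close>

locale indecomposable_projectives = fd_algebra scale
  for scale :: "'k::field \<Rightarrow> 'a::{ring,monoid_mult} \<Rightarrow> 'a" +
  fixes n :: nat and S PP :: "nat \<Rightarrow> ('k, 'a) umod" and top
  assumes reps: "simple_representatives n S"
    and cover: "i < n \<Longrightarrow> projective_cover (PP i) (top i) (S i)"
begin

lemma S_simple: "i < n \<Longrightarrow> simple_module (S i)"
  using reps unfolding simple_representatives_def by blast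

lemma simple_iso_S: "simple_module X \<Longrightarrow> \<exists>i<n. mod_iso X (S i)"
  using reps unfolding simple_representatives_def by blast

lemma S_iso_eq: "i < n \<Longrightarrow> j < n \<Longrightarrow> mod_iso (S i) (S j) \<Longrightarrow> i = j"
  using reps unfolding simple_representatives_def by blast

lemma S_right_module: "i < n \<Longrightarrow> right_module (S i)"
  using fg_right_module[OF simple_fg[OF S_simple]] by blast

lemma PP_fg: "i < n \<Longrightarrow> fg_module (PP i)"
  using pc_fg[OF cover] .

lemma PP_right_module: "i < n \<Longrightarrow> right_module (PP i)"
  using fg_right_module[OF PP_fg] .

text \<open>A submodule not contained in the kernel maps onto the simple module \<open>S i\<close>, and is then everything by
  superfluousness. So \<open>PP i\<close> has the kernel of \<open>top i\<close> as its only maximal submodule.\<close>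

lemma proper_submodule_le_mker_top:
  assumes i: "i < n" and V: "submodule V (PP i)" "V \<noteq> car (PP i)"
  shows "V \<subseteq> mker (PP i) (top i)"
proof -
  note c = cover[OF i] and P = PP_right_module[OF i] and Si = S_right_module[OF i]
  have "submodule (top i ` V) (S i)" by (rule submodule_image[OF P Si pc_mhom[OF c] V(1)])
  then consider "top i ` V = {0}" | "top i ` V = car (S i)" using simple_submodule[OF S_simple[OF i]] by blast
  then show ?thesis
  proof cases
    case 1
    then show ?thesis unfolding mker_def using submodule_subset[OF V(1)] by blast
  next
    case 2
    have "(\<lambda>x. x) ` car (submod (PP i) V) = car (PP i)"
    proof (rule projective_cover_surj[OF c right_module_submod[OF P V(1)] mhom_incl[OF submodule_subset[OF V(1)]]])
      fix y assume "y \<in> car (S i)"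
      then show "\<exists>x\<in>car (submod (PP i) V). top i x = y" using 2 by (metis imageE submod_simps(1))
    qed
    then show ?thesis using V(2) by simp
  qed
qed

lemma exists_hom_from_PP:
  fixes X :: "('k, 'a) umod"
  assumes X: "fg_module X" and nz: "car X \<noteq> {0}"
  shows "\<exists>i<n. \<exists>h. mhom (PP i) X h \<and> (\<exists>p\<in>car (PP i). h p \<noteq> 0)"
proof -
  obtain V where V: "submodule V X" "simple_module (submod X V)" using exists_simple_submodule[OF X nz] by blast
  obtain i where i: "i < n" "mod_iso (submod X V) (S i)" using simple_iso_S[OF V(2)] by blast
  note V' = fg_right_module[OF simple_fg[OF V(2)]]
  obtain f where f: "mhom (S i) (submod X V) f" "bij_betw f (car (S i)) V"
    using mod_iso_sym[OF V' i(2)] unfolding mod_iso_def by auto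
  have h: "mhom (PP i) X (\<lambda>x. f (top i x))"
    using mhom_comp[OF mhom_comp[OF pc_mhom[OF cover[OF i(1)]] f(1)] mhom_incl[OF submodule_subset[OF V(1)]]] .
  obtain v where v: "v \<in> V" "v \<noteq> 0" using simple_nonzero[OF V(2)] sm_zero[OF fg_right_module[OF X] V(1)] by auto
  then have "v \<in> f ` top i ` car (PP i)"
    using f(2) pc_surj[OF cover[OF i(1)]] unfolding bij_betw_def by simp
  then show ?thesis using i(1) h v(2) by blast
qed

text \<open>The map to \<open>S k\<close> lifts to \<open>PP k\<close>; the lift is onto because \<open>PP k\<close> is a cover, splits because \<open>PP k\<close>
  is projective, and is bijective because \<open>N\<close> is indecomposable.\<close>

lemma indecomposable_projective_iso_PP:
  fixes N :: "('k, 'a) umod"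
  assumes N: "projective N" "indecomposable N" and k: "k < n"
    and h: "mhom N (S k) h" "x \<in> car N" "h x \<noteq> 0"
  shows "mod_iso N (PP k)"
proof -
  note N' = fg_right_module[OF projective_fg[OF N(1)]] and c = cover[OF k] and P' = PP_right_module[OF k]
  have hs: "h ` car N = car (S k)" by (rule hom_to_simple_surj[where h = h and x = x, OF S_simple[OF k] N' h])
  obtain l where l: "mhom N (PP k) l" "\<forall>p\<in>car N. top k (l p) = h p"
    using projective_lift[OF N(1) pc_fg[OF c] S_right_module[OF k] pc_mhom[OF c] h(1)]
      mhom_in[OF h(1)] pc_surj[OF c] by auto
  have ls: "l ` car N = car (PP k)"
  proof (rule projective_cover_surj[OF c N' l(1)])
    fix y assume "y \<in> car (S k)"
    then have "y \<in> h ` car N" using hs by simp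
    then obtain p where "p \<in> car N" "h p = y" by blast
    then show "\<exists>p\<in>car N. top k (l p) = y" using l(2) by blast
  qed
  obtain s where s: "mhom (PP k) N s" "\<forall>p\<in>car (PP k). l (s p) = p"
    using projective_lift[OF pc_projective[OF c] projective_fg[OF N(1)] P' l(1) mhom_ident] ls by auto
  have "car (PP k) \<noteq> {0}"
    using mhom_0[OF P' pc_mhom[OF c]] pc_surj[OF c] simple_nonzero[OF S_simple[OF k]] by auto
  then have "bij_betw l (car N) (car (PP k))"
    using retract_of_indecomposable[OF N' P' N(2) s(1) l(1)] s(2) by blast
  then show ?thesis unfolding mod_iso_def using l(1) by blast
qed

lemma indecomposable_projective_iso_some_PP:
  fixes N :: "('k, 'a) umod"
  assumes N: "projective N" "indecomposable N"
  shows "\<exists>k<n. mod_iso N (PP k)"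
proof -
  have nz: "car N \<noteq> {0}" using N(2) unfolding indecomposable_def by blast
  obtain X q where X: "simple_module (X :: ('k, 'a) umod)" "mhom N X q" "q ` car N = car X"
    using exists_simple_quotient[OF projective_fg[OF N(1)] nz] by blast
  note X' = fg_right_module[OF simple_fg[OF X(1)]]
  obtain k where k: "k < n" "mod_iso X (S k)" using simple_iso_S[OF X(1)] by blast
  obtain f where f: "mhom X (S k) f" "bij_betw f (car X) (car (S k))" using k(2) unfolding mod_iso_def by blast
  obtain y where y: "y \<in> car (S k)" "y \<noteq> 0"
    using simple_nonzero[OF S_simple[OF k(1)]] rm_zero[OF S_right_module[OF k(1)]] by blast
  have "y \<in> f ` q ` car N" using f(2) X(3) y(1) unfolding bij_betw_def by simp
  then obtain x where "x \<in> car N" "f (q x) \<noteq> 0" using y(2) by blast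
  then show ?thesis using indecomposable_projective_iso_PP[OF N k(1) mhom_comp[OF X(2) f(1)]] k(1) by blast
qed

text \<open>A nonzero map \<open>PP i \<rightarrow> S k\<close> is onto and its kernel lies in the kernel of \<open>top i\<close>, so it induces a nonzero
  map between the simple modules \<open>S k\<close> and \<open>S i\<close>.\<close>

lemma hom_PP_S_zero:
  assumes i: "i < n" and k: "k < n" and ne: "i \<noteq> k"
  shows "hom_zero (PP i) (S k)"
proof (rule ccontr)
  assume "\<not> hom_zero (PP i) (S k)"
  then obtain h x where h: "mhom (PP i) (S k) h" "x \<in> car (PP i)" "h x \<noteq> 0" unfolding hom_zero_def by blast
  note P' = PP_right_module[OF i] and c = cover[OF i]
  have hs: "h ` car (PP i) = car (S k)" by (rule hom_to_simple_surj[where h = h and x = x, OF S_simple[OF k] P' h])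
  have "mker (PP i) h \<noteq> car (PP i)" using h(2,3) unfolding mker_def by blast
  then have "mker (PP i) h \<subseteq> mker (PP i) (top i)"
    using proper_submodule_le_mker_top[OF i submodule_mker[OF P' S_right_module[OF k] h(1)]] by blast
  then have "\<exists>r. mhom (S k) (S i) r \<and> (\<forall>x\<in>car (PP i). r (h x) = top i x)"
    by (intro mhom_factor_surj[OF P' h(1) hs pc_mhom[OF c]]) (auto simp: mker_def)
  then obtain r where r: "mhom (S k) (S i) r" "\<forall>x\<in>car (PP i). r (h x) = top i x" by blast
  have rs: "car (S i) = r ` car (S k)" using r(2) hs pc_surj[OF c] by (metis image_cong image_image)
  obtain y where y: "y \<in> car (S i)" "y \<noteq> 0"
    using simple_nonzero[OF S_simple[OF i]] rm_zero[OF S_right_module[OF i]] by blast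
  then have "y \<in> r ` car (S k)" using rs by simp
  then obtain z where z: "z \<in> car (S k)" "r z \<noteq> 0" using y(2) by blast
  have "inj_on r (car (S k))" by (rule hom_from_simple_inj[where h = r and x = z, OF S_simple[OF k] S_right_module[OF i] r(1) z])
  then have "mod_iso (S k) (S i)" unfolding mod_iso_def bij_betw_def using r(1) rs by blast
  then show False using S_iso_eq[OF k i] ne by blast
qed

lemma hdim_PP_S_zero: "i < n \<Longrightarrow> k < n \<Longrightarrow> i \<noteq> k \<Longrightarrow> hdim (PP i) (S k) = 0"
  using hdim_eq_0[OF S_right_module hom_PP_S_zero] by blast

lemma hdim_PP_S_pos:
  assumes k: "k < n" shows "0 < hdim (PP k) (S k)"
proof -
  obtain y where y: "y \<in> car (S k)" "y \<noteq> 0"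
    using simple_nonzero[OF S_simple[OF k]] rm_zero[OF S_right_module[OF k]] by blast
  then have "y \<in> top k ` car (PP k)" using pc_surj[OF cover[OF k]] by simp
  then obtain x where x: "x \<in> car (PP k)" "top k x \<noteq> 0" using y(2) by blast
  show ?thesis
    by (rule hdim_pos[where f = "top k" and x = x, OF PP_fg[OF k] simple_fg[OF S_simple[OF k]]
      pc_mhom[OF cover[OF k]] x])
qed

lemma PP_iso_eq:
  assumes "i < n" "k < n" "mod_iso (PP i) (PP k)" shows "i = k"
  using hdim_iso[OF PP_fg[OF assms(1)] PP_fg[OF assms(2)] simple_fg[OF S_simple[OF assms(2)]] assms(3)]
    hdim_PP_S_zero[OF assms(1,2)] hdim_PP_S_pos[OF assms(2)] by fastforce

text \<open>Each indecomposable summand of \<open>P\<close> is isomorphic to exactly one \<open>PP i\<close>.\<close>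

theorem hdim_projective:
  fixes P X :: "('k, 'a) umod"
  assumes P: "projective P" and N: "indec_decomp P t N" and X: "fg_module X"
  shows "hdim P X = (\<Sum>i<n. multiplicity_in (PP i) P t N * hdim (PP i) X)"
proof -
  note P' = fg_right_module[OF projective_fg[OF P]]
  obtain \<pi> where bp: "biproduct P t (\<lambda>i. submod P (N i)) (\<lambda>i x. x) \<pi>"
    using indec_decomp_biproduct[OF P' N] by blast
  have pr: "projective (submod P (N j))" if "j < t" for j using projective_summand[OF P bp that] .
  have ind: "indecomposable (submod P (N j))" if "j < t" for j using N that unfolding indec_decomp_def by blast
  have "\<forall>j\<in>{..<t}. \<exists>k. k < n \<and> mod_iso (submod P (N j)) (PP k)"
    using indecomposable_projective_iso_some_PP[OF pr ind] by blast
  from bchoice[OF this] obtain \<kappa> where \<kappa>: "\<forall>j\<in>{..<t}. \<kappa> j < n \<and> mod_iso (submod P (N j)) (PP (\<kappa> j))" by blast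
  have iso_iff: "mod_iso (submod P (N j)) (PP i) \<longleftrightarrow> \<kappa> j = i" if j: "j < t" and i: "i < n" for i j
  proof
    assume "mod_iso (submod P (N j)) (PP i)"
    moreover have "mod_iso (PP (\<kappa> j)) (submod P (N j))"
      using mod_iso_sym[OF bp_right_module[OF bp j]] \<kappa> j by blast
    ultimately have "mod_iso (PP (\<kappa> j)) (PP i)" using mod_iso_trans by blast
    then show "\<kappa> j = i" using PP_iso_eq \<kappa> i j by blast
  qed (use \<kappa> j in blast)
  have "hdim P X = (\<Sum>j<t. hdim (submod P (N j)) X)" by (rule hdim_biproduct[OF bp projective_fg[OF P] X])
  also have "\<dots> = (\<Sum>j<t. hdim (PP (\<kappa> j)) X)"
    using hdim_iso[OF projective_fg[OF pr] PP_fg X] \<kappa> by (intro sum.cong) auto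
  also have "\<dots> = (\<Sum>i<n. \<Sum>j\<in>{j\<in>{..<t}. \<kappa> j = i}. hdim (PP (\<kappa> j)) X)"
    using \<kappa> by (intro sum.group[symmetric]) auto
  also have "\<dots> = (\<Sum>i<n. multiplicity_in (PP i) P t N * hdim (PP i) X)"
  proof (intro sum.cong refl)
    fix i assume i: "i \<in> {..<n}"
    have "{j \<in> {..<t}. \<kappa> j = i} = {j. j < t \<and> mod_iso (submod P (N j)) (PP i)}" using iso_iff i by auto
    moreover have "(\<Sum>j\<in>{j\<in>{..<t}. \<kappa> j = i}. hdim (PP (\<kappa> j)) X) = (\<Sum>j\<in>{j\<in>{..<t}. \<kappa> j = i}. hdim (PP i) X)"
      by (intro sum.cong) auto
    ultimately show "(\<Sum>j\<in>{j\<in>{..<t}. \<kappa> j = i}. hdim (PP (\<kappa> j)) X) = multiplicity_in (PP i) P t N * hdim (PP i) X"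
      unfolding multiplicity_in_def by simp
  qed
  finally show ?thesis .
qed

end

section \<open>Presentations and tau-rigid modules\<close>

context fd_algebra
begin

text \<open>If \<open>f : M \<rightarrow> N\<close> is a minimal projective presentation of a module \<open>U\<close>, this is the condition that
  \<open>Hom(X, \<tau> U) = 0\<close>. Used in this form, it spares all further reference to the Auslander-Reiten translate.\<close>

definition extends_along ::
    "('k, 'a, 'm::ab_group_add) amod \<Rightarrow> ('m \<Rightarrow> 'n::ab_group_add) \<Rightarrow> ('k, 'a, 'n) amod \<Rightarrow> ('k, 'a, 'l::ab_group_add) amod \<Rightarrow> bool" where
  "extends_along M f N X \<longleftrightarrow> (\<forall>\<phi>. mhom M X \<phi> \<longrightarrow> (\<exists>\<theta>. mhom N X \<theta> \<and> (\<forall>p\<in>car M. \<theta> (f p) = \<phi> p)))"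

lemma extends_alongD:
  "extends_along M f N X \<Longrightarrow> mhom M X \<phi> \<Longrightarrow> \<exists>\<theta>. mhom N X \<theta> \<and> (\<forall>p\<in>car M. \<theta> (f p) = \<phi> p)"
  unfolding extends_along_def by blast

lemma min_proj_presentationD:
  assumes "min_proj_presentation P1 f P0 e M"
  shows mpp_cover0: "projective_cover P0 e M"
    and mpp_cover1: "projective_cover P1 f (submod P0 (mker P0 e))"
    and mpp_mhom: "mhom P1 P0 f"
    and mpp_exact: "x \<in> car P0 \<Longrightarrow> e x = 0 \<longleftrightarrow> x \<in> f ` car P1"
    and mpp_comp_zero: "p \<in> car P1 \<Longrightarrow> e (f p) = 0"
proof -
  show c0: "projective_cover P0 e M" and c1: "projective_cover P1 f (submod P0 (mker P0 e))"
    using assms unfolding min_proj_presentation_def by blast+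
  have im: "f ` car P1 = mker P0 e" using pc_surj[OF c1] by simp
  have "mker P0 e \<subseteq> car P0" unfolding mker_def by blast
  then show "mhom P1 P0 f" using mhom_comp[OF pc_mhom[OF c1] mhom_incl] by blast
  show "x \<in> car P0 \<Longrightarrow> e x = 0 \<longleftrightarrow> x \<in> f ` car P1" unfolding im mker_def by simp
  show "p \<in> car P1 \<Longrightarrow> e (f p) = 0" using im unfolding mker_def by blast
qed

lemma extends_along_quotient:
  fixes P1 X Y :: "('k, 'a) umod"
  assumes P1: "projective P1" and X: "fg_module X" and Y: "right_module Y"
    and g: "mhom X Y g" "g ` car X = car Y" and e: "extends_along P1 f P0 X"
  shows "extends_along P1 f P0 Y"
  unfolding extends_along_def
proof (intro allI impI)
  fix \<phi> assume phi: "mhom P1 Y \<phi>"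
  have "\<exists>l. mhom P1 X l \<and> (\<forall>p\<in>car P1. g (l p) = \<phi> p)"
    by (rule projective_lift[OF P1 X Y g(1) phi]) (use mhom_in[OF phi] g(2) in simp)
  then obtain l where l: "mhom P1 X l" "\<forall>p\<in>car P1. g (l p) = \<phi> p" by blast
  obtain \<theta> where "mhom P0 X \<theta>" "\<forall>p\<in>car P1. \<theta> (f p) = l p" using extends_alongD[OF e l(1)] by blast
  then show "\<exists>\<theta>. mhom P0 Y \<theta> \<and> (\<forall>p\<in>car P1. \<theta> (f p) = \<phi> p)"
    using mhom_comp[OF _ g(1)] l(2) by (intro exI[of _ "\<lambda>x. g (\<theta> x)"]) simp
qed

text \<open>Minimality of presentations makes the extension property pass from a module to its direct
  summands: the presentation of the summand is a retract of that of the whole module, since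
  endomorphisms of a minimal presentation over the identity are automorphisms.\<close>

lemma extends_along_summand:
  fixes P1 P0 R1 R0 M N :: "('k, 'a) umod" and X :: "('k, 'a, 'l::ab_group_add) amod"
  assumes m: "min_proj_presentation P1 f P0 e M" and r: "min_proj_presentation R1 h R0 d N"
    and i: "mhom N M i" and p: "mhom M N p" and pi: "\<And>x. x \<in> car N \<Longrightarrow> p (i x) = x"
    and ext: "extends_along P1 f P0 X"
  shows "extends_along R1 h R0 X"
proof -
  note c0 = mpp_cover0[OF m] and c1 = mpp_cover1[OF m] and d0 = mpp_cover0[OF r] and d1 = mpp_cover1[OF r]
  note P0' = fg_right_module[OF pc_fg[OF c0]] and R0' = fg_right_module[OF pc_fg[OF d0]]
    and M' = fg_right_module[OF pc_fg_target[OF c0]] and N' = fg_right_module[OF pc_fg_target[OF d0]]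
    and R1' = fg_right_module[OF pc_fg[OF d1]]
  have id: "mhom R0 M (\<lambda>x. i (d x))" by (rule mhom_comp[OF pc_mhom[OF d0] i])
  have "\<exists>l. mhom R0 P0 l \<and> (\<forall>x\<in>car R0. e (l x) = i (d x))"
    by (rule projective_lift[OF pc_projective[OF d0] pc_fg[OF c0] M' pc_mhom[OF c0] id])
      (use mhom_in[OF id] pc_surj[OF c0] in simp)
  then obtain a0 where a0: "mhom R0 P0 a0" "\<And>x. x \<in> car R0 \<Longrightarrow> e (a0 x) = i (d x)" by blast
  have pe: "mhom P0 N (\<lambda>x. p (e x))" by (rule mhom_comp[OF pc_mhom[OF c0] p])
  have "\<exists>l. mhom P0 R0 l \<and> (\<forall>x\<in>car P0. d (l x) = p (e x))"
    by (rule projective_lift[OF pc_projective[OF c0] pc_fg[OF d0] N' pc_mhom[OF d0] pe])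
      (use mhom_in[OF pe] pc_surj[OF d0] in simp)
  then obtain b0 where b0: "mhom P0 R0 b0" "\<And>x. x \<in> car P0 \<Longrightarrow> d (b0 x) = p (e x)" by blast
  have ah: "mhom R1 P0 (\<lambda>x. a0 (h x))" by (rule mhom_comp[OF mpp_mhom[OF r] a0(1)])
  have "\<exists>l. mhom R1 P1 l \<and> (\<forall>x\<in>car R1. f (l x) = a0 (h x))"
  proof (rule projective_lift[OF pc_projective[OF d1] pc_fg[OF c1] P0' mpp_mhom[OF m] ah])
    fix x assume x: "x \<in> car R1"
    have "e (a0 (h x)) = 0"
      using a0(2)[OF mhom_in[OF mpp_mhom[OF r] x]] mpp_comp_zero[OF r x] mhom_0[OF N' i] by simp
    then show "a0 (h x) \<in> f ` car P1" using mpp_exact[OF m mhom_in[OF ah x]] by simp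
  qed
  then obtain a1 where a1: "mhom R1 P1 a1" "\<And>x. x \<in> car R1 \<Longrightarrow> f (a1 x) = a0 (h x)" by blast
  have bf: "mhom P1 R0 (\<lambda>x. b0 (f x))" by (rule mhom_comp[OF mpp_mhom[OF m] b0(1)])
  have "\<exists>l. mhom P1 R1 l \<and> (\<forall>x\<in>car P1. h (l x) = b0 (f x))"
  proof (rule projective_lift[OF pc_projective[OF c1] pc_fg[OF d1] R0' mpp_mhom[OF r] bf])
    fix x assume x: "x \<in> car P1"
    have "d (b0 (f x)) = 0"
      using b0(2)[OF mhom_in[OF mpp_mhom[OF m] x]] mpp_comp_zero[OF m x] mhom_0[OF M' p] by simp
    then show "b0 (f x) \<in> h ` car R1" using mpp_exact[OF r mhom_in[OF bf x]] by simp
  qed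
  then obtain b1 where b1: "mhom P1 R1 b1" "\<And>x. x \<in> car P1 \<Longrightarrow> h (b1 x) = b0 (f x)" by blast
  have ba0: "mhom R0 R0 (\<lambda>x. b0 (a0 x))" by (rule mhom_comp[OF a0(1) b0(1)])
  have dba: "d (b0 (a0 x)) = d x" if "x \<in> car R0" for x
    using b0(2)[OF mhom_in[OF a0(1) that]] a0(2)[OF that] pi[OF mhom_in[OF pc_mhom[OF d0] that]] by simp
  have bij0: "bij_betw (\<lambda>x. b0 (a0 x)) (car R0) (car R0)"
    by (rule projective_cover_endo_bij[OF d0 ba0 dba])
  have ba1: "mhom R1 R1 (\<lambda>x. b1 (a1 x))" by (rule mhom_comp[OF a1(1) b1(1)])
  have hba: "h (b1 (a1 x)) = b0 (a0 (h x))" if "x \<in> car R1" for x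
    using b1(2)[OF mhom_in[OF a1(1) that]] a1(2)[OF that] by simp
  have "(\<lambda>x. b1 (a1 x)) ` car R1 = car R1"
  proof (rule projective_cover_surj[OF d1 R1' ba1])
    fix y assume "y \<in> car (submod R0 (mker R0 d))"
    then have y: "y \<in> car R0" "d y = 0" unfolding mker_def by simp_all
    have "y \<in> (\<lambda>x. b0 (a0 x)) ` car R0" using bij_betw_imp_surj_on[OF bij0] y(1) by simp
    then obtain z where z: "z \<in> car R0" "y = b0 (a0 z)" by blast
    have "d z = 0" using dba[OF z(1)] z(2) y(2) by simp
    then have "z \<in> h ` car R1" using mpp_exact[OF r z(1)] by simp
    then obtain x where "x \<in> car R1" "z = h x" by blast
    then show "\<exists>x\<in>car R1. h (b1 (a1 x)) = y" using hba z(2) by auto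
  qed
  then have "bij_betw (\<lambda>x. b1 (a1 x)) (car R1) (car R1)" by (rule endo_bij_if_surj[OF pc_fg[OF d1] ba1])
  then obtain k where k: "mhom R1 R1 k" "\<And>x. x \<in> car R1 \<Longrightarrow> k (b1 (a1 x)) = x"
    using mhom_inverse[OF R1' ba1] by blast
  show ?thesis
    unfolding extends_along_def
  proof (intro allI impI)
    fix \<psi> assume psi: "mhom R1 X \<psi>"
    have "mhom P1 X (\<lambda>x. \<psi> (k (b1 x)))" by (rule mhom_comp[OF mhom_comp[OF b1(1) k(1)] psi])
    then obtain \<theta> where th: "mhom P0 X \<theta>" "\<forall>x\<in>car P1. \<theta> (f x) = \<psi> (k (b1 x))"
      using extends_alongD[OF ext] by blast
    have "\<theta> (a0 (h x)) = \<psi> x" if "x \<in> car R1" for x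
      using th(2) mhom_in[OF a1(1) that] a1(2)[OF that] k(2)[OF that] by metis
    then show "\<exists>\<theta>. mhom R0 X \<theta> \<and> (\<forall>x\<in>car R1. \<theta> (h x) = \<psi> x)"
      using mhom_comp[OF a0(1) th(1)] by blast
  qed
qed

lemma right_module_regular: "right_module regular"
proof -
  have vs: "vector_space (smul regular)" unfolding regular_def using vector_space_axioms by simp
  show ?thesis
    unfolding right_module_def bilinear_action_def
    using vs by (auto simp: regular_def algebra_simps scale_mult_left scale_mult_right)
qed

lemma fg_regular: "fg_module regular"
proof -
  obtain B where "finite B" "span B = UNIV" using finite_dim by blast
  then show ?thesis using fg_moduleI[OF right_module_regular, of B] by (simp add: regular_def)
qed

lemma mhom_regular:
  assumes M: "right_module M" and m: "m \<in> car M" shows "mhom regular M (\<lambda>r. act M r m)"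
  by (rule mhomI)
    (auto simp: regular_def rm_act[OF M m] rm_act_plus[OF M m] rm_act_scale[OF M m] rm_act_mult[OF M m])

text \<open>The dual basis lemma, obtained by splitting a surjection from a free module onto \<open>P\<close>. The sum \<open>W\<close> of
  copies of \<open>A\<close>, a copy of the regular module, serves as the free module.\<close>

lemma projective_dual_basis:
  fixes P :: "('k, 'a) umod"
  assumes P: "projective P"
  shows "\<exists>m y g. (\<forall>a<m. y a \<in> car P \<and> mhom P regular (g a)) \<and>
    (\<forall>x\<in>car P. x = (\<Sum>a<(m::nat). act P (g a x) (y a)))"
proof -
  note fgP = projective_fg[OF P] and P' = fg_right_module[OF projective_fg[OF P]]
  obtain A :: "('k, 'a) umod" and \<theta> where A: "fg_module A" "mhom regular A \<theta>" "\<theta> ` car regular = car A"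
    "\<forall>x\<in>car regular. \<theta> x = 0 \<longleftrightarrow> x \<in> {0}"
    using exists_quotient[OF fg_regular submodule_0[OF right_module_regular]] by blast
  have "bij_betw \<theta> (car regular) (car A)"
    unfolding bij_betw_def using A mhom_inj_on[OF right_module_regular A(2)] by blast
  then obtain \<theta>' where \<theta>': "mhom A regular \<theta>'" "\<forall>x\<in>car regular. \<theta>' (\<theta> x) = x"
    using mhom_inverse[OF right_module_regular A(2)] by blast
  obtain F where F: "finite F" "F \<subseteq> car P" "\<forall>x\<in>car P. \<exists>c. x = (\<Sum>y\<in>F. act P (c y) y)"
    using fgP unfolding fg_module_def by blast
  define m where "m = card F"
  obtain y where "bij_betw y {0..<m} F" using ex_bij_betw_nat_finite[OF F(1)] unfolding m_def by blast
  then have y: "bij_betw y {..<m} F" by (simp add: atLeast0LessThan)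
  have yP: "y a \<in> car P" if "a < m" for a
    using bij_betw_apply[OF y, of a] that F(2) by auto
  obtain W :: "('k, 'a) umod" and \<iota> \<pi> where W: "fg_module W" and bp: "biproduct W m (\<lambda>_. A) \<iota> \<pi>"
    using exists_biproduct[of m "\<lambda>_. A"] A(1) by blast
  note W' = fg_right_module[OF W]
  let ?\<psi> = "\<lambda>w. \<Sum>a<m. act P (\<theta>' (\<pi> a w)) (y a)"
  have hom: "mhom A P (\<lambda>x. act P (\<theta>' x) (y a))" if "a < m" for a
    by (rule mhom_comp[OF \<theta>'(1) mhom_regular[OF P' yP[OF that]]])
  have psi: "mhom W P ?\<psi>" by (rule bp_mhom_from[OF bp P' hom])
  have surj: "x \<in> ?\<psi> ` car W" if x: "x \<in> car P" for x
  proof -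
    obtain c where "x = (\<Sum>y\<in>F. act P (c y) y)" using F(3) x by blast
    then have c: "x = (\<Sum>a<m. act P (c (y a)) (y a))"
      using sum.reindex_bij_betw[OF y, of "\<lambda>y. act P (c y) y"] by simp
    let ?w = "\<Sum>a<m. \<iota> a (\<theta> (c (y a)))"
    have th: "\<theta> (c (y a)) \<in> car A" for a using mhom_in[OF A(2)] by (simp add: regular_def)
    have w: "?w \<in> car W" by (rule rm_sum[OF W']) (use mhom_in[OF bp_inj[OF bp] th] in auto)
    have eq: "?\<psi> ?w = x"
      unfolding c
    proof (intro sum.cong refl)
      fix a assume "a \<in> {..<m}"
      then have "\<pi> a ?w = \<theta> (c (y a))" using bp_proj_sum[OF bp W', of "\<lambda>a. \<theta> (c (y a))"] th by simp
      then show "act P (\<theta>' (\<pi> a ?w)) (y a) = act P (c (y a)) (y a)"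
        using \<theta>'(2) by (simp add: regular_def)
    qed
    show ?thesis by (rule image_eqI[where f = "?\<psi>" and x = "?w", OF eq[symmetric] w])
  qed
  obtain s where s: "mhom P W s" "\<forall>x\<in>car P. ?\<psi> (s x) = x"
    using projective_lift[OF P W P' psi mhom_ident surj] by blast
  have "\<forall>a<m. y a \<in> car P \<and> mhom P regular (\<lambda>x. \<theta>' (\<pi> a (s x)))"
    using yP mhom_comp[OF mhom_comp[OF s(1) bp_proj[OF bp]] \<theta>'(1)] by blast
  moreover have "\<forall>x\<in>car P. x = (\<Sum>a<m. act P (\<theta>' (\<pi> a (s x))) (y a))" using s(2) by simp
  ultimately show ?thesis
    by (intro exI[of _ m] exI[of _ y] exI[of _ "\<lambda>a x. \<theta>' (\<pi> a (s x))"]) blast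
qed

lemma car_hom_to_A: "car (hom_to_A P) = homs P regular"
  unfolding hom_to_A_def homs_def by simp

text \<open>Let \<open>\<phi> : P1 \<rightarrow> M\<close> not extend along \<open>f\<close>. A linear form \<open>\<xi>\<close> on \<open>Hom(P1, M)\<close> that vanishes on all
  extendable maps but not on \<open>\<phi>\<close> assigns to each \<open>m\<close> in \<open>M\<close> the form \<open>g \<mapsto> \<xi> (m \<otimes> g)\<close> on
  \<open>Hom(P1, A)\<close>. It vanishes on the image of \<open>Hom(P0, A)\<close>, and thus is an element of the dual of the
  transpose. This defines a homomorphism from \<open>M\<close> to \<open>\<tau> M\<close>, which is zero by tau-rigidity. But the
  elements \<open>m \<otimes> g\<close> span \<open>Hom(P1, M)\<close> by the dual basis lemma, so \<open>\<xi> \<phi> = 0\<close>, a contradiction.\<close>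

lemma tau_rigid_extends_along:
  fixes M :: "('k, 'a) umod"
  assumes "tau_rigid M"
  shows "\<exists>P1 f P0 e. min_proj_presentation P1 f P0 e M \<and> extends_along P1 f P0 M"
proof -
  have fgM: "fg_module M" using assms unfolding tau_rigid_def by blast
  note M = fg_right_module[OF fgM]
  obtain T where T: "is_transpose M T" "hom_zero M (kdual T)"
    using assms unfolding tau_rigid_def is_AR_translate_def by blast
  obtain P1 f P0 e q where pres: "min_proj_presentation P1 f P0 e M"
    and q: "mhom (hom_to_A P1) T q" "q ` car (hom_to_A P1) = car T"
      "mker (hom_to_A P1) q = pullback_to_A P1 f ` car (hom_to_A P0)"
    using T(1) unfolding is_transpose_def by blast
  note P1 = fg_right_module[OF pc_fg[OF mpp_cover1[OF pres]]] and P0 = fg_right_module[OF pc_fg[OF mpp_cover0[OF pres]]]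
  note pr1 = pc_projective[OF mpp_cover1[OF pres]]
  interpret H: vector_space "homscale M :: 'k \<Rightarrow> ((nat \<Rightarrow> 'k) \<Rightarrow> nat \<Rightarrow> 'k) \<Rightarrow> (nat \<Rightarrow> 'k) \<Rightarrow> nat \<Rightarrow> 'k"
    using vector_space_homscale[OF M] .
  interpret R: vector_space "homscale (regular :: ('k, 'a, 'a) amod) :: 'k \<Rightarrow> ((nat \<Rightarrow> 'k) \<Rightarrow> 'a) \<Rightarrow> (nat \<Rightarrow> 'k) \<Rightarrow> 'a"
    using vector_space_homscale[OF right_module_regular] .
  note SR = homs_subspace[OF right_module_regular, of P1]
  define I where "I = (\<lambda>\<theta>. extend0 P1 (\<lambda>x. \<theta> (f x))) ` homs P0 M"
  have I: "H.subspace I"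
  proof (rule H.subspaceI)
    note S0 = homs_subspace[OF M, of P0]
    show "0 \<in> I" unfolding I_def using H.subspace_0[OF S0]
      by (intro image_eqI[of _ _ 0]) (auto simp: extend0_def fun_eq_iff)
    fix x assume "x \<in> I"
    then obtain \<theta> where x: "\<theta> \<in> homs P0 M" "x = extend0 P1 (\<lambda>x. \<theta> (f x))" unfolding I_def by blast
    show "homscale M c x \<in> I" for c
      unfolding I_def x(2) extend0_comp_scale[OF M, symmetric] using H.subspace_scale[OF S0 x(1)] by blast
    fix y assume "y \<in> I"
    then obtain \<theta>' where y: "\<theta>' \<in> homs P0 M" "y = extend0 P1 (\<lambda>x. \<theta>' (f x))" unfolding I_def by blast
    show "x + y \<in> I"
      unfolding I_def x(2) y(2) extend0_comp_add[symmetric] using H.subspace_add[OF S0 x(1) y(1)] by blast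
  qed
  \<comment> \<open>The element \<open>m \<otimes> g\<close> of \<open>Hom(P1, M)\<close>.\<close>
  define mg where "mg m g = (\<lambda>p. act M (g p) m)" for m :: "nat \<Rightarrow> 'k" and g :: "(nat \<Rightarrow> 'k) \<Rightarrow> 'a"
  have "extends_along P1 f P0 M"
    unfolding extends_along_def
  proof (intro allI impI, rule ccontr)
    fix \<phi> assume phi: "mhom P1 M \<phi>" and no: "\<not> (\<exists>\<theta>. mhom P0 M \<theta> \<and> (\<forall>p\<in>car P1. \<theta> (f p) = \<phi> p))"
    have notI: "extend0 P1 \<phi> \<notin> I"
    proof
      assume "extend0 P1 \<phi> \<in> I"
      then obtain \<theta> where th: "\<theta> \<in> homs P0 M" "extend0 P1 \<phi> = extend0 P1 (\<lambda>x. \<theta> (f x))" unfolding I_def by blast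
      have "\<theta> (f p) = \<phi> p" if "p \<in> car P1" for p using fun_cong[OF th(2), of p] that by simp
      then show False using no homs_mhom[OF th(1)] by blast
    qed
    obtain B where B: "B \<subseteq> I" "H.independent B" "I \<subseteq> H.span B" "card B = H.dim I" by (rule H.basis_exists)
    have spB: "H.span B = I" using B(3) H.span_minimal[OF B(1) I] by blast
    have ind: "H.independent (insert (extend0 P1 \<phi>) B)"
      by (rule H.independent_insertI[OF _ B(2)]) (simp add: spB notI)
    have vk: "vector_space ((*) :: 'k \<Rightarrow> 'k \<Rightarrow> 'k)" by unfold_locales (auto simp: algebra_simps)
    interpret VP: vector_space_pair "homscale M :: 'k \<Rightarrow> ((nat \<Rightarrow> 'k) \<Rightarrow> nat \<Rightarrow> 'k) \<Rightarrow> (nat \<Rightarrow> 'k) \<Rightarrow> nat \<Rightarrow> 'k"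
      "(*) :: 'k \<Rightarrow> 'k \<Rightarrow> 'k"
      using H.vector_space_axioms vk by (simp add: vector_space_pair_def)
    obtain \<xi> where xi: "Vector_Spaces.linear (homscale M) (*) \<xi>"
      "\<forall>x\<in>insert (extend0 P1 \<phi>) B. \<xi> x = (if x = extend0 P1 \<phi> then 1 else 0)"
      using VP.linear_independent_extend[OF ind, of "\<lambda>x. if x = extend0 P1 \<phi> then 1 else 0"] by blast
    interpret X: Vector_Spaces.linear "homscale M :: 'k \<Rightarrow> ((nat \<Rightarrow> 'k) \<Rightarrow> nat \<Rightarrow> 'k) \<Rightarrow> (nat \<Rightarrow> 'k) \<Rightarrow> nat \<Rightarrow> 'k"
      "(*) :: 'k \<Rightarrow> 'k \<Rightarrow> 'k" \<xi> by (fact xi(1))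
    have xi1: "\<xi> (extend0 P1 \<phi>) = 1" using xi(2) by simp
    have xi0: "\<xi> x = 0" if "x \<in> I" for x
    proof (rule X.eq_0_on_span)
      show "x \<in> H.span B" using that spB by simp
      show "\<xi> b = 0" if "b \<in> B" for b using that xi(2) B(1) notI by auto
    qed
    have mg_add: "mg (m + m') g = mg m g + mg m' g" if "m \<in> car M" "m' \<in> car M" for m m' g
      unfolding mg_def using rm_act_add[OF M that] by (auto simp: fun_eq_iff)
    have mg_smul: "mg (smul M c m) g = homscale M c (mg m g)" if "m \<in> car M" for m c g
      unfolding mg_def homscale_def using rm_act_smul[OF M that] by auto
    have mg_act: "mg (act M a m) g = mg m (\<lambda>x. a * g x)" if "m \<in> car M" for m a g
      unfolding mg_def using rm_act_mult[OF M that] by auto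
    have mg_add': "mg m (g + g') = mg m g + mg m g'" if "m \<in> car M" for m g g'
      unfolding mg_def using rm_act_plus[OF M that] by (auto simp: fun_eq_iff)
    have mg_scale': "mg m (\<lambda>x. scale c (g x)) = homscale M c (mg m g)" if "m \<in> car M" for m c g
      unfolding mg_def homscale_def using rm_act_scale[OF M that] by auto
    have mg_I: "mg m g \<in> I" if m: "m \<in> car M" and g: "g \<in> mker (hom_to_A P1) q" for m g
    proof -
      obtain g0 where g0: "g0 \<in> homs P0 regular" "g = pullback_to_A P1 f g0"
        using g q(3) car_hom_to_A by blast
      have "mhom P0 M (\<lambda>x. act M (g0 x) m)" by (rule mhom_comp[OF homs_mhom[OF g0(1)] mhom_regular[OF M m]])
      then have h: "extend0 P0 (\<lambda>x. act M (g0 x) m) \<in> homs P0 M" by (rule extend0_homs[OF P0])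
      have "mg m g = extend0 P1 (\<lambda>x. extend0 P0 (\<lambda>x. act M (g0 x) m) (f x))"
        unfolding mg_def g0(2) pullback_to_A_def extend0_def
        using mhom_in[OF mpp_mhom[OF pres]] rm_act_0_left[OF M m] by (auto simp: fun_eq_iff)
      then show ?thesis unfolding I_def using h by blast
    qed
    have xi_cong: "\<xi> (mg m g) = \<xi> (mg m g')"
      if m: "m \<in> car M" and g: "g \<in> homs P1 regular" "g' \<in> homs P1 regular" and eq: "q g = q g'" for m g g'
    proof -
      have d: "g - g' \<in> homs P1 regular" by (rule R.subspace_diff[OF SR g])
      have "q ((g - g') + g') = q (g - g') + q g'"
        by (rule mhom_add[OF q(1)]) (simp_all only: car_hom_to_A d g)
      then have "q (g - g') = 0" using eq by simp
      then have "g - g' \<in> mker (hom_to_A P1) q" unfolding mker_def car_hom_to_A using d by simp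
      then have "\<xi> (mg m (g - g')) = 0" using xi0 mg_I[OF m] by blast
      moreover have "mg m g = mg m (g - g') + mg m g'" using mg_add'[OF m, of "g - g'" g'] by simp
      ultimately show ?thesis using X.add by simp
    qed
    \<comment> \<open>The functional \<open>\<xi>\<close> turns into a homomorphism from \<open>M\<close> to the dual of the transpose.\<close>
    define \<Psi> where "\<Psi> m t = (if t \<in> car T then \<xi> (mg m (inv_into (homs P1 regular) q t)) else 0)" for m t
    have qs: "q ` homs P1 regular = car T" using q(2) car_hom_to_A by metis
    have Psi: "\<Psi> m (q g) = \<xi> (mg m g)" if m: "m \<in> car M" and g: "g \<in> homs P1 regular" for m g
    proof -
      have "q g \<in> q ` homs P1 regular" using g by blast
      then have "inv_into (homs P1 regular) q (q g) \<in> homs P1 regular" "q (inv_into (homs P1 regular) q (q g)) = q g"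
        by (rule inv_into_into, rule f_inv_into_f)
      then have "\<xi> (mg m (inv_into (homs P1 regular) q (q g))) = \<xi> (mg m g)" using xi_cong[OF m _ g] by blast
      moreover have "q g \<in> car T" using g qs by blast
      ultimately show ?thesis unfolding \<Psi>_def by simp
    qed
    have tE: "\<exists>g\<in>homs P1 regular. t = q g" if "t \<in> car T" for t using that qs by blast
    have hsmul: "(\<lambda>x. scale c (g x)) \<in> homs P1 regular \<and> q (\<lambda>x. scale c (g x)) = smul T c (q g)"
      if g: "g \<in> homs P1 regular" for c g
    proof
      have "homscale regular c g \<in> homs P1 regular" by (rule R.subspace_scale[OF SR g])
      then show "(\<lambda>x. scale c (g x)) \<in> homs P1 regular" by (simp add: homscale_def regular_def)
      show "q (\<lambda>x. scale c (g x)) = smul T c (q g)"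
        using mhom_smul[OF q(1), of g c] g unfolding car_hom_to_A by (simp add: hom_to_A_def)
    qed
    have hact: "(\<lambda>x. a * g x) \<in> homs P1 regular \<and> q (\<lambda>x. a * g x) = act T a (q g)"
      if g: "g \<in> homs P1 regular" for a g
    proof
      have "mhom (regular :: ('k, 'a, 'a) amod) regular (\<lambda>x. a * x)"
        by (rule mhomI) (auto simp: regular_def algebra_simps scale_mult_right)
      then have "mhom P1 regular (\<lambda>x. a * g x)" by (rule mhom_comp[OF homs_mhom[OF g]])
      then show "(\<lambda>x. a * g x) \<in> homs P1 regular" using homs_out[OF g] unfolding homs_def by simp
      show "q (\<lambda>x. a * g x) = act T a (q g)"
        using mhom_act[OF q(1), of g a] g unfolding car_hom_to_A by (simp add: hom_to_A_def)
    qed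
    have "mhom M (kdual T) \<Psi>"
    proof (rule mhomI)
      fix m assume m: "m \<in> car M"
      have "\<Psi> m (s + t) = \<Psi> m s + \<Psi> m t" if st: "s \<in> car T" "t \<in> car T" for s t
      proof -
        obtain g g' where g: "g \<in> homs P1 regular" "s = q g" "g' \<in> homs P1 regular" "t = q g'"
          using tE st by meson
        have gg: "g + g' \<in> homs P1 regular" by (rule R.subspace_add[OF SR g(1,3)])
        have "s + t = q (g + g')"
          unfolding g(2,4) by (rule mhom_add[OF q(1), symmetric]) (simp_all only: car_hom_to_A g)
        then show ?thesis using Psi[OF m gg] Psi[OF m g(1)] Psi[OF m g(3)] g mg_add'[OF m] X.add by simp
      qed
      moreover have "\<Psi> m (smul T c t) = c * \<Psi> m t" if t: "t \<in> car T" for c t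
      proof -
        obtain g where g: "g \<in> homs P1 regular" "t = q g" using tE[OF t] by blast
        note hs = hsmul[OF g(1), of c]
        have "\<Psi> m (smul T c t) = \<Psi> m (q (\<lambda>x. scale c (g x)))" using hs g(2) by simp
        also have "\<dots> = \<xi> (mg m (\<lambda>x. scale c (g x)))" using Psi[OF m] hs by blast
        also have "\<dots> = c * \<xi> (mg m g)" unfolding mg_scale'[OF m] by (rule X.scale)
        finally show ?thesis using Psi[OF m g(1)] g(2) by simp
      qed
      moreover have "\<Psi> m t = 0" if "t \<notin> car T" for t using that unfolding \<Psi>_def by simp
      ultimately show "\<Psi> m \<in> car (kdual T)" unfolding kdual_def by simp
      show "\<Psi> (smul M c m) = smul (kdual T) c (\<Psi> m)" for c
      proof -
        have "\<Psi> (smul M c m) t = c * \<Psi> m t" for t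
          unfolding \<Psi>_def using mg_smul[OF m] X.scale by simp
        then show ?thesis unfolding kdual_def by auto
      qed
      show "\<Psi> (m + m') = \<Psi> m + \<Psi> m'" if m': "m' \<in> car M" for m'
      proof -
        have "\<Psi> (m + m') t = \<Psi> m t + \<Psi> m' t" for t
          unfolding \<Psi>_def using mg_add[OF m m'] X.add by simp
        then show ?thesis by (auto simp: fun_eq_iff)
      qed
      show "\<Psi> (act M a m) = act (kdual T) a (\<Psi> m)" for a
      proof -
        have "\<Psi> (act M a m) t = (if t \<in> car T then \<Psi> m (act T a t) else 0)" for t
        proof (cases "t \<in> car T")
          case True
          obtain g where g: "g \<in> homs P1 regular" "t = q g" using tE[OF True] by blast
          note ha = hact[OF g(1), of a]
          have "\<Psi> m (act T a t) = \<Psi> m (q (\<lambda>x. a * g x))" using ha g(2) by simp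
          also have "\<dots> = \<xi> (mg m (\<lambda>x. a * g x))" using Psi[OF m] ha by blast
          also have "\<dots> = \<xi> (mg (act M a m) g)" unfolding mg_act[OF m] ..
          also have "\<dots> = \<Psi> (act M a m) t" using Psi[OF rm_act[OF M m] g(1)] g(2) by simp
          finally show ?thesis using True by simp
        qed (simp add: \<Psi>_def)
        then show ?thesis unfolding kdual_def by (auto simp: fun_eq_iff)
      qed
    qed
    then have Psi0: "\<Psi> m = 0" if "m \<in> car M" for m using T(2) that unfolding hom_zero_def by blast
    have xi_mg: "\<xi> (mg m g) = 0" if "m \<in> car M" "g \<in> homs P1 regular" for m g
      using Psi[OF that] Psi0[OF that(1)] by simp
    obtain m y g where yg: "\<forall>a<m. y a \<in> car P1 \<and> mhom P1 regular (g a)"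
      "\<forall>x\<in>car P1. x = (\<Sum>a<(m::nat). act P1 (g a x) (y a))"
      using projective_dual_basis[OF pr1] by blast
    have "extend0 P1 \<phi> = (\<Sum>a<m. mg (\<phi> (y a)) (extend0 P1 (g a)))"
    proof
      fix x
      show "extend0 P1 \<phi> x = (\<Sum>a<m. mg (\<phi> (y a)) (extend0 P1 (g a))) x"
      proof (cases "x \<in> car P1")
        case True
        have "\<phi> x = \<phi> (\<Sum>a<m. act P1 (g a x) (y a))" using yg(2) True by simp
        also have "\<dots> = (\<Sum>a<m. \<phi> (act P1 (g a x) (y a)))"
          by (rule mhom_sum[OF P1 phi]) (use yg(1) rm_act[OF P1] in blast)
        also have "\<dots> = (\<Sum>a<m. act M (g a x) (\<phi> (y a)))"
          by (intro sum.cong refl mhom_act[OF phi]) (use yg(1) in blast)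
        finally show ?thesis using True by (simp add: sum_fun_apply mg_def)
      next
        case False
        then show ?thesis using yg(1) rm_act_0_left[OF M mhom_in[OF phi]] by (simp add: sum_fun_apply mg_def)
      qed
    qed
    then have "\<xi> (extend0 P1 \<phi>) = (\<Sum>a<m. \<xi> (mg (\<phi> (y a)) (extend0 P1 (g a))))" using X.sum by simp
    also have "\<dots> = (\<Sum>a<m. 0)"
    proof (intro sum.cong refl)
      fix a assume "a \<in> {..<m}"
      then have "y a \<in> car P1" "mhom P1 regular (g a)" using yg(1) by blast+
      then show "\<xi> (mg (\<phi> (y a)) (extend0 P1 (g a))) = 0"
        by (intro xi_mg mhom_in[OF phi] extend0_homs[OF P1])
    qed
    finally show False using xi1 by simp
  qed
  then show ?thesis using pres by blast
qed

lemma hdim_of_presentation: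
  fixes X :: "('k, 'a) umod"
  assumes m: "min_proj_presentation P1 f P0 e M" and X: "fg_module X" and ext: "extends_along P1 f P0 X"
  shows "hdim P0 X = hdim P1 X + hdim M X"
  by (rule hdim_exact_contravariant[OF pc_fg[OF mpp_cover1[OF m]] pc_fg[OF mpp_cover0[OF m]]
        pc_fg_target[OF mpp_cover0[OF m]] X mpp_mhom[OF m] pc_mhom[OF mpp_cover0[OF m]] pc_surj[OF mpp_cover0[OF m]]
        mpp_exact[OF m] extends_alongD[OF ext]])

text \<open>The minimal presentation of a projective module \<open>Q\<close> is \<open>0 \<rightarrow> Q\<close>: the cover \<open>e\<close> splits and is therefore
  injective, so that \<open>P1\<close> covers the zero module and is zero itself.\<close>

lemma projective_extends_along:
  fixes X :: "('k, 'a, 'l::ab_group_add) amod"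
  assumes m: "min_proj_presentation P1 f P0 e Q" and Q: "projective Q" and X: "right_module X"
  shows "extends_along P1 f P0 X"
proof -
  note c0 = mpp_cover0[OF m] and c1 = mpp_cover1[OF m]
  note P0' = fg_right_module[OF pc_fg[OF c0]] and P1' = fg_right_module[OF pc_fg[OF c1]]
    and Q' = fg_right_module[OF projective_fg[OF Q]]
  have "\<exists>s. mhom Q P0 s \<and> (\<forall>x\<in>car Q. e (s x) = x)"
    by (rule projective_lift[OF Q pc_fg[OF c0] Q' pc_mhom[OF c0] mhom_ident]) (simp add: pc_surj[OF c0])
  then obtain s where s: "mhom Q P0 s" "\<forall>x\<in>car Q. e (s x) = x" by blast
  have "bij_betw (\<lambda>x. s (e x)) (car P0) (car P0)"
    by (rule projective_cover_endo_bij[OF c0 mhom_comp[OF pc_mhom[OF c0] s(1)]])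
      (use s(2) mhom_in[OF pc_mhom[OF c0]] in blast)
  then have inj: "inj_on (\<lambda>x. s (e x)) (car P0)" by (rule bij_betw_imp_inj_on)
  have f0: "f p = 0" if p: "p \<in> car P1" for p
  proof -
    have "s (e (f p)) = s (e 0)" using mpp_comp_zero[OF m p] mhom_0[OF P0' pc_mhom[OF c0]] by simp
    then show ?thesis using inj_onD[OF inj, of "f p" 0] mhom_in[OF mpp_mhom[OF m] p] rm_zero[OF P0'] by simp
  qed
  have "{0} = car P1"
  proof (rule superfluousD[OF pc_superfluous[OF c1] submodule_0[OF P1']])
    show "set_sum (mker P1 f) {0} = car P1" unfolding set_sum_def mker_def using f0 by auto
  qed
  then have z: "p = 0" if "p \<in> car P1" for p using that by blast
  show ?thesis
    unfolding extends_along_def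
  proof (intro allI impI)
    fix \<phi> assume phi: "mhom P1 X \<phi>"
    show "\<exists>\<theta>. mhom P0 X \<theta> \<and> (\<forall>p\<in>car P1. \<theta> (f p) = \<phi> p)"
      using mhom_zero[OF X] z mhom_0[OF P1' phi] by (intro exI[of _ "\<lambda>_. 0"]) fastforce
  qed
qed

end

context indecomposable_projectives
begin

text \<open>Counting summands, the pairing equals \<open>hdim P0 X - hdim P1 X\<close>, and the extension property makes the
  sequence of Hom-spaces exact. The presentation is the one that defines the g-vector.\<close>

lemma g_vector_pairing:
  assumes "is_g_vector n PP M g"
  shows "\<exists>P1 f P0 e. min_proj_presentation P1 f P0 e M \<and>
    (\<forall>X :: ('k, 'a) umod. fg_module X \<longrightarrow> extends_along P1 f P0 X \<longrightarrow>
      (\<Sum>i<n. g $ i * int (hdim (PP i) X)) = int (hdim M X))"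
proof -
  obtain P1 f P0 e t0 N0 t1 N1 where m: "min_proj_presentation P1 f P0 e M"
    and N: "indec_decomp P0 t0 N0" "indec_decomp P1 t1 N1"
    and g: "g = vec n (\<lambda>i. int (multiplicity_in (PP i) P0 t0 N0) - int (multiplicity_in (PP i) P1 t1 N1))"
    using assms unfolding is_g_vector_def by blast
  have "(\<Sum>i<n. g $ i * int (hdim (PP i) X)) = int (hdim M X)"
    if X: "fg_module X" and ext: "extends_along P1 f P0 X" for X :: "('k, 'a) umod"
  proof -
    have "(\<Sum>i<n. g $ i * int (hdim (PP i) X)) =
      int (\<Sum>i<n. multiplicity_in (PP i) P0 t0 N0 * hdim (PP i) X) - int (\<Sum>i<n. multiplicity_in (PP i) P1 t1 N1 * hdim (PP i) X)"
      unfolding g by (simp add: left_diff_distrib sum_subtractf)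
    also have "\<dots> = int (hdim P0 X) - int (hdim P1 X)"
      using hdim_projective[OF pc_projective[OF mpp_cover0[OF m]] N(1) X]
        hdim_projective[OF pc_projective[OF mpp_cover1[OF m]] N(2) X] by simp
    also have "\<dots> = int (hdim M X)" using hdim_of_presentation[OF m X ext] by simp
    finally show ?thesis .
  qed
  then show ?thesis using m by blast
qed

end

section \<open>The torsion class of a tau-rigid pair\<close>

text \<open>The data of a tau-rigid pair, given by families of indecomposable summands \<open>U l\<close> and \<open>Q q\<close> with
  presentations of the \<open>U l\<close>. Working with families avoids a presentation of the sum of the \<open>U l\<close>, the
  g-vectors being those of the summands.\<close>

locale rigid_family = indecomposable_projectives scale n S PP top
  for scale :: "'k::field \<Rightarrow> 'a::{ring,monoid_mult} \<Rightarrow> 'a" and n S PP top +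
  fixes L :: "nat set" and U P1 P0 :: "nat \<Rightarrow> ('k, 'a) umod" and f e
    and K :: "nat set" and Q :: "nat \<Rightarrow> ('k, 'a) umod"
  assumes finite_L: "finite L"
    and presentation: "l \<in> L \<Longrightarrow> min_proj_presentation (P1 l) (f l) (P0 l) (e l) (U l)"
    and U_indecomposable: "l \<in> L \<Longrightarrow> indecomposable (U l)"
    and rigid: "l \<in> L \<Longrightarrow> l' \<in> L \<Longrightarrow> extends_along (P1 l) (f l) (P0 l) (U l')"
    and Q_projective: "q \<in> K \<Longrightarrow> projective (Q q)"
    and Q_indecomposable: "q \<in> K \<Longrightarrow> indecomposable (Q q)"
    and hom_Q_U: "q \<in> K \<Longrightarrow> l \<in> L \<Longrightarrow> hom_zero (Q q) (U l)"
begin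

lemma P1_projective: "l \<in> L \<Longrightarrow> projective (P1 l)"
  using pc_projective[OF mpp_cover1[OF presentation]] .

lemma P0_projective: "l \<in> L \<Longrightarrow> projective (P0 l)"
  using pc_projective[OF mpp_cover0[OF presentation]] .

lemma P_right_module: "l \<in> L \<Longrightarrow> right_module (P1 l)" "l \<in> L \<Longrightarrow> right_module (P0 l)"
  using fg_right_module projective_fg P1_projective P0_projective by blast+

lemma U_fg: "l \<in> L \<Longrightarrow> fg_module (U l)"
  using pc_fg_target[OF mpp_cover0[OF presentation]] .

lemma mhom_f: "l \<in> L \<Longrightarrow> mhom (P1 l) (P0 l) (f l)"
  using mpp_mhom[OF presentation] .

lemma mhom_e: "l \<in> L \<Longrightarrow> mhom (P0 l) (U l) (e l)"
  using pc_mhom[OF mpp_cover0[OF presentation]] .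

lemma e_surj: "l \<in> L \<Longrightarrow> e l ` car (P0 l) = car (U l)"
  using pc_surj[OF mpp_cover0[OF presentation]] .

lemma e_f: "l \<in> L \<Longrightarrow> p \<in> car (P1 l) \<Longrightarrow> e l (f l p) = 0"
  using mpp_comp_zero[OF presentation] .

lemma kernel_e: "l \<in> L \<Longrightarrow> x \<in> car (P0 l) \<Longrightarrow> e l x = 0 \<Longrightarrow> x \<in> f l ` car (P1 l)"
  using mpp_exact[OF presentation] by blast

lemma descend_to_U:
  assumes l: "l \<in> L" and h: "mhom (P0 l) X h" and z: "\<And>p. p \<in> car (P1 l) \<Longrightarrow> h (f l p) = 0"
  shows "\<exists>k. mhom (U l) X k \<and> (\<forall>x\<in>car (P0 l). k (e l x) = h x)"
  by (rule mhom_factor_surj[OF P_right_module(2)[OF l] mhom_e[OF l] e_surj[OF l] h])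
    (use kernel_e[OF l] z in blast)

text \<open>The modules \<open>X\<close> with \<open>Hom(X, \<tau> U l) = 0\<close> and \<open>Hom(Q q, X) = 0\<close>.\<close>

definition torsion :: "('k, 'a) umod \<Rightarrow> bool" where
  "torsion X \<longleftrightarrow> fg_module X \<and> (\<forall>l\<in>L. extends_along (P1 l) (f l) (P0 l) X) \<and> (\<forall>q\<in>K. hom_zero (Q q) X)"

definition add_U :: "('k, 'a) umod \<Rightarrow> nat \<Rightarrow> (nat \<Rightarrow> nat) \<Rightarrow> (nat \<Rightarrow> (nat \<Rightarrow> 'k) \<Rightarrow> nat \<Rightarrow> 'k) \<Rightarrow>
    (nat \<Rightarrow> (nat \<Rightarrow> 'k) \<Rightarrow> nat \<Rightarrow> 'k) \<Rightarrow> bool" where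
  "add_U W m ix \<iota> \<pi> \<longleftrightarrow> fg_module W \<and> (\<forall>a<m. ix a \<in> L) \<and> biproduct W m (\<lambda>a. U (ix a)) \<iota> \<pi>"

lemma torsionD:
  assumes "torsion X"
  shows torsion_fg: "fg_module X"
    and torsion_extends: "l \<in> L \<Longrightarrow> mhom (P1 l) X \<phi> \<Longrightarrow> \<exists>\<theta>. mhom (P0 l) X \<theta> \<and> (\<forall>p\<in>car (P1 l). \<theta> (f l p) = \<phi> p)"
    and torsion_hom_zero: "q \<in> K \<Longrightarrow> mhom (Q q) X h \<Longrightarrow> x \<in> car (Q q) \<Longrightarrow> h x = 0"
  using assms extends_alongD unfolding torsion_def hom_zero_def by blast+

lemma torsionI:
  assumes "fg_module X"
    and "\<And>l \<phi>. l \<in> L \<Longrightarrow> mhom (P1 l) X \<phi> \<Longrightarrow> \<exists>\<theta>. mhom (P0 l) X \<theta> \<and> (\<forall>p\<in>car (P1 l). \<theta> (f l p) = \<phi> p)"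
    and "\<And>q h x. q \<in> K \<Longrightarrow> mhom (Q q) X h \<Longrightarrow> x \<in> car (Q q) \<Longrightarrow> h x = 0"
  shows "torsion X"
  using assms unfolding torsion_def hom_zero_def extends_along_def by blast

lemma torsion_right_module: "torsion X \<Longrightarrow> right_module X"
  using torsion_fg fg_right_module by blast

lemma torsion_quotient:
  fixes X Y :: "('k, 'a) umod"
  assumes X: "torsion X" and Y: "right_module Y" and g: "mhom X Y g" "g ` car X = car Y"
  shows "torsion Y"
proof (rule torsionI)
  show "fg_module Y" by (rule fg_image[OF torsion_fg[OF X] Y g])
  fix l \<phi> assume l: "l \<in> L" and phi: "mhom (P1 l) Y \<phi>"
  have "extends_along (P1 l) (f l) (P0 l) X" using X l unfolding torsion_def by blast
  then show "\<exists>\<theta>. mhom (P0 l) Y \<theta> \<and> (\<forall>p\<in>car (P1 l). \<theta> (f l p) = \<phi> p)"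
    using extends_along_quotient[OF P1_projective[OF l] torsion_fg[OF X] Y g] extends_alongD phi by blast
next
  fix q h x assume q: "q \<in> K" and h: "mhom (Q q) Y h" and x: "x \<in> car (Q q)"
  have "\<exists>k. mhom (Q q) X k \<and> (\<forall>p\<in>car (Q q). g (k p) = h p)"
    by (rule projective_lift[OF Q_projective[OF q] torsion_fg[OF X] Y g(1) h])
      (use mhom_in[OF h] g(2) in simp)
  then obtain k where k: "mhom (Q q) X k" "\<forall>p\<in>car (Q q). g (k p) = h p" by blast
  have "h x = g 0" using bspec[OF k(2) x] torsion_hom_zero[OF X q k(1) x] by simp
  then show "h x = 0" using mhom_0[OF torsion_right_module[OF X] g(1)] by simp
qed

lemma torsion_biproduct:
  fixes W :: "('k, 'a) umod" and X :: "nat \<Rightarrow> ('k, 'a) umod"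
  assumes W: "fg_module W" and bp: "biproduct W m X \<iota> \<pi>" and X: "\<And>a. a < m \<Longrightarrow> torsion (X a)"
  shows "torsion W"
proof (rule torsionI)
  note W' = fg_right_module[OF W]
  show "fg_module W" by (fact W)
  fix l \<phi> assume l: "l \<in> L" and phi: "mhom (P1 l) W \<phi>"
  have "\<forall>a\<in>{..<m}. \<exists>\<theta>. mhom (P0 l) (X a) \<theta> \<and> (\<forall>p\<in>car (P1 l). \<theta> (f l p) = \<pi> a (\<phi> p))"
    using torsion_extends[OF X l mhom_comp[OF phi bp_proj[OF bp]]] by blast
  from bchoice[OF this] obtain \<theta> where
    th: "\<forall>a\<in>{..<m}. mhom (P0 l) (X a) (\<theta> a) \<and> (\<forall>p\<in>car (P1 l). \<theta> a (f l p) = \<pi> a (\<phi> p))" by blast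
  have hom: "mhom (P0 l) W (\<lambda>x. \<Sum>a<m. \<iota> a (\<theta> a x))" by (rule bp_mhom_to[OF bp W']) (use th in blast)
  have "(\<Sum>a<m. \<iota> a (\<theta> a (f l p))) = \<phi> p" if p: "p \<in> car (P1 l)" for p
  proof -
    have "(\<Sum>a<m. \<iota> a (\<theta> a (f l p))) = (\<Sum>a<m. \<iota> a (\<pi> a (\<phi> p)))"
      using th p by (intro sum.cong) auto
    then show ?thesis using bp_sum[OF bp mhom_in[OF phi p]] by simp
  qed
  then show "\<exists>\<theta>. mhom (P0 l) W \<theta> \<and> (\<forall>p\<in>car (P1 l). \<theta> (f l p) = \<phi> p)" using hom by blast
next
  fix q h x assume q: "q \<in> K" and h: "mhom (Q q) W h" and x: "x \<in> car (Q q)"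
  show "h x = 0"
    by (rule bp_eq_zero[OF bp fg_right_module[OF W] mhom_in[OF h x]])
      (use torsion_hom_zero[OF X q mhom_comp[OF h bp_proj[OF bp]] x] in blast)
qed

lemma torsion_U: "l \<in> L \<Longrightarrow> torsion (U l)"
  unfolding torsion_def using U_fg rigid hom_Q_U by blast

lemma torsion_add_U: "add_U W m ix \<iota> \<pi> \<Longrightarrow> torsion W"
  unfolding add_U_def using torsion_biproduct[of W m "\<lambda>a. U (ix a)"] torsion_U by blast

lemma right_approximation:
  fixes X :: "('k, 'a) umod"
  assumes X: "fg_module X"
  shows "\<exists>W m ix \<iota> \<pi> p. add_U W m ix \<iota> \<pi> \<and> mhom W X p \<and>
    (\<forall>l\<in>L. \<forall>\<phi>. mhom (U l) X \<phi> \<longrightarrow> (\<exists>\<psi>. mhom (U l) W \<psi> \<and> (\<forall>x\<in>car (U l). p (\<psi> x) = \<phi> x)))"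
proof -
  note X' = fg_right_module[OF X]
  have "\<exists>s ix b. (\<forall>a<s. ix a \<in> L \<and> mhom (U (ix a)) X (b a)) \<and>
    (\<forall>l\<in>L. \<forall>\<phi>. mhom (U l) X \<phi> \<longrightarrow>
      (\<exists>c. \<forall>x\<in>car (U l). \<phi> x = (\<Sum>a\<in>{a. a < (s::nat) \<and> ix a = l}. smul X (c a) (b a x))))"
    by (rule finite_spanning_homs_family[OF finite_L U_fg X])
  then obtain m ix b where b: "\<forall>a<m. ix a \<in> L \<and> mhom (U (ix a)) X (b a)"
    and sp: "\<forall>l\<in>L. \<forall>\<phi>. mhom (U l) X \<phi> \<longrightarrow>
      (\<exists>c. \<forall>x\<in>car (U l). \<phi> x = (\<Sum>a\<in>{a. a < (m::nat) \<and> ix a = l}. smul X (c a) (b a x)))" by blast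
  obtain W :: "('k, 'a) umod" and \<iota> \<pi> where W: "fg_module W" and bp: "biproduct W m (\<lambda>a. U (ix a)) \<iota> \<pi>"
    using exists_biproduct[of m "\<lambda>a. U (ix a)"] b U_fg by blast
  note W' = fg_right_module[OF W]
  have hb: "mhom (U (ix a)) X (b a)" if "a < m" for a using b that by blast
  let ?p = "\<lambda>w. \<Sum>a<m. b a (\<pi> a w)"
  have p: "mhom W X ?p" by (rule bp_mhom_from[OF bp X' hb])
  have "\<exists>\<psi>. mhom (U l) W \<psi> \<and> (\<forall>x\<in>car (U l). ?p (\<psi> x) = \<phi> x)" if l: "l \<in> L" and phi: "mhom (U l) X \<phi>" for l \<phi>
  proof -
    obtain c where c: "\<forall>x\<in>car (U l). \<phi> x = (\<Sum>a\<in>{a. a < m \<and> ix a = l}. smul X (c a) (b a x))"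
      using sp l phi by blast
    let ?\<psi> = "\<lambda>x. \<Sum>a\<in>{a. a < m \<and> ix a = l}. smul W (c a) (\<iota> a x)"
    have hi: "mhom (U l) W (\<lambda>x. smul W (c a) (\<iota> a x))" if "a \<in> {a. a < m \<and> ix a = l}" for a
      using mhom_fun_smul[OF W' bp_inj[OF bp, of a]] that by auto
    have "mhom (U l) W ?\<psi>" by (rule mhom_fun_sum[OF W' hi])
    moreover have "?p (?\<psi> x) = \<phi> x" if x: "x \<in> car (U l)" for x
    proof -
      have "?p (?\<psi> x) = (\<Sum>a\<in>{a. a < m \<and> ix a = l}. ?p (smul W (c a) (\<iota> a x)))"
        by (rule mhom_sum[OF W' p]) (use mhom_in[OF hi] x in blast)
      also have "\<dots> = (\<Sum>a\<in>{a. a < m \<and> ix a = l}. smul X (c a) (b a x))"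
      proof (intro sum.cong refl)
        fix a assume "a \<in> {a. a < m \<and> ix a = l}"
        then have a: "a < m" "x \<in> car (U (ix a))" using x by auto
        have "?p (smul W (c a) (\<iota> a x)) = smul X (c a) (?p (\<iota> a x))"
          by (rule mhom_smul[OF p mhom_in[OF bp_inj[OF bp a(1)] a(2)]])
        also have "?p (\<iota> a x) = b a x" by (rule bp_mhom_from_inj[OF bp hb a])
        finally show "?p (smul W (c a) (\<iota> a x)) = smul X (c a) (b a x)" .
      qed
      finally show ?thesis using c x by simp
    qed
    ultimately show ?thesis by blast
  qed
  moreover have "add_U W m ix \<iota> \<pi>" unfolding add_U_def using W bp b by blast
  ultimately show ?thesis using p by blast
qed

lemma left_approximation:
  fixes R :: "('k, 'a) umod"
  assumes R: "fg_module R"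
  shows "\<exists>W m ix \<iota> \<pi> r. add_U W m ix \<iota> \<pi> \<and> mhom R W r \<and>
    (\<forall>l\<in>L. \<forall>\<phi>. mhom R (U l) \<phi> \<longrightarrow> (\<exists>\<psi>. mhom W (U l) \<psi> \<and> (\<forall>x\<in>car R. \<psi> (r x) = \<phi> x)))"
proof -
  have "\<exists>s ix b. (\<forall>a<s. ix a \<in> L \<and> mhom R (U (ix a)) (b a)) \<and>
    (\<forall>l\<in>L. \<forall>\<phi>. mhom R (U l) \<phi> \<longrightarrow>
      (\<exists>c. \<forall>x\<in>car R. \<phi> x = (\<Sum>a\<in>{a. a < (s::nat) \<and> ix a = l}. smul (U l) (c a) (b a x))))"
    by (rule finite_spanning_homs_family[OF finite_L R U_fg])
  then obtain m ix b where b: "\<forall>a<m. ix a \<in> L \<and> mhom R (U (ix a)) (b a)"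
    and sp: "\<forall>l\<in>L. \<forall>\<phi>. mhom R (U l) \<phi> \<longrightarrow>
      (\<exists>c. \<forall>x\<in>car R. \<phi> x = (\<Sum>a\<in>{a. a < (m::nat) \<and> ix a = l}. smul (U l) (c a) (b a x)))" by blast
  obtain W :: "('k, 'a) umod" and \<iota> \<pi> where W: "fg_module W" and bp: "biproduct W m (\<lambda>a. U (ix a)) \<iota> \<pi>"
    using exists_biproduct[of m "\<lambda>a. U (ix a)"] b U_fg by blast
  note W' = fg_right_module[OF W]
  have hb: "mhom R (U (ix a)) (b a)" if "a < m" for a using b that by blast
  let ?r = "\<lambda>x. \<Sum>a<m. \<iota> a (b a x)"
  have r: "mhom R W ?r" by (rule bp_mhom_to[OF bp W' hb])
  have "\<exists>\<psi>. mhom W (U l) \<psi> \<and> (\<forall>x\<in>car R. \<psi> (?r x) = \<phi> x)" if l: "l \<in> L" and phi: "mhom R (U l) \<phi>" for l \<phi>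
  proof -
    note Ul = fg_right_module[OF U_fg[OF l]]
    obtain c where c: "\<forall>x\<in>car R. \<phi> x = (\<Sum>a\<in>{a. a < m \<and> ix a = l}. smul (U l) (c a) (b a x))"
      using sp l phi by blast
    let ?\<psi> = "\<lambda>w. \<Sum>a\<in>{a. a < m \<and> ix a = l}. smul (U l) (c a) (\<pi> a w)"
    have hi: "mhom W (U l) (\<lambda>w. smul (U l) (c a) (\<pi> a w))" if "a \<in> {a. a < m \<and> ix a = l}" for a
      using mhom_fun_smul[OF Ul] bp_proj[OF bp, of a] that by auto
    have "mhom W (U l) ?\<psi>" by (rule mhom_fun_sum[OF Ul hi])
    moreover have "?\<psi> (?r x) = \<phi> x" if x: "x \<in> car R" for x
    proof -
      have "?\<psi> (?r x) = (\<Sum>a\<in>{a. a < m \<and> ix a = l}. smul (U l) (c a) (b a x))"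
      proof (intro sum.cong refl)
        fix a assume "a \<in> {a. a < m \<and> ix a = l}"
        then have "a < m" by blast
        then have "\<pi> a (?r x) = b a x"
          by (intro bp_proj_sum[OF bp W', of "\<lambda>a. b a x"] mhom_in[OF hb x])
        then show "smul (U l) (c a) (\<pi> a (?r x)) = smul (U l) (c a) (b a x)" by simp
      qed
      then show ?thesis using c x by simp
    qed
    ultimately show ?thesis by blast
  qed
  moreover have "add_U W m ix \<iota> \<pi>" unfolding add_U_def using W bp b by blast
  ultimately show ?thesis using r by blast
qed

text \<open>The universal extension of a simple module. Choose maps \<open>b a : P1 (ix a) \<rightarrow> S k\<close> that span all maps from
  the \<open>P1 l\<close> to \<open>S k\<close>, and let \<open>X\<close> be the pushout of the presentation of the sum \<open>W\<close> of the \<open>U (ix a)\<close>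
  along them. Then \<open>X\<close> is an extension of \<open>W\<close> by the image of \<open>S k\<close>. In \<open>X\<close> every \<open>b a\<close>
  extends along \<open>f (ix a)\<close>, by construction; as maps to \<open>W\<close> extend too, \<open>X\<close> lies in the torsion class.
  That \<open>S k\<close> embeds into \<open>X\<close> is due to minimality: the kernel of \<open>f (ix a)\<close> is superfluous, and hence
  killed by all maps to a simple module.\<close>

lemma universal_extension:
  assumes k: "k < n" and QS: "\<And>q. q \<in> K \<Longrightarrow> hom_zero (Q q) (S k)"
  shows "\<exists>X W j r. torsion X \<and> torsion W \<and> mhom (S k) X j \<and> inj_on j (car (S k)) \<and> mhom X W r \<and>
    r ` car X = car W \<and> (\<forall>x\<in>car X. r x = 0 \<longleftrightarrow> x \<in> j ` car (S k))"
proof -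
  note S = S_right_module[OF k] and fgS = simple_fg[OF S_simple[OF k]]
  have "\<exists>s ix b. (\<forall>a<s. ix a \<in> L \<and> mhom (P1 (ix a)) (S k) (b a)) \<and>
    (\<forall>l\<in>L. \<forall>\<phi>. mhom (P1 l) (S k) \<phi> \<longrightarrow>
      (\<exists>c. \<forall>x\<in>car (P1 l). \<phi> x = (\<Sum>a\<in>{a. a < (s::nat) \<and> ix a = l}. smul (S k) (c a) (b a x))))"
    by (rule finite_spanning_homs_family[OF finite_L projective_fg[OF P1_projective] fgS])
  then obtain s ix b where b: "\<forall>a<s. ix a \<in> L \<and> mhom (P1 (ix a)) (S k) (b a)"
    and sp: "\<forall>l\<in>L. \<forall>\<phi>. mhom (P1 l) (S k) \<phi> \<longrightarrow>
      (\<exists>c. \<forall>x\<in>car (P1 l). \<phi> x = (\<Sum>a\<in>{a. a < (s::nat) \<and> ix a = l}. smul (S k) (c a) (b a x)))" by blast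
  have ixL: "ix a \<in> L" if "a < s" for a using b that by blast
  have hb: "mhom (P1 (ix a)) (S k) (b a)" if "a < s" for a using b that by blast
  \<comment> \<open>\<open>Z\<close> is the sum of the modules \<open>P0 (ix a)\<close> and of \<open>S k\<close>, \<open>V\<close> the image of the \<open>P1 (ix a)\<close>.\<close>
  let ?Z = "\<lambda>a. if a < s then P0 (ix a) else S k"
  have "fg_module (?Z a)" for a using projective_fg[OF P0_projective[OF ixL]] fgS by simp
  then obtain Z :: "('k, 'a) umod" and \<iota> \<pi> where Z: "fg_module Z" and bp: "biproduct Z (Suc s) ?Z \<iota> \<pi>"
    using exists_biproduct[of "Suc s" ?Z] by blast
  have "\<And>a. a < s \<Longrightarrow> fg_module (P1 (ix a))" using projective_fg[OF P1_projective[OF ixL]] .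
  then obtain Y :: "('k, 'a) umod" and \<iota>1 \<pi>1 where Y: "fg_module Y"
    and bp1: "biproduct Y s (\<lambda>a. P1 (ix a)) \<iota>1 \<pi>1"
    using exists_biproduct[of s "\<lambda>a. P1 (ix a)"] by blast
  have "\<And>a. a < s \<Longrightarrow> fg_module (U (ix a))" using U_fg[OF ixL] .
  then obtain W :: "('k, 'a) umod" and \<iota>' \<pi>' where W: "fg_module W"
    and bpW: "biproduct W s (\<lambda>a. U (ix a)) \<iota>' \<pi>'"
    using exists_biproduct[of s "\<lambda>a. U (ix a)"] by blast
  note Z' = fg_right_module[OF Z] and Y' = fg_right_module[OF Y] and W' = fg_right_module[OF W]
  have TW: "torsion W" by (rule torsion_biproduct[OF W bpW]) (rule torsion_U[OF ixL])
  have i0: "mhom (P0 (ix a)) Z (\<iota> a)" and p0: "mhom Z (P0 (ix a)) (\<pi> a)" if "a < s" for a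
    using bp_inj[OF bp, of a] bp_proj[OF bp, of a] that by simp_all
  have iS: "mhom (S k) Z (\<iota> s)" and ps: "mhom Z (S k) (\<pi> s)"
    using bp_inj[OF bp, of s] bp_proj[OF bp, of s] by simp_all
  define \<delta> where "\<delta> a p = \<iota> a (f (ix a) p) + \<iota> s (b a p)" for a p
  have hd: "mhom (P1 (ix a)) Z (\<delta> a)" if a: "a < s" for a
    unfolding \<delta>_def
    by (rule mhom_fun_add[OF Z' mhom_comp[OF mhom_f[OF ixL[OF a]] i0[OF a]] mhom_comp[OF hb[OF a] iS]])
  define \<Delta> where "\<Delta> y = (\<Sum>a<s. \<delta> a (\<pi>1 a y))" for y
  have D: "mhom Y Z \<Delta>" unfolding \<Delta>_def by (rule bp_mhom_from[OF bp1 Z' hd])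
  define V where "V = \<Delta> ` car Y"
  have V: "submodule V Z" unfolding V_def by (rule submodule_range[OF Y' Z' D])
  have dV: "\<delta> a p \<in> V" if a: "a < s" and p: "p \<in> car (P1 (ix a))" for a p
  proof -
    have "\<Delta> (\<iota>1 a p) = \<delta> a p" unfolding \<Delta>_def by (rule bp_mhom_from_inj[OF bp1 hd a p])
    then show ?thesis unfolding V_def using mhom_in[OF bp_inj[OF bp1 a] p] by (metis image_eqI)
  qed
  \<comment> \<open>The components of an element of \<open>V\<close>.\<close>
  have V_comp: "\<exists>p. (\<forall>a<s. p a \<in> car (P1 (ix a)) \<and> \<pi> a v = f (ix a) (p a)) \<and> \<pi> s v = (\<Sum>a<s. b a (p a))"
    if v: "v \<in> V" for v
  proof -
    obtain y where y: "y \<in> car Y" "v = \<Delta> y" using v unfolding V_def by blast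
    have p: "\<pi>1 a y \<in> car (P1 (ix a))" if "a < s" for a using mhom_in[OF bp_proj[OF bp1 that] y(1)] .
    have fp: "f (ix a) (\<pi>1 a y) \<in> car (P0 (ix a))" if "a < s" for a
      using mhom_in[OF mhom_f[OF ixL[OF that]] p[OF that]] .
    have bS: "b a (\<pi>1 a y) \<in> car (S k)" if "a < s" for a using mhom_in[OF hb[OF that] p[OF that]] .
    have inZ: "\<delta> a (\<pi>1 a y) \<in> car Z" if "a \<in> {..<s}" for a using mhom_in[OF hd p] that by simp
    have c0: "\<pi> c (\<delta> a (\<pi>1 a y)) = (if a = c then f (ix c) (\<pi>1 c y) else 0)" if a: "a < s" and c: "c < s" for a c
    proof -
      have "\<pi> c (\<delta> a (\<pi>1 a y)) = \<pi> c (\<iota> a (f (ix a) (\<pi>1 a y))) + \<pi> c (\<iota> s (b a (\<pi>1 a y)))"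
        unfolding \<delta>_def by (rule mhom_add[OF p0[OF c] mhom_in[OF i0[OF a] fp[OF a]] mhom_in[OF iS bS[OF a]]])
      moreover have "\<pi> c (\<iota> a (f (ix a) (\<pi>1 a y))) = (if a = c then f (ix a) (\<pi>1 a y) else 0)"
        using bp_proj_inj[OF bp, of a c] a c fp[OF a] by simp
      moreover have "\<pi> c (\<iota> s (b a (\<pi>1 a y))) = 0"
        using bp_proj_inj[OF bp, of s c] c bS[OF a] by simp
      ultimately show ?thesis by simp
    qed
    have cs: "\<pi> s (\<delta> a (\<pi>1 a y)) = b a (\<pi>1 a y)" if a: "a < s" for a
    proof -
      have "\<pi> s (\<delta> a (\<pi>1 a y)) = \<pi> s (\<iota> a (f (ix a) (\<pi>1 a y))) + \<pi> s (\<iota> s (b a (\<pi>1 a y)))"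
        unfolding \<delta>_def by (rule mhom_add[OF ps mhom_in[OF i0[OF a] fp[OF a]] mhom_in[OF iS bS[OF a]]])
      moreover have "\<pi> s (\<iota> a (f (ix a) (\<pi>1 a y))) = 0"
        using bp_proj_inj[OF bp, of a s] a fp[OF a] by simp
      moreover have "\<pi> s (\<iota> s (b a (\<pi>1 a y))) = b a (\<pi>1 a y)"
        using bp_proj_inj[OF bp, of s s] bS[OF a] by simp
      ultimately show ?thesis by simp
    qed
    have "\<pi> c v = f (ix c) (\<pi>1 c y)" if c: "c < s" for c
    proof -
      have "\<pi> c v = (\<Sum>a<s. \<pi> c (\<delta> a (\<pi>1 a y)))" unfolding y(2) \<Delta>_def by (rule mhom_sum[OF Z' p0[OF c] inZ])
      also have "\<dots> = (\<Sum>a<s. if a = c then f (ix c) (\<pi>1 c y) else 0)" using c0[OF _ c] by (intro sum.cong) auto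
      finally show ?thesis using c by simp
    qed
    moreover have "\<pi> s v = (\<Sum>a<s. b a (\<pi>1 a y))"
    proof -
      have "\<pi> s v = (\<Sum>a<s. \<pi> s (\<delta> a (\<pi>1 a y)))" unfolding y(2) \<Delta>_def by (rule mhom_sum[OF Z' ps inZ])
      also have "\<dots> = (\<Sum>a<s. b a (\<pi>1 a y))" using cs by (intro sum.cong) auto
      finally show ?thesis .
    qed
    ultimately show ?thesis using p by (intro exI[of _ "\<lambda>a. \<pi>1 a y"]) blast
  qed
  obtain X :: "('k, 'a) umod" and q where X: "fg_module X" and q: "mhom Z X q" "q ` car Z = car X"
    "\<forall>z\<in>car Z. q z = 0 \<longleftrightarrow> z \<in> V"
    using exists_quotient[OF Z V] by blast
  note X' = fg_right_module[OF X]
  \<comment> \<open>The projection from \<open>Z\<close> to the sum of the \<open>U (ix a)\<close> factors through \<open>X\<close>.\<close>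
  define \<epsilon> where "\<epsilon> z = (\<Sum>a<s. \<iota>' a (e (ix a) (\<pi> a z)))" for z
  have he: "mhom Z (U (ix a)) (\<lambda>z. e (ix a) (\<pi> a z))" if "a < s" for a
    by (rule mhom_comp[OF p0[OF that] mhom_e[OF ixL[OF that]]])
  have eps: "mhom Z W \<epsilon>" unfolding \<epsilon>_def by (rule bp_mhom_to[OF bpW W' he])
  have eps_comp: "\<pi>' a (\<epsilon> z) = e (ix a) (\<pi> a z)" if "a < s" "z \<in> car Z" for a z
    unfolding \<epsilon>_def by (rule bp_proj_sum[OF bpW W' mhom_in[OF he that(2)] that(1)])
  have "\<exists>r. mhom X W r \<and> (\<forall>z\<in>car Z. r (q z) = \<epsilon> z)"
  proof (rule mhom_factor_surj[OF Z' q(1,2) eps])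
    fix z assume z: "z \<in> car Z" "q z = 0"
    then have "z \<in> V" using q(3) by blast
    then obtain p where p: "\<forall>a<s. p a \<in> car (P1 (ix a)) \<and> \<pi> a z = f (ix a) (p a)" using V_comp by blast
    show "\<epsilon> z = 0"
    proof (rule bp_eq_zero[OF bpW W' mhom_in[OF eps z(1)]])
      fix a assume a: "a < s"
      show "\<pi>' a (\<epsilon> z) = 0" unfolding eps_comp[OF a z(1)] using p a e_f[OF ixL[OF a]] by simp
    qed
  qed
  then obtain r where r: "mhom X W r" "\<forall>z\<in>car Z. r (q z) = \<epsilon> z" by blast
  have r_surj: "r ` car X = car W"
  proof (intro subset_antisym subsetI)
    show "w \<in> car W" if "w \<in> r ` car X" for w using that mhom_in[OF r(1)] by blast
    fix w assume w: "w \<in> car W"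
    have "\<exists>u. u \<in> car (P0 (ix a)) \<and> e (ix a) u = \<pi>' a w" if a: "a < s" for a
    proof -
      have "\<pi>' a w \<in> e (ix a) ` car (P0 (ix a))" using mhom_in[OF bp_proj[OF bpW a] w] e_surj[OF ixL[OF a]] by simp
      then show ?thesis by (metis imageE)
    qed
    then obtain u where u: "\<And>a. a < s \<Longrightarrow> u a \<in> car (P0 (ix a)) \<and> e (ix a) (u a) = \<pi>' a w" by metis
    let ?u = "\<lambda>a. if a < s then u a else 0"
    let ?z = "\<Sum>a<Suc s. \<iota> a (?u a)"
    have uin: "?u a \<in> car (?Z a)" if "a < Suc s" for a using u rm_zero[OF S] by simp
    have zin: "?z \<in> car Z" by (rule rm_sum[OF Z']) (use mhom_in[OF bp_inj[OF bp] uin] in blast)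
    have pz: "\<pi> a ?z = u a" if "a < s" for a
      using bp_proj_sum[OF bp Z', of ?u a] uin that by simp
    have "\<epsilon> ?z = (\<Sum>a<s. \<iota>' a (\<pi>' a w))"
      unfolding \<epsilon>_def using u pz by (intro sum.cong refl) (simp del: sum.lessThan_Suc)
    then have "\<epsilon> ?z = w" using bp_sum[OF bpW w] by simp
    then have "r (q ?z) = w" using r(2) zin by simp
    then show "w \<in> r ` car X" using mhom_in[OF q(1) zin] by blast
  qed
  define j where "j x = q (\<iota> s x)" for x
  have j: "mhom (S k) X j" unfolding j_def by (rule mhom_comp[OF iS q(1)])
  have rj: "r (j x) = 0" if x: "x \<in> car (S k)" for x
  proof -
    have z: "\<iota> s x \<in> car Z" using mhom_in[OF iS x] .
    have "\<epsilon> (\<iota> s x) = 0"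
    proof (rule bp_eq_zero[OF bpW W' mhom_in[OF eps z]])
      fix a assume a: "a < s"
      have "\<pi> a (\<iota> s x) = 0" using bp_proj_inj[OF bp, of s a] a x by simp
      then show "\<pi>' a (\<epsilon> (\<iota> s x)) = 0"
        unfolding eps_comp[OF a z] using mhom_0[OF P_right_module(2)[OF ixL[OF a]] mhom_e[OF ixL[OF a]]] by simp
    qed
    then show ?thesis unfolding j_def using r(2) z by simp
  qed
  have ker_r: "x \<in> j ` car (S k)" if x: "x \<in> car X" "r x = 0" for x
  proof -
    obtain z where z: "z \<in> car Z" "x = q z" using x(1) q(2) by blast
    have "\<epsilon> z = 0" using x(2) z r(2) by simp
    have "\<exists>p. p \<in> car (P1 (ix a)) \<and> \<pi> a z = f (ix a) p" if a: "a < s" for a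
    proof -
      have "e (ix a) (\<pi> a z) = \<pi>' a (\<epsilon> z)" using eps_comp[OF a z(1)] by simp
      also have "\<dots> = 0" using \<open>\<epsilon> z = 0\<close> mhom_0[OF W' bp_proj[OF bpW a]] by simp
      finally have "\<pi> a z \<in> f (ix a) ` car (P1 (ix a))"
        using kernel_e[OF ixL[OF a] mhom_in[OF p0[OF a] z(1)]] by blast
      then show ?thesis by blast
    qed
    then obtain p where p: "\<And>a. a < s \<Longrightarrow> p a \<in> car (P1 (ix a)) \<and> \<pi> a z = f (ix a) (p a)" by metis
    let ?v = "\<Sum>a<s. \<delta> a (p a)" and ?x = "\<pi> s z - (\<Sum>a<s. b a (p a))"
    have v: "?v \<in> V" by (rule sm_sum[OF Z' V]) (use dV p in blast)
    then have vZ: "?v \<in> car Z" using submodule_subset[OF V] by blast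
    have bS: "b a (p a) \<in> car (S k)" if "a \<in> {..<s}" for a using mhom_in[OF hb] p that by blast
    have sb: "(\<Sum>a<s. b a (p a)) \<in> car (S k)" by (rule rm_sum[OF S bS])
    have xs: "?x \<in> car (S k)" by (rule rm_diff[OF S mhom_in[OF ps z(1)] sb])
    have reorder: "x - y + w = x + (w - y)" for x y w :: "nat \<Rightarrow> 'k" by (simp add: algebra_simps)
    have "z = (\<Sum>a<Suc s. \<iota> a (\<pi> a z))" using bp_sum[OF bp z(1)] by simp
    also have "\<dots> = (\<Sum>a<s. \<iota> a (\<pi> a z)) + \<iota> s (\<pi> s z)" by simp
    also have "(\<Sum>a<s. \<iota> a (\<pi> a z)) = (\<Sum>a<s. \<delta> a (p a) - \<iota> s (b a (p a)))"
      using p by (intro sum.cong) (auto simp: \<delta>_def)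
    also have "\<dots> = ?v - \<iota> s (\<Sum>a<s. b a (p a))"
      using mhom_sum[OF S iS, of "{..<s}" "\<lambda>a. b a (p a)"] bS by (simp add: sum_subtractf)
    also have "?v - \<iota> s (\<Sum>a<s. b a (p a)) + \<iota> s (\<pi> s z) = ?v + (\<iota> s (\<pi> s z) - \<iota> s (\<Sum>a<s. b a (p a)))"
      by (rule reorder)
    also have "\<dots> = ?v + \<iota> s ?x" unfolding mhom_diff[OF S iS mhom_in[OF ps z(1)] sb] ..
    finally have "z = ?v + \<iota> s ?x" .
    then have "q z = q ?v + q (\<iota> s ?x)" using mhom_add[OF q(1) vZ mhom_in[OF iS xs]] by simp
    moreover have "q ?v = 0" using q(3) v vZ by blast
    ultimately have "x = j ?x" unfolding j_def using z(2) by simp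
    then show ?thesis using xs by blast
  qed
  \<comment> \<open>The maps \<open>b a\<close> vanish on the kernel of \<open>f (ix a)\<close>, since this kernel is superfluous and \<open>S k\<close> simple.\<close>
  have b_ker: "b a p = 0" if a: "a < s" and p: "p \<in> car (P1 (ix a))" "f (ix a) p = 0" for a p
  proof (rule ccontr)
    assume nz: "b a p \<noteq> 0"
    note c1 = mpp_cover1[OF presentation[OF ixL[OF a]]] and P1' = P_right_module(1)[OF ixL[OF a]]
    note sup = pc_superfluous[OF c1]
    let ?Kf = "mker (P1 (ix a)) (f (ix a))"
    have sK: "submodule ?Kf (P1 (ix a))" by (rule submodule_mker[OF P1' P_right_module(2)[OF ixL[OF a]] mhom_f[OF ixL[OF a]]])
    have KS: "submodule (b a ` ?Kf) (S k)" by (rule submodule_image[OF P1' S hb[OF a] sK])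
    have "b a p \<in> b a ` ?Kf" using p unfolding mker_def by blast
    then have img: "b a ` ?Kf = car (S k)" using simple_submodule[OF S_simple[OF k] KS] nz by blast
    let ?B = "mker (P1 (ix a)) (b a)"
    have sB: "submodule ?B (P1 (ix a))" by (rule submodule_mker[OF P1' S hb[OF a]])
    have "set_sum ?Kf ?B = car (P1 (ix a))"
    proof
      show "set_sum ?Kf ?B \<subseteq> car (P1 (ix a))" by (rule submodule_subset[OF submodule_set_sum[OF P1' sK sB]])
      show "car (P1 (ix a)) \<subseteq> set_sum ?Kf ?B"
      proof
        fix x assume x: "x \<in> car (P1 (ix a))"
        have "b a x \<in> b a ` ?Kf" using img mhom_in[OF hb[OF a] x] by simp
        then obtain y where y: "y \<in> ?Kf" "b a x = b a y" by blast
        have yP: "y \<in> car (P1 (ix a))" using y(1) unfolding mker_def by blast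
        have "x - y \<in> ?B"
          unfolding mker_def using rm_diff[OF P1' x yP] mhom_diff[OF P1' hb[OF a] x yP] y(2) by simp
        moreover have "x = y + (x - y)" by simp
        ultimately show "x \<in> set_sum ?Kf ?B" unfolding set_sum_def using y(1) by blast
      qed
    qed
    then have "?B = car (P1 (ix a))" by (rule superfluousD[OF sup sB])
    then show False using p(1) nz unfolding mker_def by blast
  qed
  have j_inj: "inj_on j (car (S k))"
  proof (rule mhom_inj_on[OF S j])
    fix x assume x: "x \<in> car (S k)" "j x = 0"
    have z: "\<iota> s x \<in> car Z" using mhom_in[OF iS x(1)] .
    then have "\<iota> s x \<in> V" using x(2) q(3) unfolding j_def by blast
    then obtain p where p: "\<forall>a<s. p a \<in> car (P1 (ix a)) \<and> \<pi> a (\<iota> s x) = f (ix a) (p a)"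
      and s: "\<pi> s (\<iota> s x) = (\<Sum>a<s. b a (p a))" using V_comp by blast
    have "b a (p a) = 0" if a: "a < s" for a
    proof (rule b_ker[OF a])
      show "p a \<in> car (P1 (ix a))" using p a by blast
      have "\<pi> a (\<iota> s x) = 0" using bp_proj_inj[OF bp, of s a] a x(1) by simp
      then show "f (ix a) (p a) = 0" using p a by simp
    qed
    moreover have "\<pi> s (\<iota> s x) = x" using bp_proj_inj[OF bp, of s s] x(1) by simp
    ultimately show "x = 0" using s by simp
  qed
  have jS: "submodule (j ` car (S k)) X" by (rule submodule_range[OF S X' j])
  have inv: "\<exists>\<beta>. mhom R (S k) \<beta> \<and> (\<forall>x\<in>car R. j (\<beta> x) = h x)"
    if h: "mhom R X h" and hr: "\<And>x. x \<in> car R \<Longrightarrow> r (h x) = 0" for R :: "('k, 'a) umod" and h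
  proof -
    have hj: "h x \<in> j ` car (S k)" if "x \<in> car R" for x using ker_r[OF mhom_in[OF h that] hr[OF that]] .
    have "mhom (S k) (submod X (j ` car (S k))) j" by (rule mhom_to_submod[OF j]) blast
    moreover have "bij_betw j (car (S k)) (car (submod X (j ` car (S k))))" using j_inj by (simp add: bij_betw_def)
    ultimately obtain g where g: "mhom (submod X (j ` car (S k))) (S k) g"
      "\<forall>y\<in>car (submod X (j ` car (S k))). j (g y) = y"
      using mhom_inverse[OF S] by blast
    have "mhom R (S k) (\<lambda>x. g (h x))" by (rule mhom_comp[OF mhom_to_submod[OF h hj] g(1)])
    moreover have "\<forall>x\<in>car R. j (g (h x)) = h x"
    proof
      fix x assume "x \<in> car R"
      then have "h x \<in> car (submod X (j ` car (S k)))" using hj by simp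
      then show "j (g (h x)) = h x" using g(2) by blast
    qed
    ultimately show ?thesis by blast
  qed
  have TX: "torsion X"
  proof (rule torsionI)
    show "fg_module X" by (fact X)
  next
    fix q' h x assume q': "q' \<in> K" and h: "mhom (Q q') X h" and x: "x \<in> car (Q q')"
    have "r (h y) = 0" if "y \<in> car (Q q')" for y using torsion_hom_zero[OF TW q' mhom_comp[OF h r(1)] that] .
    then obtain \<beta> where beta: "mhom (Q q') (S k) \<beta>" "\<forall>x\<in>car (Q q'). j (\<beta> x) = h x" using inv[OF h] by blast
    have "\<beta> x = 0" using QS[OF q'] beta(1) x unfolding hom_zero_def by blast
    then show "h x = 0" using beta(2) x mhom_0[OF S j] by metis
  next
    fix l \<phi> assume l: "l \<in> L" and phi: "mhom (P1 l) X \<phi>"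
    \<comment> \<open>Correct \<open>\<phi>\<close> by an extendable map so that it takes values in \<open>S k\<close>, where it is a combination of
      the \<open>b a\<close>.\<close>
    obtain \<rho> where rho: "mhom (P0 l) W \<rho>" "\<forall>p\<in>car (P1 l). \<rho> (f l p) = r (\<phi> p)"
      using torsion_extends[OF TW l mhom_comp[OF phi r(1)]] by blast
    have "\<exists>\<rho>'. mhom (P0 l) X \<rho>' \<and> (\<forall>p\<in>car (P0 l). r (\<rho>' p) = \<rho> p)"
      by (rule projective_lift[OF P0_projective[OF l] X W' r(1) rho(1)])
        (use mhom_in[OF rho(1)] r_surj in simp)
    then obtain \<rho>' where rho': "mhom (P0 l) X \<rho>'" "\<forall>p\<in>car (P0 l). r (\<rho>' p) = \<rho> p" by blast
    have fP: "f l p \<in> car (P0 l)" if "p \<in> car (P1 l)" for p using mhom_in[OF mhom_f[OF l] that] .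
    have diff: "mhom (P1 l) X (\<lambda>p. \<phi> p - \<rho>' (f l p))"
      by (rule mhom_fun_diff[OF X' phi mhom_comp[OF mhom_f[OF l] rho'(1)]])
    have rz: "r (\<phi> p - \<rho>' (f l p)) = 0" if p: "p \<in> car (P1 l)" for p
      using mhom_diff[OF X' r(1) mhom_in[OF phi p] mhom_in[OF rho'(1) fP[OF p]]] rho(2) rho'(2) fP[OF p] p by simp
    obtain \<beta> where beta: "mhom (P1 l) (S k) \<beta>" "\<forall>p\<in>car (P1 l). j (\<beta> p) = \<phi> p - \<rho>' (f l p)"
      using inv[OF diff rz] by blast
    let ?A = "{a. a < s \<and> ix a = l}"
    obtain c where c: "\<forall>p\<in>car (P1 l). \<beta> p = (\<Sum>a\<in>?A. smul (S k) (c a) (b a p))" using sp l beta(1) by blast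
    let ?\<theta> = "\<lambda>x. \<Sum>a\<in>?A. smul X (c a) (- q (\<iota> a x))"
    have th_in: "mhom (P0 l) X (\<lambda>x. smul X (c a) (- q (\<iota> a x)))" if "a \<in> ?A" for a
      using mhom_fun_smul[OF X' mhom_fun_neg[OF X' mhom_comp[OF i0[of a] q(1)]]] that by auto
    have th: "mhom (P0 l) X ?\<theta>" by (rule mhom_fun_sum[OF X' th_in])
    have "?\<theta> (f l p) = j (\<beta> p)" if p: "p \<in> car (P1 l)" for p
    proof -
      have jb: "j (smul (S k) (c a) (b a p)) = smul X (c a) (- q (\<iota> a (f l p)))"
        and inS: "smul (S k) (c a) (b a p) \<in> car (S k)" if "a \<in> ?A" for a
      proof -
        have a: "a < s" "ix a = l" using that by auto
        have bp': "b a p \<in> car (S k)" using mhom_in[OF hb[OF a(1)]] p a(2) by simp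
        then show "smul (S k) (c a) (b a p) \<in> car (S k)" by (rule rm_smul[OF S])
        have "\<delta> a p \<in> V" using dV[OF a(1)] p a(2) by simp
        moreover have "\<delta> a p \<in> car Z" using calculation submodule_subset[OF V] by blast
        ultimately have "q (\<delta> a p) = 0" using q(3) by blast
        moreover have "q (\<delta> a p) = q (\<iota> a (f l p)) + q (\<iota> s (b a p))"
          unfolding \<delta>_def a(2)
          by (rule mhom_add[OF q(1) mhom_in[OF i0[OF a(1)]] mhom_in[OF iS bp']]) (use fP[OF p] a(2) in simp)
        ultimately have "j (b a p) = - q (\<iota> a (f l p))" unfolding j_def by (simp add: add_eq_0_iff)
        then show "j (smul (S k) (c a) (b a p)) = smul X (c a) (- q (\<iota> a (f l p)))"
          using mhom_smul[OF j bp'] by simp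
      qed
      have "j (\<Sum>a\<in>?A. smul (S k) (c a) (b a p)) = (\<Sum>a\<in>?A. j (smul (S k) (c a) (b a p)))"
        by (rule mhom_sum[OF S j inS])
      then have "j (\<beta> p) = (\<Sum>a\<in>?A. j (smul (S k) (c a) (b a p)))" using bspec[OF c p] by simp
      also have "\<dots> = ?\<theta> (f l p)" using jb by (intro sum.cong) auto
      finally show ?thesis by simp
    qed
    then have "\<rho>' (f l p) + ?\<theta> (f l p) = \<phi> p" if "p \<in> car (P1 l)" for p using beta(2) that by simp
    then show "\<exists>\<theta>. mhom (P0 l) X \<theta> \<and> (\<forall>p\<in>car (P1 l). \<theta> (f l p) = \<phi> p)"
      using mhom_fun_add[OF X' rho'(1) th] by blast
  qed
  show ?thesis using TX TW j j_inj r(1) rj ker_r r_surj by (intro exI[of _ X] exI[of _ W] exI[of _ j] exI[of _ r]) auto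
qed

end

section \<open>Generation of the torsion class and spanning of the g-vectors\<close>

text \<open>The case in which no nonzero module of the torsion class is orthogonal to the \<open>U l\<close>. It does occur
  when the pair is support tau-tilting; the purpose here is to show that then the g-vectors span.\<close>

locale rigid_family_generating = rigid_family scale n S PP top L U P1 P0 f e K Q
  for scale :: "'k::field \<Rightarrow> 'a::{ring,monoid_mult} \<Rightarrow> 'a" and n S PP top L U P1 P0 f e K Q +
  assumes no_orthogonal: "torsion X \<Longrightarrow> (\<And>l. l \<in> L \<Longrightarrow> hom_zero (U l) X) \<Longrightarrow> car X = {0}"
begin

text \<open>Let \<open>p\<close> be a right approximation of \<open>X\<close> by a sum of modules \<open>U l\<close>, and \<open>Y\<close> its cokernel. A map
  \<open>U l \<rightarrow> Y\<close> lifts to \<open>X\<close>: lift it from \<open>P0 l\<close> to \<open>X\<close>; on \<open>P1 l\<close> the lift takes values in the image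
  of \<open>p\<close>, and there it extends along \<open>f l\<close>, so that subtracting the extension makes the lift descend
  to \<open>U l\<close>. As all maps \<open>U l \<rightarrow> X\<close> factor through \<open>p\<close>, the given map is zero, so \<open>Y = 0\<close>. That the
  kernel of \<open>p\<close> lies in the torsion class follows in the same way: an extension with values in \<open>W\<close> is
  corrected by a map that factors through \<open>U l\<close>.\<close>

lemma torsion_generated:
  fixes X :: "('k, 'a) umod"
  assumes X: "torsion X"
  shows "\<exists>W m ix \<iota> \<pi> p. add_U W m ix \<iota> \<pi> \<and> mhom W X p \<and> p ` car W = car X \<and> torsion (submod W (mker W p)) \<and>
    (\<forall>l\<in>L. \<forall>\<phi>. mhom (U l) X \<phi> \<longrightarrow> (\<exists>\<psi>. mhom (U l) W \<psi> \<and> (\<forall>x\<in>car (U l). p (\<psi> x) = \<phi> x)))"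
proof -
  note fgX = torsion_fg[OF X] and X' = torsion_right_module[OF X]
  obtain W m ix \<iota> \<pi> p where W: "add_U W m ix \<iota> \<pi>" and p: "mhom W X p"
    and app: "\<forall>l\<in>L. \<forall>\<phi>. mhom (U l) X \<phi> \<longrightarrow> (\<exists>\<psi>. mhom (U l) W \<psi> \<and> (\<forall>x\<in>car (U l). p (\<psi> x) = \<phi> x))"
    using right_approximation[OF fgX] by blast
  have TW: "torsion W" by (rule torsion_add_U[OF W])
  note fgW = torsion_fg[OF TW] and W' = torsion_right_module[OF TW]
  have sub: "submodule (p ` car W) X" by (rule submodule_range[OF W' X' p])
  obtain Y :: "('k, 'a) umod" and q where Y: "fg_module Y" and q: "mhom X Y q" "q ` car X = car Y"
    "\<forall>x\<in>car X. q x = 0 \<longleftrightarrow> x \<in> p ` car W" using exists_quotient[OF fgX sub] by blast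
  note Y' = fg_right_module[OF Y]
  have "car Y = {0}"
  proof (rule no_orthogonal)
    show "torsion Y" by (rule torsion_quotient[OF X Y' q(1,2)])
    fix l assume l: "l \<in> L"
    show "hom_zero (U l) Y"
      unfolding hom_zero_def
    proof (intro allI impI ballI)
      fix \<phi> u assume phi: "mhom (U l) Y \<phi>" and u: "u \<in> car (U l)"
      have phie: "mhom (P0 l) Y (\<lambda>x. \<phi> (e l x))" by (rule mhom_comp[OF mhom_e[OF l] phi])
      have "\<exists>k. mhom (P0 l) X k \<and> (\<forall>x\<in>car (P0 l). q (k x) = \<phi> (e l x))"
        by (rule projective_lift[OF P0_projective[OF l] fgX Y' q(1) phie])
          (use mhom_in[OF phie] q(2) in simp)
      then obtain lm where lam: "mhom (P0 l) X lm" "\<forall>x\<in>car (P0 l). q (lm x) = \<phi> (e l x)" by blast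
      have lf: "mhom (P1 l) X (\<lambda>x. lm (f l x))" by (rule mhom_comp[OF mhom_f[OF l] lam(1)])
      have "\<exists>\<kappa>. mhom (P1 l) W \<kappa> \<and> (\<forall>x\<in>car (P1 l). p (\<kappa> x) = lm (f l x))"
      proof (rule projective_lift[OF P1_projective[OF l] fgW X' p lf])
        fix x assume x: "x \<in> car (P1 l)"
        have "q (lm (f l x)) = \<phi> 0" using lam(2) mhom_in[OF mhom_f[OF l] x] e_f[OF l x] by simp
        then have "q (lm (f l x)) = 0" using mhom_0[OF fg_right_module[OF U_fg[OF l]] phi] by simp
        then show "lm (f l x) \<in> p ` car W" using q(3) mhom_in[OF lf x] by blast
      qed
      then obtain \<kappa> where kap: "mhom (P1 l) W \<kappa>" "\<forall>x\<in>car (P1 l). p (\<kappa> x) = lm (f l x)" by blast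
      obtain \<rho> where rho: "mhom (P0 l) W \<rho>" "\<forall>x\<in>car (P1 l). \<rho> (f l x) = \<kappa> x"
        using torsion_extends[OF TW l kap(1)] by blast
      have d: "mhom (P0 l) X (\<lambda>x. lm x - p (\<rho> x))"
        by (rule mhom_fun_diff[OF X' lam(1) mhom_comp[OF rho(1) p]])
      have "\<exists>k. mhom (U l) X k \<and> (\<forall>x\<in>car (P0 l). k (e l x) = lm x - p (\<rho> x))"
        by (rule descend_to_U[OF l d]) (use rho(2) kap(2) in simp)
      then obtain \<mu> where mu: "mhom (U l) X \<mu>" "\<forall>x\<in>car (P0 l). \<mu> (e l x) = lm x - p (\<rho> x)" by blast
      obtain \<psi> where psi: "mhom (U l) W \<psi>" "\<forall>x\<in>car (U l). p (\<psi> x) = \<mu> x" using app l mu(1) by blast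
      have "u \<in> e l ` car (P0 l)" using u e_surj[OF l] by simp
      then obtain x where x: "x \<in> car (P0 l)" "u = e l x" by blast
      have ex: "e l x \<in> car (U l)" using mhom_in[OF mhom_e[OF l] x(1)] .
      have "lm x = p (\<psi> (e l x)) + p (\<rho> x)" using mu(2) psi(2) ex x(1) by simp
      also have "\<dots> = p (\<psi> (e l x) + \<rho> x)"
        using mhom_add[OF p mhom_in[OF psi(1) ex] mhom_in[OF rho(1) x(1)]] by simp
      finally have "lm x \<in> p ` car W" using rm_add[OF W' mhom_in[OF psi(1) ex] mhom_in[OF rho(1) x(1)]] by blast
      then have "q (lm x) = 0" using q(3) mhom_in[OF lam(1) x(1)] by blast
      then show "\<phi> u = 0" using lam(2) x by simp
    qed
  qed
  then have surj: "p ` car W = car X" using q mhom_in[OF p] mhom_in[OF q(1)] by blast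
  have "torsion (submod W (mker W p))"
  proof (rule torsionI)
    have sK: "submodule (mker W p) W" by (rule submodule_mker[OF W' X' p])
    note incl = mhom_incl[OF submodule_subset[OF sK]]
    show "fg_module (submod W (mker W p))" by (rule fg_submod[OF fgW sK])
    show "h x = 0" if "q \<in> K" "mhom (Q q) (submod W (mker W p)) h" "x \<in> car (Q q)" for q h x
      using torsion_hom_zero[OF TW that(1) mhom_comp[OF that(2) incl] that(3)] .
    fix l \<phi> assume l: "l \<in> L" and phi: "mhom (P1 l) (submod W (mker W p)) \<phi>"
    have pphi: "p (\<phi> x) = 0" if "x \<in> car (P1 l)" for x using mhom_in[OF phi that] unfolding mker_def by simp
    obtain \<rho> where rho: "mhom (P0 l) W \<rho>" "\<forall>x\<in>car (P1 l). \<rho> (f l x) = \<phi> x"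
      using torsion_extends[OF TW l mhom_comp[OF phi incl]] by blast
    have "\<exists>k. mhom (U l) X k \<and> (\<forall>x\<in>car (P0 l). k (e l x) = p (\<rho> x))"
      by (rule descend_to_U[OF l mhom_comp[OF rho(1) p]]) (use rho(2) pphi in simp)
    then obtain \<mu> where mu: "mhom (U l) X \<mu>" "\<forall>x\<in>car (P0 l). \<mu> (e l x) = p (\<rho> x)" by blast
    obtain \<psi> where psi: "mhom (U l) W \<psi>" "\<forall>x\<in>car (U l). p (\<psi> x) = \<mu> x" using app l mu(1) by blast
    have ex: "e l x \<in> car (U l)" if "x \<in> car (P0 l)" for x using mhom_in[OF mhom_e[OF l] that] .
    have "mhom (P0 l) (submod W (mker W p)) (\<lambda>x. \<rho> x - \<psi> (e l x))"
    proof (rule mhom_to_submod[OF mhom_fun_diff[OF W' rho(1) mhom_comp[OF mhom_e[OF l] psi(1)]]])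
      fix x assume x: "x \<in> car (P0 l)"
      show "\<rho> x - \<psi> (e l x) \<in> mker W p"
        unfolding mker_def
        using rm_diff[OF W' mhom_in[OF rho(1) x] mhom_in[OF psi(1) ex[OF x]]]
          mhom_diff[OF W' p mhom_in[OF rho(1) x] mhom_in[OF psi(1) ex[OF x]]] psi(2) ex[OF x] mu(2) x by simp
    qed
    moreover have "\<rho> (f l x) - \<psi> (e l (f l x)) = \<phi> x" if x: "x \<in> car (P1 l)" for x
      using rho(2) x e_f[OF l x] mhom_0[OF fg_right_module[OF U_fg[OF l]] psi(1)] by simp
    ultimately show "\<exists>\<theta>. mhom (P0 l) (submod W (mker W p)) \<theta> \<and> (\<forall>x\<in>car (P1 l). \<theta> (f l x) = \<phi> x)" by blast
  qed
  then show ?thesis using W p app surj by blast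
qed

lemma hdim_add_U:
  assumes W: "add_U W m ix \<iota> \<pi>"
  shows "\<exists>\<nu> :: nat \<Rightarrow> nat. \<forall>X :: ('k, 'a) umod. fg_module X \<longrightarrow> hdim W X = (\<Sum>l\<in>L. \<nu> l * hdim (U l) X)"
proof (intro exI allI impI)
  fix X :: "('k, 'a) umod" assume X: "fg_module X"
  have fgW: "fg_module W" and ix: "\<forall>a<m. ix a \<in> L" and bp: "biproduct W m (\<lambda>a. U (ix a)) \<iota> \<pi>"
    using W unfolding add_U_def by blast+
  have "hdim W X = (\<Sum>a<m. hdim (U (ix a)) X)" by (rule hdim_biproduct[OF bp fgW X])
  also have "\<dots> = (\<Sum>l\<in>L. \<Sum>a\<in>{a\<in>{..<m}. ix a = l}. hdim (U (ix a)) X)"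
    using ix finite_L by (intro sum.group[symmetric]) auto
  also have "\<dots> = (\<Sum>l\<in>L. card {a\<in>{..<m}. ix a = l} * hdim (U l) X)"
  proof (intro sum.cong refl)
    fix l
    have "(\<Sum>a\<in>{a\<in>{..<m}. ix a = l}. hdim (U (ix a)) X) = (\<Sum>a\<in>{a\<in>{..<m}. ix a = l}. hdim (U l) X)"
      by (intro sum.cong) auto
    then show "(\<Sum>a\<in>{a\<in>{..<m}. ix a = l}. hdim (U (ix a)) X) = card {a\<in>{..<m}. ix a = l} * hdim (U l) X" by simp
  qed
  finally show "hdim W X = (\<Sum>l\<in>L. card {a\<in>{..<m}. ix a = l} * hdim (U l) X)" .
qed

text \<open>For \<open>X\<close> in the torsion class the sequence \<open>0 \<rightarrow> Hom(C, X) \<rightarrow> Hom(W, X) \<rightarrow> Hom(PP i, X) \<rightarrow> 0\<close> is exact,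
  where \<open>PP i \<rightarrow> W\<close> is a left approximation and \<open>C\<close> its cokernel; it is onto at the right because \<open>X\<close> is
  generated by the \<open>U l\<close>. Both \<open>W\<close> and \<open>C\<close> are sums of modules \<open>U l\<close>.\<close>

lemma hdim_PP_on_torsion:
  assumes i: "i < n"
  shows "\<exists>\<nu> :: nat \<Rightarrow> int. \<forall>X. torsion X \<longrightarrow> int (hdim (PP i) X) = (\<Sum>l\<in>L. \<nu> l * int (hdim (U l) X))"
proof -
  let ?R = "PP i"
  note R = PP_fg[OF i] and R' = PP_right_module[OF i] and prR = pc_projective[OF cover[OF i]]
  obtain W m ix \<iota> \<pi> r where W: "add_U W m ix \<iota> \<pi>" and r: "mhom ?R W r"
    and app: "\<forall>l\<in>L. \<forall>\<phi>. mhom ?R (U l) \<phi> \<longrightarrow> (\<exists>\<psi>. mhom W (U l) \<psi> \<and> (\<forall>x\<in>car ?R. \<psi> (r x) = \<phi> x))"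
    using left_approximation[OF R] by blast
  have TW: "torsion W" by (rule torsion_add_U[OF W])
  note fgW = torsion_fg[OF TW] and W' = torsion_right_module[OF TW]
  have ixL: "ix a \<in> L" if "a < m" for a using W that unfolding add_U_def by blast
  have bpW: "biproduct W m (\<lambda>a. U (ix a)) \<iota> \<pi>" using W unfolding add_U_def by blast
  have ext_torsion: "\<exists>\<psi>. mhom W X \<psi> \<and> (\<forall>x\<in>car ?R. \<psi> (r x) = \<phi> x)"
    if X: "torsion X" and phi: "mhom ?R X \<phi>" for X \<phi>
  proof -
    obtain W1 m1 ix1 \<iota>1 \<pi>1 p where W1: "add_U W1 m1 ix1 \<iota>1 \<pi>1" and p: "mhom W1 X p" "p ` car W1 = car X"
      using torsion_generated[OF X] by blast
    note fgW1 = torsion_fg[OF torsion_add_U[OF W1]]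
    note W1' = fg_right_module[OF fgW1]
    have bp1: "biproduct W1 m1 (\<lambda>a. U (ix1 a)) \<iota>1 \<pi>1" and ix1: "\<forall>a<m1. ix1 a \<in> L"
      using W1 unfolding add_U_def by blast+
    have "\<exists>k. mhom ?R W1 k \<and> (\<forall>x\<in>car ?R. p (k x) = \<phi> x)"
      by (rule projective_lift[OF prR fgW1 torsion_right_module[OF X] p(1) phi])
        (use mhom_in[OF phi] p(2) in simp)
    then obtain k where k: "mhom ?R W1 k" "\<forall>x\<in>car ?R. p (k x) = \<phi> x" by blast
    have "\<forall>a\<in>{..<m1}. \<exists>\<psi>. mhom W (U (ix1 a)) \<psi> \<and> (\<forall>x\<in>car ?R. \<psi> (r x) = \<pi>1 a (k x))"
      using app ix1 mhom_comp[OF k(1) bp_proj[OF bp1]] by simp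
    from bchoice[OF this] obtain \<psi> where
      psi: "\<forall>a\<in>{..<m1}. mhom W (U (ix1 a)) (\<psi> a) \<and> (\<forall>x\<in>car ?R. \<psi> a (r x) = \<pi>1 a (k x))" by blast
    have h: "mhom W W1 (\<lambda>w. \<Sum>a<m1. \<iota>1 a (\<psi> a w))" by (rule bp_mhom_to[OF bp1 W1']) (use psi in blast)
    have "p (\<Sum>a<m1. \<iota>1 a (\<psi> a (r x))) = \<phi> x" if x: "x \<in> car ?R" for x
    proof -
      have "(\<Sum>a<m1. \<iota>1 a (\<psi> a (r x))) = (\<Sum>a<m1. \<iota>1 a (\<pi>1 a (k x)))"
        using psi x by (intro sum.cong) auto
      then show ?thesis using bp_sum[OF bp1 mhom_in[OF k(1) x]] k(2) x by simp
    qed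
    then show ?thesis using mhom_comp[OF h p(1)] by blast
  qed
  have sub: "submodule (r ` car ?R) W" by (rule submodule_range[OF R' W' r])
  obtain C :: "('k, 'a) umod" and c where C: "fg_module C" and c: "mhom W C c" "c ` car W = car C"
    "\<forall>w\<in>car W. c w = 0 \<longleftrightarrow> w \<in> r ` car ?R" using exists_quotient[OF fgW sub] by blast
  note C' = fg_right_module[OF C]
  have TC: "torsion C" by (rule torsion_quotient[OF TW C' c(1,2)])
  obtain W2 m2 ix2 \<iota>2 \<pi>2 p where W2: "add_U W2 m2 ix2 \<iota>2 \<pi>2" and p: "mhom W2 C p"
    and TK: "torsion (submod W2 (mker W2 p))"
    and app2: "\<forall>l\<in>L. \<forall>\<phi>. mhom (U l) C \<phi> \<longrightarrow> (\<exists>\<psi>. mhom (U l) W2 \<psi> \<and> (\<forall>x\<in>car (U l). p (\<psi> x) = \<phi> x))"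
    using torsion_generated[OF TC] by blast
  note fgW2 = torsion_fg[OF torsion_add_U[OF W2]]
  note W2' = fg_right_module[OF fgW2]
  have bp2: "biproduct W2 m2 (\<lambda>a. U (ix2 a)) \<iota>2 \<pi>2" and ix2: "\<forall>a<m2. ix2 a \<in> L"
    using W2 unfolding add_U_def by blast+
  \<comment> \<open>The cokernel \<open>C\<close> is a direct summand of \<open>W2\<close>: \<open>c\<close> lifts to \<open>W2\<close>, and the lift can be corrected to
    vanish on the image of \<open>r\<close>.\<close>
  have "\<forall>a\<in>{..<m}. \<exists>\<psi>. mhom (U (ix a)) W2 \<psi> \<and> (\<forall>x\<in>car (U (ix a)). p (\<psi> x) = c (\<iota> a x))"
    using app2 ixL mhom_comp[OF bp_inj[OF bpW] c(1)] by simp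
  from bchoice[OF this] obtain \<psi> where
    psi: "\<forall>a\<in>{..<m}. mhom (U (ix a)) W2 (\<psi> a) \<and> (\<forall>x\<in>car (U (ix a)). p (\<psi> a x) = c (\<iota> a x))" by blast
  define \<Lambda> where "\<Lambda> w = (\<Sum>a<m. \<psi> a (\<pi> a w))" for w
  have Lam: "mhom W W2 \<Lambda>" unfolding \<Lambda>_def by (rule bp_mhom_from[OF bpW W2']) (use psi in blast)
  have pLam: "p (\<Lambda> w) = c w" if w: "w \<in> car W" for w
  proof -
    have pw: "\<pi> a w \<in> car (U (ix a))" if "a < m" for a using mhom_in[OF bp_proj[OF bpW that] w] .
    have "p (\<Lambda> w) = (\<Sum>a<m. p (\<psi> a (\<pi> a w)))"
      unfolding \<Lambda>_def by (rule mhom_sum[OF W2' p]) (use psi pw mhom_in in blast)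
    also have "\<dots> = (\<Sum>a<m. c (\<iota> a (\<pi> a w)))" using psi pw by (intro sum.cong) auto
    also have "\<dots> = c (\<Sum>a<m. \<iota> a (\<pi> a w))"
      by (rule mhom_sum[OF W' c(1), symmetric]) (use pw mhom_in[OF bp_inj[OF bpW]] in auto)
    finally show ?thesis using bp_sum[OF bpW w] by simp
  qed
  have sK: "submodule (mker W2 p) W2" by (rule submodule_mker[OF W2' C' p])
  have "mhom ?R (submod W2 (mker W2 p)) (\<lambda>x. \<Lambda> (r x))"
  proof (rule mhom_to_submod[OF mhom_comp[OF r Lam]])
    fix x assume x: "x \<in> car ?R"
    have "c (r x) = 0" using c(3) mhom_in[OF r x] x by blast
    then show "\<Lambda> (r x) \<in> mker W2 p"
      unfolding mker_def using pLam[OF mhom_in[OF r x]] mhom_in[OF Lam mhom_in[OF r x]] by simp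
  qed
  then obtain \<nu> where nu: "mhom W (submod W2 (mker W2 p)) \<nu>" "\<forall>x\<in>car ?R. \<nu> (r x) = \<Lambda> (r x)"
    using ext_torsion[OF TK] by blast
  have nuW2: "mhom W W2 \<nu>" by (rule mhom_comp[OF nu(1) mhom_incl[OF submodule_subset[OF sK]]])
  have pnu: "p (\<nu> w) = 0" if "w \<in> car W" for w using mhom_in[OF nu(1) that] unfolding mker_def by simp
  have d: "mhom W W2 (\<lambda>w. \<Lambda> w - \<nu> w)" by (rule mhom_fun_diff[OF W2' Lam nuW2])
  have "\<exists>\<sigma>. mhom C W2 \<sigma> \<and> (\<forall>w\<in>car W. \<sigma> (c w) = \<Lambda> w - \<nu> w)"
  proof (rule mhom_factor_surj[OF W' c(1,2) d])
    fix w assume "w \<in> car W" "c w = 0"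
    then have "w \<in> r ` car ?R" using c(3) by blast
    then obtain x where "x \<in> car ?R" "w = r x" by blast
    then show "\<Lambda> w - \<nu> w = 0" using nu(2) by simp
  qed
  then obtain \<sigma> where sig: "mhom C W2 \<sigma>" "\<forall>w\<in>car W. \<sigma> (c w) = \<Lambda> w - \<nu> w" by blast
  have psig: "p (\<sigma> x) = x" if x: "x \<in> car C" for x
  proof -
    have "x \<in> c ` car W" using x c(2) by simp
    then obtain w where w: "w \<in> car W" "x = c w" by blast
    have "p (\<sigma> x) = p (\<Lambda> w) - p (\<nu> w)"
      using sig(2) w mhom_diff[OF W2' p mhom_in[OF Lam w(1)] mhom_in[OF nuW2 w(1)]] by simp
    then show ?thesis using pLam[OF w(1)] pnu[OF w(1)] w(2) by simp
  qed
  have "\<exists>\<mu> :: nat \<Rightarrow> nat. \<forall>X :: ('k, 'a) umod. fg_module X \<longrightarrow> hdim C X = (\<Sum>l\<in>L. \<mu> l * hdim (U l) X)"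
  proof (rule hdim_of_summand[where m = m2 and ix = ix2 and i = "\<lambda>a x. \<pi>2 a (\<sigma> x)" and p = "\<lambda>a x. p (\<iota>2 a x)", OF finite_L _ C])
    show "fg_module (U l) \<and> indecomposable (U l)" if "l \<in> L" for l using U_fg U_indecomposable that by blast
    show "ix2 a \<in> L \<and> mhom C (U (ix2 a)) (\<lambda>x. \<pi>2 a (\<sigma> x)) \<and> mhom (U (ix2 a)) C (\<lambda>x. p (\<iota>2 a x))" if "a < m2" for a
      using ix2 that mhom_comp[OF sig(1) bp_proj[OF bp2 that]] mhom_comp[OF bp_inj[OF bp2 that] p] by blast
    fix x assume x: "x \<in> car C"
    have s: "\<sigma> x \<in> car W2" using mhom_in[OF sig(1) x] .
    have "x = p (\<Sum>a<m2. \<iota>2 a (\<pi>2 a (\<sigma> x)))" using bp_sum[OF bp2 s] psig[OF x] by simp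
    also have "\<dots> = (\<Sum>a<m2. p (\<iota>2 a (\<pi>2 a (\<sigma> x))))"
      by (rule mhom_sum[OF W2' p]) (use mhom_in[OF bp_inj[OF bp2]] mhom_in[OF bp_proj[OF bp2] s] in auto)
    finally show "x = (\<Sum>a<m2. p (\<iota>2 a (\<pi>2 a (\<sigma> x))))" .
  qed
  then obtain \<mu> :: "nat \<Rightarrow> nat" where mu: "\<forall>X :: ('k, 'a) umod. fg_module X \<longrightarrow> hdim C X = (\<Sum>l\<in>L. \<mu> l * hdim (U l) X)" by blast
  obtain \<nu>' :: "nat \<Rightarrow> nat" where nu': "\<forall>X :: ('k, 'a) umod. fg_module X \<longrightarrow> hdim W X = (\<Sum>l\<in>L. \<nu>' l * hdim (U l) X)"
    using hdim_add_U[OF W] by blast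
  have "int (hdim ?R X) = (\<Sum>l\<in>L. (int (\<nu>' l) - int (\<mu> l)) * int (hdim (U l) X))" if X: "torsion X" for X
  proof -
    note fgX = torsion_fg[OF X]
    have "hdim W X = hdim ?R X + hdim C X"
      by (rule hdim_exact_contravariant[OF R fgW C fgX r c(1,2) _ ext_torsion[OF X]]) (use c(3) in blast)
    then have "int (hdim ?R X) = int (hdim W X) - int (hdim C X)" by simp
    also have "\<dots> = (\<Sum>l\<in>L. int (\<nu>' l) * int (hdim (U l) X)) - (\<Sum>l\<in>L. int (\<mu> l) * int (hdim (U l) X))"
      using mu nu' fgX by simp
    finally show ?thesis by (simp add: left_diff_distrib sum_subtractf)
  qed
  then show ?thesis by (intro exI[of _ "\<lambda>l. int (\<nu>' l) - int (\<mu> l)"]) blast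
qed

text \<open>The vector \<open>p\<close> below, a basis vector minus a combination of g-vectors, annihilates the dimension
  vectors of the torsion class. By the universal extension it annihilates that of \<open>S k\<close> too, and so has
  entry \<open>0\<close> at \<open>k\<close>, unless some \<open>Q q\<close> maps to \<open>S k\<close>; in that case \<open>Q q\<close> is isomorphic to \<open>PP k\<close>, and
  \<open>c\<close> has entry \<open>0\<close> there. In all cases \<open>p\<close> is orthogonal to \<open>c\<close>.\<close>

theorem orthogonal_to_g_vectors:
  fixes g :: "nat \<Rightarrow> nat \<Rightarrow> int" and c :: "nat \<Rightarrow> int"
  assumes g: "\<And>l X. l \<in> L \<Longrightarrow> torsion X \<Longrightarrow> (\<Sum>i<n. g l i * int (hdim (PP i) X)) = int (hdim (U l) X)"
    and cU: "\<And>l. l \<in> L \<Longrightarrow> (\<Sum>i<n. g l i * c i) = 0"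
    and cQ: "\<And>q k. q \<in> K \<Longrightarrow> k < n \<Longrightarrow> mod_iso (Q q) (PP k) \<Longrightarrow> c k = 0"
    and i: "i < n"
  shows "c i = 0"
proof -
  obtain \<nu> :: "nat \<Rightarrow> int" where nu: "\<And>X. torsion X \<Longrightarrow> int (hdim (PP i) X) = (\<Sum>l\<in>L. \<nu> l * int (hdim (U l) X))"
    using hdim_PP_on_torsion[OF i] by blast
  define p where "p k = (if k = i then 1 else 0) - (\<Sum>l\<in>L. \<nu> l * g l k)" for k
  have pair: "(\<Sum>k<n. p k * x k) = x i - (\<Sum>l\<in>L. \<nu> l * (\<Sum>k<n. g l k * x k))" for x :: "nat \<Rightarrow> int"
  proof -
    have "(\<Sum>k<n. p k * x k) = (\<Sum>k<n. (if k = i then x k else 0)) - (\<Sum>k<n. \<Sum>l\<in>L. \<nu> l * g l k * x k)"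
      unfolding sum_subtractf[symmetric] p_def
      by (intro sum.cong) (auto simp: left_diff_distrib sum_distrib_right)
    also have "(\<Sum>k<n. \<Sum>l\<in>L. \<nu> l * g l k * x k) = (\<Sum>l\<in>L. \<Sum>k<n. \<nu> l * g l k * x k)" by (rule sum.swap)
    also have "\<dots> = (\<Sum>l\<in>L. \<nu> l * (\<Sum>k<n. g l k * x k))" by (simp add: sum_distrib_left mult.assoc)
    finally show ?thesis using i by simp
  qed
  have p_torsion: "(\<Sum>k<n. p k * int (hdim (PP k) X)) = 0" if X: "torsion X" for X
    unfolding pair using nu[OF X] g[OF _ X] by simp
  have "p k * c k = 0" if k: "k < n" for k
  proof (cases "\<exists>q\<in>K. \<not> hom_zero (Q q) (S k)")
    case True
    then obtain q h x where q: "q \<in> K" and h: "mhom (Q q) (S k) h" "x \<in> car (Q q)" "h x \<noteq> 0"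
      unfolding hom_zero_def by blast
    have "mod_iso (Q q) (PP k)"
      by (rule indecomposable_projective_iso_PP[where h = h and x = x, OF Q_projective[OF q] Q_indecomposable[OF q] k h])
    then show ?thesis using cQ[OF q k] by simp
  next
    case False
    then have QS: "hom_zero (Q q) (S k)" if "q \<in> K" for q using that by blast
    obtain X W j r where X: "torsion X" and W: "torsion W" and j: "mhom (S k) X j" "inj_on j (car (S k))"
      and r: "mhom X W r" "\<forall>x\<in>car X. r x = 0 \<longleftrightarrow> x \<in> j ` car (S k)" "r ` car X = car W"
      using universal_extension[OF k QS] by blast
    have add: "hdim (PP m) X = hdim (PP m) (S k) + hdim (PP m) W" if m: "m < n" for m
    proof (rule hdim_exact_covariant[OF PP_fg[OF m] simple_fg[OF S_simple[OF k]] torsion_fg[OF X] torsion_fg[OF W] j r(1)])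
      show "x \<in> car X \<Longrightarrow> r x = 0 \<longleftrightarrow> x \<in> j ` car (S k)" for x using r(2) by blast
      show "\<exists>\<psi>. mhom (PP m) X \<psi> \<and> (\<forall>x\<in>car (PP m). r (\<psi> x) = \<phi> x)" if phi: "mhom (PP m) W \<phi>" for \<phi>
        by (rule projective_lift[OF pc_projective[OF cover[OF m]] torsion_fg[OF X] torsion_right_module[OF W] r(1) phi])
          (use mhom_in[OF phi] r(3) in simp)
    qed
    have "(\<Sum>m<n. p m * int (hdim (PP m) (S k))) = (\<Sum>m<n. p m * int (hdim (PP m) X)) - (\<Sum>m<n. p m * int (hdim (PP m) W))"
      unfolding sum_subtractf[symmetric] using add by (intro sum.cong) (auto simp: algebra_simps)
    also have "\<dots> = 0" using p_torsion[OF X] p_torsion[OF W] by simp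
    finally have z: "(\<Sum>m<n. p m * int (hdim (PP m) (S k))) = 0" .
    have "(\<Sum>m<n. p m * int (hdim (PP m) (S k))) = (\<Sum>m<n. if m = k then p k * int (hdim (PP k) (S k)) else 0)"
      using hdim_PP_S_zero[OF _ k] by (intro sum.cong) auto
    also have "\<dots> = p k * int (hdim (PP k) (S k))" using k by simp
    finally have "p k * int (hdim (PP k) (S k)) = 0" using z by simp
    then show ?thesis using hdim_PP_S_pos[OF k] by simp
  qed
  then have "(\<Sum>k<n. p k * c k) = 0" by (intro sum.neutral) auto
  then show ?thesis unfolding pair using cU by simp
qed

end

section \<open>Sign-coherence of c-vectors\<close>

context indecomposable_projectives
begin

lemma hdim_sum_PP_S:
  assumes k: "k < n" shows "(\<Sum>i<n. x i * int (hdim (PP i) (S k))) = x k * int (hdim (PP k) (S k))"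
proof -
  have "(\<Sum>i<n. x i * int (hdim (PP i) (S k))) = (\<Sum>i<n. if i = k then x k * int (hdim (PP k) (S k)) else 0)"
    using hdim_PP_S_zero[OF _ k] by (intro sum.cong) auto
  then show ?thesis using k by simp
qed

text \<open>Pairing with the simple modules \<open>S m\<close> isolates the entries of a g-vector.\<close>

lemma g_vector_PP:
  assumes g: "is_g_vector n PP Q g" and Q: "projective Q" and iso: "mod_iso Q (PP k)" and k: "k < n" and m: "m < n"
  shows "g $ m = (if m = k then 1 else 0)"
proof -
  note fgS = simple_fg[OF S_simple[OF m]]
  obtain P1 f P0 e where pres: "min_proj_presentation P1 f P0 e Q"
    and pair: "\<forall>X :: ('k, 'a) umod. fg_module X \<longrightarrow> extends_along P1 f P0 X \<longrightarrow>
      (\<Sum>i<n. g $ i * int (hdim (PP i) X)) = int (hdim Q X)"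
    using g_vector_pairing[OF g] by blast
  have "g $ m * int (hdim (PP m) (S m)) = int (hdim Q (S m))"
    using pair[rule_format, OF fgS projective_extends_along[OF pres Q S_right_module[OF m]]]
    unfolding hdim_sum_PP_S[OF m, of "\<lambda>i. g $ i"] .
  also have "\<dots> = int (hdim (PP k) (S m))" using hdim_iso[OF projective_fg[OF Q] PP_fg[OF k] fgS iso] by simp
  finally have e: "g $ m * int (hdim (PP m) (S m)) = int (hdim (PP k) (S m))" .
  show ?thesis using e hdim_PP_S_pos[OF m] hdim_PP_S_zero[OF k m] by (cases "m = k") auto
qed

text \<open>Leaving out the summand with index \<open>j\<close> gives a tau-rigid pair. Either its torsion class contains a nonzero
  \<open>X\<close> orthogonal to the \<open>U l\<close>, whose dimension vector is a multiple of \<open>c\<close>, or \<open>c\<close> is zero, which is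
  impossible for a column of an invertible matrix.\<close>

theorem c_vector_sign_coherent:
  assumes c: "c_vector n PP c"
  shows "(\<forall>i<n. 0 \<le> c $ i) \<or> (\<forall>i<n. c $ i \<le> 0)"
proof -
  obtain M P C j where MP: "basic_support_tau_tilting_pair n M P" and C: "is_C_matrix n PP M P C"
    and j: "j < n" and c: "c = col C j"
    using c unfolding c_vector_def by blast
  have tau: "tau_rigid M" and P: "projective P" and PM: "hom_zero P M"
    using MP unfolding basic_support_tau_tilting_pair_def support_tau_tilting_pair_def tau_rigid_pair_def by blast+
  obtain G where Cn: "C \<in> carrier_mat n n" and G: "is_G_matrix n PP M P G"
    and inv: "inverts_mat (transpose_mat G) C" "inverts_mat C (transpose_mat G)"
    using C unfolding is_C_matrix_def by blast
  obtain t N Qs where Gn: "G \<in> carrier_mat n n" and t: "t \<le> n" and N: "indec_decomp M t N"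
    and Qs: "indec_decomp P (n - t) Qs" and gM: "\<forall>i<t. is_g_vector n PP (submod M (N i)) (col G i)"
    and gP: "\<forall>i<n - t. is_g_vector n PP (submod P (Qs i)) (- col G (t + i))"
    using G unfolding is_G_matrix_def by blast
  have GC: "(\<Sum>i<n. G $$ (i, l) * C $$ (i, k)) = (if l = k then 1 else 0)" if "l < n" "k < n" for l k
  proof -
    have "transpose_mat G * C = 1\<^sub>m n" using inv(1) Gn unfolding inverts_mat_def by simp
    then have "(transpose_mat G * C) $$ (l, k) = (if l = k then 1 else 0)" using that by simp
    then show ?thesis using that Gn Cn by (simp add: scalar_prod_def atLeast0LessThan)
  qed
  have CG: "(\<Sum>l<n. C $$ (i, l) * G $$ (k, l)) = (if i = k then 1 else 0)" if "i < n" "k < n" for i k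
  proof -
    have "C * transpose_mat G = 1\<^sub>m n" using inv(2) Cn unfolding inverts_mat_def by simp
    then have "(C * transpose_mat G) $$ (i, k) = (if i = k then 1 else 0)" using that by simp
    then show ?thesis using that Gn Cn by (simp add: scalar_prod_def atLeast0LessThan)
  qed
  have fgM: "fg_module M" using tau unfolding tau_rigid_def by blast
  note M' = fg_right_module[OF fgM] and P' = fg_right_module[OF projective_fg[OF P]]
  obtain \<pi> where bpM: "biproduct M t (\<lambda>i. submod M (N i)) (\<lambda>i x. x) \<pi>" using indec_decomp_biproduct[OF M' N] by blast
  obtain \<pi>' where bpP: "biproduct P (n - t) (\<lambda>i. submod P (Qs i)) (\<lambda>i x. x) \<pi>'"
    using indec_decomp_biproduct[OF P' Qs] by blast
  define U where "U i = submod M (N i)" for i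
  define Q where "Q i = submod P (Qs i)" for i
  note bpM = bpM[folded U_def] and bpP = bpP[folded Q_def]
  define L where "L = {i. i < t \<and> i \<noteq> j}"
  define K where "K = {i. i < n - t \<and> t + i \<noteq> j}"
  have prQ: "projective (Q i)" if "i < n - t" for i using projective_summand[OF P bpP that] .
  \<comment> \<open>For each summand, fix the presentation by which its g-vector is computed.\<close>
  define pres_pairing where "pres_pairing i P1 f P0 e \<longleftrightarrow> min_proj_presentation P1 f P0 e (U i) \<and>
      (\<forall>X :: ('k, 'a) umod. fg_module X \<longrightarrow> extends_along P1 f P0 X \<longrightarrow>
        (\<Sum>m<n. col G i $ m * int (hdim (PP m) X)) = int (hdim (U i) X))" for i P1 f P0 e
  have "\<forall>i. \<exists>P1 f P0 e. i < t \<longrightarrow> pres_pairing i P1 f P0 e"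
  proof
    fix i
    show "\<exists>P1 f P0 e. i < t \<longrightarrow> pres_pairing i P1 f P0 e"
      using g_vector_pairing[of "U i" "col G i"] gM unfolding U_def pres_pairing_def by blast
  qed
  then have "\<exists>P1 f P0 e. \<forall>i. i < t \<longrightarrow> pres_pairing i (P1 i) (f i) (P0 i) (e i)"
    by (simp only: choice_iff)
  then obtain P1 f P0 e where chosen: "\<forall>i. i < t \<longrightarrow> pres_pairing i (P1 i) (f i) (P0 i) (e i)" by blast
  have pres: "min_proj_presentation (P1 i) (f i) (P0 i) (e i) (U i)" if "i < t" for i
    using chosen that unfolding pres_pairing_def by blast
  have pair: "(\<Sum>m<n. col G i $ m * int (hdim (PP m) X)) = int (hdim (U i) X)"
    if "i < t" "fg_module X" "extends_along (P1 i) (f i) (P0 i) X" for i and X :: "('k, 'a) umod"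
    using chosen that unfolding pres_pairing_def by blast
  obtain R1 r R0 d where presM: "min_proj_presentation R1 r R0 d M" and extM: "extends_along R1 r R0 M"
    using tau_rigid_extends_along[OF tau] by blast
  interpret F: rigid_family scale n S PP top L U P1 P0 f e K Q
  proof unfold_locales
    show "finite L" unfolding L_def by simp
    fix l assume "l \<in> L"
    then have l: "l < t" unfolding L_def by blast
    show "min_proj_presentation (P1 l) (f l) (P0 l) (e l) (U l)" by (rule pres[OF l])
    show "indecomposable (U l)" using N l unfolding U_def indec_decomp_def by blast
    have ext: "extends_along (P1 l) (f l) (P0 l) M"
      by (rule extends_along_summand[OF presM pres[OF l] bp_inj[OF bpM l] bp_proj[OF bpM l] _ extM])
        (use bp_proj_inj[OF bpM l l] in simp)
    fix l' assume "l' \<in> L"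
    then have l': "l' < t" unfolding L_def by blast
    show "extends_along (P1 l) (f l) (P0 l) (U l')"
    proof (rule extends_along_quotient[OF _ fgM bp_right_module[OF bpM l'] bp_proj[OF bpM l'] _ ext])
      show "projective (P1 l)" by (rule pc_projective[OF mpp_cover1[OF pres[OF l]]])
      show "\<pi> l' ` car M = car (U l')"
      proof (intro subset_antisym subsetI)
        show "x \<in> car (U l')" if "x \<in> \<pi> l' ` car M" for x using that mhom_in[OF bp_proj[OF bpM l']] by blast
        show "x \<in> \<pi> l' ` car M" if "x \<in> car (U l')" for x
          using bp_proj_inj[OF bpM l' l' that] mhom_in[OF bp_inj[OF bpM l'] that] by (metis image_eqI)
      qed
    qed
  next
    fix q assume "q \<in> K"
    then have q: "q < n - t" unfolding K_def by blast
    show "projective (Q q)" by (rule prQ[OF q])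
    show "indecomposable (Q q)" using Qs q unfolding Q_def indec_decomp_def by blast
    fix l assume "l \<in> L"
    then have l: "l < t" unfolding L_def by blast
    show "hom_zero (Q q) (U l)"
      unfolding hom_zero_def
    proof (intro allI impI ballI)
      fix h x assume h: "mhom (Q q) (U l) h" and x: "x \<in> car (Q q)"
      have "mhom P M (\<lambda>y. h (\<pi>' q y))" by (rule mhom_comp[OF mhom_comp[OF bp_proj[OF bpP q] h] bp_inj[OF bpM l]])
      then have "h (\<pi>' q x) = 0" using PM mhom_in[OF bp_inj[OF bpP q] x] unfolding hom_zero_def by blast
      then show "h x = 0" using bp_proj_inj[OF bpP q q x] by simp
    qed
  qed
  show ?thesis
  proof (cases "\<exists>X. F.torsion X \<and> (\<forall>l\<in>L. hom_zero (U l) X) \<and> car X \<noteq> {0}")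
    case True
    then obtain X where X: "F.torsion X" and UX: "\<And>l. l \<in> L \<Longrightarrow> hom_zero (U l) X" and nz: "car X \<noteq> {0}" by blast
    note fgX = F.torsion_fg[OF X] and X' = F.torsion_right_module[OF X]
    \<comment> \<open>The dimension vector of \<open>X\<close> is \<open>C\<close> applied to \<open>y\<close>, and only entry \<open>j\<close> of \<open>y\<close> is nonzero.\<close>
    define y where "y l = (\<Sum>m<n. G $$ (m, l) * int (hdim (PP m) X))" for l
    have y0: "y l = 0" if l: "l < n" "l \<noteq> j" for l
    proof (cases "l < t")
      case True
      then have lL: "l \<in> L" using l unfolding L_def by blast
      then have "extends_along (P1 l) (f l) (P0 l) X" using X unfolding F.torsion_def by blast
      then have "(\<Sum>m<n. col G l $ m * int (hdim (PP m) X)) = int (hdim (U l) X)" by (rule pair[OF True fgX])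
      then show ?thesis unfolding y_def using hdim_eq_0[OF X' UX[OF lL]] Gn l(1) by simp
    next
      case False
      define q where "q = l - t"
      have q: "q < n - t" "q \<in> K" "t + q = l" using False l unfolding q_def K_def by auto
      obtain Q1 h Q0 u where pr: "min_proj_presentation Q1 h Q0 u (Q q)"
        and pa: "\<forall>X :: ('k, 'a) umod. fg_module X \<longrightarrow> extends_along Q1 h Q0 X \<longrightarrow>
          (\<Sum>i<n. (- col G l) $ i * int (hdim (PP i) X)) = int (hdim (Q q) X)"
        using g_vector_pairing[of "Q q" "- col G l"] gP q unfolding Q_def by blast
      have "hom_zero (Q q) X" using X q(2) unfolding F.torsion_def by blast
      then have "(\<Sum>i<n. (- col G l) $ i * int (hdim (PP i) X)) = 0"
        using pa fgX projective_extends_along[OF pr prQ[OF q(1)] X'] hdim_eq_0[OF X'] by simp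
      then show ?thesis unfolding y_def using Gn l(1) by (simp add: sum_negf)
    qed
    have d: "int (hdim (PP i) X) = C $$ (i, j) * y j" if i: "i < n" for i
    proof -
      have "int (hdim (PP i) X) = (\<Sum>m<n. (if i = m then 1 else 0) * int (hdim (PP m) X))"
      proof -
        have "(\<Sum>m<n. (if i = m then 1 else 0) * int (hdim (PP m) X)) = (\<Sum>m<n. if m = i then int (hdim (PP i) X) else 0)"
          by (intro sum.cong) auto
        then show ?thesis using i by simp
      qed
      also have "\<dots> = (\<Sum>m<n. (\<Sum>l<n. C $$ (i, l) * G $$ (m, l)) * int (hdim (PP m) X))"
        using CG[OF i] by (intro sum.cong) auto
      also have "\<dots> = (\<Sum>m<n. \<Sum>l<n. C $$ (i, l) * (G $$ (m, l) * int (hdim (PP m) X)))"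
        by (simp add: sum_distrib_right mult.assoc)
      also have "\<dots> = (\<Sum>l<n. \<Sum>m<n. C $$ (i, l) * (G $$ (m, l) * int (hdim (PP m) X)))" by (rule sum.swap)
      also have "\<dots> = (\<Sum>l<n. C $$ (i, l) * y l)" unfolding y_def by (simp add: sum_distrib_left)
      also have "\<dots> = (\<Sum>l<n. if l = j then C $$ (i, j) * y j else 0)"
        using y0 by (intro sum.cong) auto
      also have "\<dots> = C $$ (i, j) * y j" using j by simp
      finally show ?thesis .
    qed
    obtain i h p where i: "i < n" and h: "mhom (PP i) X h" "p \<in> car (PP i)" "h p \<noteq> 0"
      using exists_hom_from_PP[OF fgX nz] by blast
    have "0 < hdim (PP i) X" by (rule hdim_pos[where f = h and x = p, OF PP_fg[OF i] fgX h])
    then have yj: "y j \<noteq> 0" using d[OF i] by auto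
    have ci: "c $ i = C $$ (i, j)" if "i < n" for i using that j Cn c by simp
    have nn: "0 \<le> c $ i * y j" if "i < n" for i using d[OF that] ci[OF that] by (metis of_nat_0_le_iff)
    show ?thesis
    proof (cases "0 < y j")
      case True
      then show ?thesis using nn by (meson zero_le_mult_iff not_le)
    next
      case False
      then have "y j < 0" using yj by simp
      then show ?thesis using nn by (meson zero_le_mult_iff not_le)
    qed
  next
    case False
    interpret T: rigid_family_generating scale n S PP top L U P1 P0 f e K Q
      by unfold_locales (use False in blast)
    have c0: "C $$ (i, j) = 0" if i: "i < n" for i
    proof (rule T.orthogonal_to_g_vectors[where g = "\<lambda>l i. G $$ (i, l)" and c = "\<lambda>i. C $$ (i, j)", OF _ _ _ i])
      fix l assume "l \<in> L"
      then have l: "l < t" "l < n" "l \<noteq> j" using t unfolding L_def by auto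
      show "(\<Sum>i<n. G $$ (i, l) * C $$ (i, j)) = 0" using GC[OF l(2) j] l(3) by simp
      fix X assume X: "F.torsion X"
      have "extends_along (P1 l) (f l) (P0 l) X" using X \<open>l \<in> L\<close> unfolding F.torsion_def by blast
      then have "(\<Sum>m<n. col G l $ m * int (hdim (PP m) X)) = int (hdim (U l) X)"
        by (rule pair[OF l(1) F.torsion_fg[OF X]])
      then show "(\<Sum>i<n. G $$ (i, l) * int (hdim (PP i) X)) = int (hdim (U l) X)" using Gn l(2) by simp
    next
      fix q k assume "q \<in> K" and k: "k < n" and iso: "mod_iso (Q q) (PP k)"
      then have q: "q < n - t" "t + q < n" "t + q \<noteq> j" unfolding K_def by auto
      have g: "is_g_vector n PP (Q q) (- col G (t + q))" using gP q(1) unfolding Q_def by blast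
      have Gq: "G $$ (m, t + q) = (if m = k then - 1 else 0)" if m: "m < n" for m
        using g_vector_PP[OF g prQ[OF q(1)] iso k m] Gn q(2) m by (auto split: if_splits)
      have "(\<Sum>i<n. G $$ (i, t + q) * C $$ (i, j)) = (\<Sum>i<n. if i = k then - C $$ (k, j) else 0)"
        using Gq by (intro sum.cong) auto
      also have "\<dots> = - C $$ (k, j)" using k by simp
      finally show "C $$ (k, j) = 0" using GC[OF q(2) j] q(3) by simp
    qed
    have "(\<Sum>i<n. G $$ (i, j) * C $$ (i, j)) = 0" using c0 by simp
    then show ?thesis using GC[OF j j] by simp
  qed
qed

end

theorem theorem3p1:
  fixes scale :: "'k::alg_closed_field \<Rightarrow> 'a::{ring,monoid_mult} \<Rightarrow> 'a"
    and n :: nat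
    and S PP :: "nat \<Rightarrow> ('k, 'a) umod"
    and c :: "int vec"
  assumes "fd_algebra scale"
    and "fd_algebra.basic_algebra scale"
    and "fd_algebra.simple_representatives scale n S"
    and "\<forall>i<n. \<exists>\<pi>. fd_algebra.projective_cover scale (PP i) \<pi> (S i)"
    and "fd_algebra.c_vector scale n PP c"
  shows "(\<forall>i<n. 0 \<le> c $ i) \<or> (\<forall>i<n. c $ i \<le> 0)"
proof -
  interpret fd_algebra scale by (fact assms(1))
  have "\<forall>i\<in>{..<n}. \<exists>\<pi>. projective_cover (PP i) \<pi> (S i)" using assms(4) by simp
  from bchoice[OF this] obtain top where top: "\<forall>i\<in>{..<n}. projective_cover (PP i) (top i) (S i)" by blast
  interpret indecomposable_projectives scale n S PP top
    by unfold_locales (use assms(3) top in auto)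
  show ?thesis by (rule c_vector_sign_coherent[OF assms(5)])
qed

end
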